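(* In the random graph setting described in the context, suppose there exist $\lambda_0>1$ and a function $p(\lambda)$ with $p(\lambda)\to0$ as $\lambda\to\infty$ such that $\mathbb P(R\in J(\lambda))\ge1-p(\lambda)$ for each $R\ge1$, $\lambda\ge\lambda_0$. (I) Suppose there exist $q_0,c>0$ such that $p(\lambda)\le c\lambda^{-q_0}$. Then there exist $\beta_1,\beta_2,\beta_3,\beta_4<\infty$ and a set $\Omega_0\subset\Omega$ with $\mathbb P(\Omega_0)=1$ such that the following hold. (a) For each $\omega\in\Omega_0$ and $x\in G(\omega)$ there exists $N_x(\omega)<\infty$ such that $$\frac{(\log n)^{-\beta_1}}{v(\mathcal I(n))}\le p^\omega_{2n}(x,x)\le\frac{(\log n)^{\beta_1}}{v(\mathcal I(n))},\quad n\ge N_x(\omega).$$ (b) For each $\omega\in\Omega_0$ and $x\in G(\omega)$ there exists $R_x(\omega)<\infty$ such that $$(\log R)^{-\beta_2}v(R)r(R)\le E^x_\omega\tau_R\le(\log R)^{\beta_2}v(R)r(R),\quad R\ge R_x(\omega).$$ (c) Let $Y_n=\max_{0\le k\le n}d(0,X_k)$. For each $\omega\in\Omega_0$ and $x\in G(\omega)$ there exist random variables $N_x(\omega,\overline\omega)$, $R_x(\omega,\overline\omega)$ with $P^x_\omega(N_x<\infty)=P^x_\omega(R_x<\infty)=1$ such that $$(\log n)^{-\beta_3}\mathcal I(n)\le Y_n(\omega,\overline\omega)\le(\log n)^{\beta_3}\mathcal I(n),\quad n\ge N_x(\omega,\overline\omega),$$ $$(\log R)^{-\beta_4}v(R)r(R)\le\tau_R(\omega,\overline\omega)\le(\log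 R)^{\beta_4}v(R)r(R),\quad R\ge R_x(\omega,\overline\omega).$$ (II) Suppose there exist $q_0,c>0$ such that $p(\lambda)\le\exp(-c\lambda^{q_0})$. Then there exist $\beta_1,\beta_2<\infty$ and $\Omega_0$ with $\mathbb P(\Omega_0)=1$ such that for each $\omega\in\Omega_0$ and $x\in G(\omega)$ there exist $N_x(\omega),R_x(\omega)<\infty$ with $$\frac{(\log\log n)^{-\beta_1}}{v(\mathcal I(n))}\le p^\omega_{2n}(x,x)\le\frac{(\log\log n)^{\beta_1}}{v(\mathcal I(n))},\quad n\ge N_x(\omega),$$ $$(\log\log R)^{-\beta_2}v(R)r(R)\le E^x_\omega\tau_R\le(\log\log R)^{\beta_2}v(R)r(R),\quad R\ge R_x(\omega).$$ (III) Suppose there exist $q_0,c>0$ such that $p(\lambda)\le c\lambda^{-q_0}$, and suppose further that, for all $R\ge2$, $$C_3^{-1}R^D(\log R)^{-m_1}\le v(R)\le C_3R^D(\log R)^{m_1},\qquad C_4^{-1}R^\alpha(\log R)^{-m_2}\le r(R)\le C_4R^\alpha(\log R)^{m_2},$$ where $C_3,C_4\ge1$, $D\ge1$, $0<\alpha\le1$ and $m_1,m_2>0$. Then there is $\Omega_0$ with $\mathbb P(\Omega_0)=1$ such that for each $\omega\in\Omega_0$ and $x\in G(\omega)$: (a) $d_s(G(\omega)):=-2\lim_{n\to\infty}\dfrac{\log p^\omega_{2n}(x,x)}{\log n}=\dfrac{2D}{D+\alpha}$, and the random walk is recurrent; (b) $\lim_{R\to\infty}\dfrac{\log E^x_\omega\tau_R}{\log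 R}=D+\alpha$; (c) with $W_n=\{X_0,X_1,\dots,X_n\}$ and $S_n=\mu(W_n)=\sum_{y\in W_n}\mu_y$, $$\lim_{n\to\infty}\frac{\log S_n}{\log n}=\frac{D}{D+\alpha},\quad P^x_\omega\text{-a.s.}$$
   Context: Random graphs. $(\Omega,\mathcal F,\mathbb P)$ is a probability space carrying a family of random graphs $\Gamma(\omega)=(G(\omega),E(\omega))$, $\omega\in\Omega$; for each $\omega$ the graph $\Gamma(\omega)$ is (unoriented) infinite, locally finite, connected, and contains a marked vertex $0$. $d=d_\omega$ is a metric on $G(\omega)$ (any metric, not necessarily the graph distance). $\mu_x$ is the number of edges containing $x$, extended to a measure $\mu$ on $G$; $B(x,R)=\{y:d(x,y)<R\}$, $B(R)=B(0,R)$, $V(R)=\mu(B(R))$. Random walk. $X=(X_n,n\ge0,P^x_\omega,x\in G(\omega))$ is the discrete-time simple random walk on $\Gamma(\omega)$ ($P^x_\omega(X_1=y)=1/\mu_x$ for $y\sim x$), with expectation $E^x_\omega$, defined on a product $\Omega\times\overline\Omega$ with $\overline\omega\in\overline\Omega$ carrying the randomness of the walk; $p^\omega_n(x,y)=P^x_\omega(X_n=y)/\mu_y$. $\tau_R=\min\{n\ge0:X_n\notin B(R)\}$ (exit time from the ball centred at $0$, whatever the starting point). Effective resistance. $\mathcal E(f,g)=\frac12\sum_{x\sim y}(f(x)-f(y))(g(x)-g(y))$ (sum over ordered pairs), $H^2=\{f\in\mathbb R^G:\mathcal E(f,f)<\infty\}$; for disjoint $A,B\subset G$, $R_{\rm eff}(A,B)^{-1}=\inf\{\mathcal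 E(f,f):f\in H^2,f|_A=1,f|_B=0\}$; $R_{\rm eff}(x,y)=R_{\rm eff}(\{x\},\{y\})$, $R_{\rm eff}(x,x)=0$. Growth functions. $v,r:[0,\infty]\to[0,\infty]$ are continuous strictly increasing functions with $v(0)=r(0)=0$, $v(1)=r(1)=1$, $v(\infty)=r(\infty)=\infty$, and for all $0<R'\le R<\infty$ $$C_1^{-1}(R/R')^{d_1}\le \frac{v(R)}{v(R')}\le C_1(R/R')^{d_2},\qquad C_2^{-1}(R/R')^{\alpha_1}\le \frac{r(R)}{r(R')}\le C_2(R/R')^{\alpha_2},$$ where $C_1,C_2\ge1$, $1\le d_1\le d_2$, $0<\alpha_1\le\alpha_2\le1$. $\mathcal I$ is the inverse function of $R\mapsto v(R)r(R)$. Good radii. For $\lambda>1$, $J(\lambda)$ is the (random) set of $R\in[1,\infty]$ such that $\lambda^{-1}v(R)\le V(R)\le\lambda v(R)$, $R_{\rm eff}(0,B(R)^c)\ge\lambda^{-1}r(R)$, and $R_{\rm eff}(0,y)\le\lambda r(d(0,y))$ for all $y\in B(R)$. *)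

theory Defs
  imports "HOL-Probability.Probability"
begin

text \<open>
  An unoriented graph is a vertex set \<open>G\<close> with a set \<open>E\<close> of unordered pairs of vertices.
  Loops \<open>{x}\<close> are not excluded; a loop counts once in the degree, consistently with a walk that
  follows each edge at its current vertex with equal probability.
\<close>

definition adj :: "'v set set \<Rightarrow> 'v \<Rightarrow> 'v \<Rightarrow> bool" where
  "adj E x y \<longleftrightarrow> {x, y} \<in> E"

definition deg :: "'v set set \<Rightarrow> 'v \<Rightarrow> nat" where
  "deg E x = card {e \<in> E. x \<in> e}"

definition marked_metric_graph ::
  "'v set \<Rightarrow> 'v set set \<Rightarrow> 'v \<Rightarrow> ('v \<Rightarrow> 'v \<Rightarrow> real) \<Rightarrow> bool" where
  "marked_metric_graph G E z d \<longleftrightarrow>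
     E \<subseteq> {{x, y} | x y. x \<in> G \<and> y \<in> G} \<and>
     infinite G \<and>
     (\<forall>x\<in>G. finite {e \<in> E. x \<in> e}) \<and>
     (\<forall>x\<in>G. \<forall>y\<in>G. (adj E)\<^sup>*\<^sup>* x y) \<and>
     z \<in> G \<and>
     Metric_space G d"

text \<open>
  Radii lie in \<open>[0, \<infinity>]\<close>, and balls may be infinite sets, so that volumes and
  resistances are \<open>ennreal\<close>-valued.
\<close>

definition gball :: "'v set \<Rightarrow> ('v \<Rightarrow> 'v \<Rightarrow> real) \<Rightarrow> 'v \<Rightarrow> ennreal \<Rightarrow> 'v set" where
  "gball G d x R = {y \<in> G. ennreal (d x y) < R}"

definition deg_measure :: "'v set \<Rightarrow> 'v set set \<Rightarrow> 'v measure" where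
  "deg_measure G E = point_measure G (\<lambda>x. of_nat (deg E x))"

definition volume ::
  "'v set \<Rightarrow> 'v set set \<Rightarrow> 'v \<Rightarrow> ('v \<Rightarrow> 'v \<Rightarrow> real) \<Rightarrow> ennreal \<Rightarrow> ennreal" where
  "volume G E z d R = emeasure (deg_measure G E) (gball G d z R)"

text \<open>
  The diagonal \<open>\<E>(f, f)\<close> of the Dirichlet form, as a sum over ordered pairs with values in
  \<open>[0, \<infinity>]\<close>; only the values of \<open>f\<close> on the vertices matter.
\<close>

definition energy :: "'v set set \<Rightarrow> ('v \<Rightarrow> real) \<Rightarrow> ennreal" where
  "energy E f =
     (\<integral>\<^sup>+ (x, y). ennreal ((f x - f y)\<^sup>2) \<partial>count_space {(x, y). adj E x y}) / 2"

definition H2 :: "'v set set \<Rightarrow> ('v \<Rightarrow> real) set" where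
  "H2 E = {f. energy E f < \<infinity>}"

text \<open>The conventions \<open>inverse 0 = \<infinity>\<close> and \<open>inverse \<infinity> = 0\<close> of \<open>ennreal\<close> are the intended ones.\<close>

definition R_eff :: "'v set set \<Rightarrow> 'v set \<Rightarrow> 'v set \<Rightarrow> ennreal" where
  "R_eff E A B =
     inverse (INF f \<in> {f \<in> H2 E. (\<forall>x\<in>A. f x = 1) \<and> (\<forall>x\<in>B. f x = 0)}. energy E f)"

definition R_eff_pt :: "'v set set \<Rightarrow> 'v \<Rightarrow> 'v \<Rightarrow> ennreal" where
  "R_eff_pt E x y = (if x = y then 0 else R_eff E {x} {y})"

definition growth_function :: "(ennreal \<Rightarrow> ennreal) \<Rightarrow> real \<Rightarrow> real \<Rightarrow> real \<Rightarrow> bool" where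
  "growth_function f C a b \<longleftrightarrow>
     continuous_on UNIV f \<and> strict_mono f \<and> f 0 = 0 \<and> f 1 = 1 \<and> f \<infinity> = \<infinity> \<and>
     (\<forall>R' R :: real. 0 < R' \<and> R' \<le> R \<longrightarrow>
        ennreal (inverse C * (R / R') powr a) \<le> f (ennreal R) / f (ennreal R') \<and>
        f (ennreal R) / f (ennreal R') \<le> ennreal (C * (R / R') powr b))"

text \<open>
  For growth functions \<open>v\<close> and \<open>r\<close>, the map \<open>R \<mapsto> v R * r R\<close> is a bijection of \<open>[0, \<infinity>]\<close>, so this is
  its inverse function.
\<close>

definition time_inverse :: "(ennreal \<Rightarrow> ennreal) \<Rightarrow> (ennreal \<Rightarrow> ennreal) \<Rightarrow> ennreal \<Rightarrow> ennreal" where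
  "time_inverse v r = inv (\<lambda>R. v R * r R)"

definition good_radii ::
  "'v set \<Rightarrow> 'v set set \<Rightarrow> 'v \<Rightarrow> ('v \<Rightarrow> 'v \<Rightarrow> real) \<Rightarrow> (ennreal \<Rightarrow> ennreal) \<Rightarrow> (ennreal \<Rightarrow> ennreal)
     \<Rightarrow> real \<Rightarrow> ennreal set" where
  "good_radii G E z d v r l =
     {R. 1 \<le> R \<and>
         ennreal (inverse l) * v R \<le> volume G E z d R \<and>
         volume G E z d R \<le> ennreal l * v R \<and>
         ennreal (inverse l) * r R \<le> R_eff E {z} (G - gball G d z R) \<and>
         (\<forall>y \<in> gball G d z R. R_eff_pt E z y \<le> ennreal l * r (ennreal (d z y)))}"

definition step_prob :: "'v set set \<Rightarrow> 'v \<Rightarrow> 'v \<Rightarrow> real" where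
  "step_prob E x y = (if adj E x y then 1 / real (deg E x) else 0)"

text \<open>
  \<open>N\<close> only serves as a measurable space; under \<open>P x\<close> the process \<open>X\<close> is the Markov chain started
  at \<open>x\<close> with transition probabilities \<open>step_prob E\<close>. The Markov property is written
  in product form to avoid conditioning on null events.
\<close>

definition simple_random_walk ::
  "'v set \<Rightarrow> 'v set set \<Rightarrow> 'b measure \<Rightarrow> (nat \<Rightarrow> 'b \<Rightarrow> 'v) \<Rightarrow> ('v \<Rightarrow> 'b measure) \<Rightarrow> bool" where
  "simple_random_walk G E N X P \<longleftrightarrow>
     (\<forall>n. X n \<in> N \<rightarrow>\<^sub>M count_space G) \<and>
     (\<forall>x\<in>G.
        prob_space (P x) \<and> sets (P x) = sets N \<and>
        measure (P x) {b \<in> space N. X 0 b = x} = 1 \<and>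
        (\<forall>n u. measure (P x) {b \<in> space N. \<forall>i\<le>Suc n. X i b = u i} =
               measure (P x) {b \<in> space N. \<forall>i\<le>n. X i b = u i} * step_prob E (u n) (u (Suc n))))"

definition heat_kernel ::
  "'v set set \<Rightarrow> (nat \<Rightarrow> 'b \<Rightarrow> 'v) \<Rightarrow> ('v \<Rightarrow> 'b measure) \<Rightarrow> nat \<Rightarrow> 'v \<Rightarrow> 'v \<Rightarrow> real" where
  "heat_kernel E X P n x y = measure (P x) {b \<in> space (P x). X n b = y} / real (deg E y)"

definition exit_time ::
  "'v set \<Rightarrow> 'v \<Rightarrow> ('v \<Rightarrow> 'v \<Rightarrow> real) \<Rightarrow> (nat \<Rightarrow> 'b \<Rightarrow> 'v) \<Rightarrow> real \<Rightarrow> 'b \<Rightarrow> ennreal" where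
  "exit_time G z d X R b =
     (INF n \<in> {n. X n b \<notin> gball G d z (ennreal R)}. of_nat n)"

definition mean_exit_time ::
  "'v set \<Rightarrow> 'v \<Rightarrow> ('v \<Rightarrow> 'v \<Rightarrow> real) \<Rightarrow> (nat \<Rightarrow> 'b \<Rightarrow> 'v) \<Rightarrow> ('v \<Rightarrow> 'b measure) \<Rightarrow> 'v \<Rightarrow> real
     \<Rightarrow> ennreal" where
  "mean_exit_time G z d X P x R = (\<integral>\<^sup>+ b. exit_time G z d X R b \<partial>P x)"

definition max_displacement ::
  "'v \<Rightarrow> ('v \<Rightarrow> 'v \<Rightarrow> real) \<Rightarrow> (nat \<Rightarrow> 'b \<Rightarrow> 'v) \<Rightarrow> nat \<Rightarrow> 'b \<Rightarrow> real" where
  "max_displacement z d X n b = Max ((\<lambda>k. d z (X k b)) ` {0..n})"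

definition range_volume :: "'v set set \<Rightarrow> (nat \<Rightarrow> 'b \<Rightarrow> 'v) \<Rightarrow> nat \<Rightarrow> 'b \<Rightarrow> real" where
  "range_volume E X n b = (\<Sum>y \<in> (\<lambda>k. X k b) ` {0..n}. real (deg E y))"

definition recurrent_walk :: "'v set \<Rightarrow> (nat \<Rightarrow> 'b \<Rightarrow> 'v) \<Rightarrow> ('v \<Rightarrow> 'b measure) \<Rightarrow> bool" where
  "recurrent_walk G X P \<longleftrightarrow> (\<forall>y\<in>G. AE b in P y. \<exists>n\<ge>1. X n b = y)"

end

theory Submission
  imports Defs "HOL-Real_Asymp.Real_Asymp"
begin

text \<open>The resistance bounds that define a good radius \<open>R\<close> enter in two ways only. By the definition of the
effective resistance as an infimum, \<open>R_eff(0, y) \<le> \<lambda> r(d(0, y))\<close> means that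
\<open>(f 0 - f y)\<^sup>2 \<le> \<lambda> r(d(0, y)) \<E>(f, f)\<close> for all \<open>f\<close>, and the lower bound on the resistance to the complement
of the ball provides a function of small energy that is 1 at the marked vertex and 0 off the ball. Let \<open>g\<close> be
the Green function of the walk killed on leaving the ball \<open>B\<close>. It has the reproducing property
\<open>\<E>(f, g(x, \<cdot>)) = f x\<close> for \<open>f\<close> supported in \<open>B\<close> (\<open>dir_green\<close>), so these bounds can be applied to Green
functions themselves; all orders of magnitude are up to powers of \<open>\<lambda>\<close>. Since \<open>g(x, \<cdot>)\<close> vanishes at a
vertex just outside \<open>B\<close>, \<open>g(x, x)\<close> is at most of order \<open>r R\<close> (\<open>partial_green_bound\<close>), and since its oscillation over a somewhat smaller ball is negligible, \<open>g(x, y)\<close>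
is at least of order \<open>r R\<close> there (\<open>green_lower\<close>). Summing over \<open>y\<close> shows that mean exit times are of order
\<open>w R = v R * r R\<close>. The upper bound is proved for the partial sums of the series that defines \<open>g\<close>, so that it
also shows that the series converges.

For the heat kernel at time \<open>2 n\<close>, the sum of two consecutive kernels \<open>f = p_k(x, \<cdot>) + p_(k+1)(x, \<cdot>)\<close>
is at most \<open>2 / V(R)\<close> somewhere in the ball, and its energy is a difference in \<open>k\<close>, hence of order
\<open>f x / n\<close> for some \<open>k\<close> between \<open>n\<close> and \<open>2 n\<close>; the oscillation bound then controls \<open>f x\<close>
(\<open>on_diagonal_upper\<close>). The lower bound is Cauchy and Schwarz combined with a lower bound on the probability of
surviving in the ball (\<open>on_diagonal_lower\<close>, \<open>mean_exit_le_survival\<close>).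

Two facts are specific to the path. Exiting the ball before time \<open>n\<close> has probability at most the expected
number of visits to the starting point before \<open>n\<close>, divided by the expected number of visits before the exit
(\<open>early_exit_le\<close>); with the heat kernel bound this is small if \<open>n\<close> is well below \<open>w R\<close>. And \<open>y\<close> is hit
before the exit with probability \<open>g(x, y) / g(y, y)\<close>, which is close to 1 on the smaller ball; this gives
recurrence and shows that the range fills most of the smaller ball (\<open>prob_avoid_le\<close>, \<open>prob_range_volume\<close>).

All changes of radius are by factors that are powers of \<open>\<lambda>\<close>, so all losses are powers of \<open>\<lambda>\<close>. By Borel and
Cantelli there are numbers \<open>L j\<close>, powers of \<open>j\<close> if \<open>p\<close> decays polynomially and powers of \<open>log j\<close> if it
decays like a stretched exponential, such that almost surely \<open>2 ^ j\<close> is a good radius for \<open>\<lambda> = L j\<close> for all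
large \<open>j\<close>. As \<open>j\<close> is of order \<open>log n\<close> at the scales that matter at time \<open>n\<close>, this gives powers of \<open>log n\<close>
and of \<open>log log n\<close>. In the polynomial case \<open>1 / L j\<close> is summable, and a second use of Borel and Cantelli, for
the path measure, gives the almost sure statements. Starting points other than the marked vertex are no
harder, because the estimates are uniform over the smaller ball, which contains any given vertex
as soon as the scale is large.\<close>

section \<open>Locally finite graphs and walks killed outside a finite set\<close>

definition nbs :: "'v set set \<Rightarrow> 'v \<Rightarrow> 'v set" where
  "nbs E x = {y. adj E x y}"

lemma adj_commute: "adj E x y \<longleftrightarrow> adj E y x"
  by (simp add: adj_def insert_commute)

locale locally_finite_graph =
  fixes G :: "'v set" and E :: "'v set set"
  assumes edges: "E \<subseteq> {{x, y} | x y. x \<in> G \<and> y \<in> G}"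
    and finite_edges_at: "x \<in> G \<Longrightarrow> finite {e \<in> E. x \<in> e}"
    and deg_pos: "x \<in> G \<Longrightarrow> deg E x > 0"
begin

lemma adj_in: "adj E x y \<Longrightarrow> x \<in> G \<and> y \<in> G"
  using edges unfolding adj_def by (auto simp: doubleton_eq_iff)

lemma bij_nbs: "bij_betw (\<lambda>y. {x, y}) (nbs E x) {e \<in> E. x \<in> e}"
  unfolding bij_betw_def
proof
  show "inj_on (\<lambda>y. {x, y}) (nbs E x)" by (auto simp: inj_on_def doubleton_eq_iff)
  show "(\<lambda>y. {x, y}) ` nbs E x = {e \<in> E. x \<in> e}"
  proof
    show "(\<lambda>y. {x, y}) ` nbs E x \<subseteq> {e \<in> E. x \<in> e}" by (auto simp: nbs_def adj_def)
    show "{e \<in> E. x \<in> e} \<subseteq> (\<lambda>y. {x, y}) ` nbs E x"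
    proof
      fix e assume e: "e \<in> {e \<in> E. x \<in> e}"
      then obtain a b where ab: "e = {a, b}" using edges by auto
      with e consider "x = a" | "x = b" by auto
      then show "e \<in> (\<lambda>y. {x, y}) ` nbs E x"
        using e ab by cases (auto simp: nbs_def adj_def insert_commute)
    qed
  qed
qed

lemma finite_nbs: "x \<in> G \<Longrightarrow> finite (nbs E x)"
  using bij_betw_finite[OF bij_nbs] finite_edges_at by auto

lemma card_nbs: "card (nbs E x) = deg E x"
  using bij_betw_same_card[OF bij_nbs] by (simp add: deg_def)

lemma nbs_subset: "nbs E x \<subseteq> G"
  using adj_in by (auto simp: nbs_def)

lemma step_prob_nonneg: "step_prob E x y \<ge> 0"
  by (simp add: step_prob_def)

lemma deg_step_prob: "x \<in> G \<Longrightarrow> real (deg E x) * step_prob E x y = of_bool (adj E x y)"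
  using deg_pos[of x] by (simp add: step_prob_def)

lemma sum_adj_le:
  assumes "finite B" "x \<in> G"
  shows "(\<Sum>y\<in>B. of_bool (adj E x y)) \<le> real (deg E x)"
proof -
  have "(\<Sum>y\<in>B. of_bool (adj E x y)) = real (card (B \<inter> nbs E x))"
    using assms by (simp add: nbs_def of_bool_def sum.If_cases)
  also have "\<dots> \<le> real (card (nbs E x))"
    using card_mono[OF finite_nbs[OF assms(2)], of "B \<inter> nbs E x"] by simp
  finally show ?thesis by (simp add: card_nbs)
qed

end

text \<open>The transition density, with respect to the degree, of the walk killed on leaving \<open>B\<close>.
  The sum makes sense for finite \<open>B\<close> only, which is the only case that occurs.\<close>

primrec killed_kernel :: "'v set set \<Rightarrow> 'v set \<Rightarrow> nat \<Rightarrow> 'v \<Rightarrow> 'v \<Rightarrow> real" where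
  "killed_kernel E B 0 x y = (if x = y \<and> x \<in> B then 1 / real (deg E x) else 0)"
| "killed_kernel E B (Suc n) x y =
     (if x \<in> B then \<Sum>w\<in>B. step_prob E x w * killed_kernel E B n w y else 0)"

definition supported :: "'v set \<Rightarrow> ('v \<Rightarrow> real) \<Rightarrow> bool" where
  "supported B f \<longleftrightarrow> (\<forall>y. y \<notin> B \<longrightarrow> f y = 0)"

locale killed_walk = locally_finite_graph +
  fixes B :: "'v set"
  assumes finite_B: "finite B" and B_subset: "B \<subseteq> G"
begin

abbreviation \<mu> :: "'v \<Rightarrow> real" where "\<mu> x \<equiv> real (deg E x)"
abbreviation a :: "'v \<Rightarrow> 'v \<Rightarrow> real" where "a x y \<equiv> of_bool (adj E x y)"
abbreviation p :: "nat \<Rightarrow> 'v \<Rightarrow> 'v \<Rightarrow> real" where "p \<equiv> killed_kernel E B"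

lemma mu_pos: "x \<in> B \<Longrightarrow> \<mu> x > 0" using deg_pos B_subset by auto
lemma mu_ge_1: "x \<in> B \<Longrightarrow> \<mu> x \<ge> 1" using deg_pos[of x] B_subset by (auto simp: Suc_le_eq)
lemma a_commute: "a x y = a y x" by (simp add: adj_commute)
lemma mu_step: "x \<in> B \<Longrightarrow> \<mu> x * step_prob E x y = a x y"
  using deg_step_prob[of x y] subsetD[OF B_subset] by blast
lemma step_eq: "x \<in> B \<Longrightarrow> step_prob E x y = a x y / \<mu> x"
  using mu_pos[of x] mu_step[of x y] by (metis less_irrefl mult.commute nonzero_eq_divide_eq)

lemma p_nonneg: "p n x y \<ge> 0"
  by (induction n arbitrary: x) (auto intro!: sum_nonneg mult_nonneg_nonneg step_prob_nonneg)

lemma p_outside1: "x \<notin> B \<Longrightarrow> p n x y = 0"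
  by (cases n) auto

lemma p_outside2: "y \<notin> B \<Longrightarrow> p n x y = 0"
  by (induction n arbitrary: x) auto

lemma p_Suc: "x \<in> B \<Longrightarrow> \<mu> x * p (Suc n) x y = (\<Sum>w\<in>B. a x w * p n w y)"
  using mu_step[of x] by (simp add: sum_distrib_left mult.assoc[symmetric])

text \<open>Reversibility. The recursion that defines the kernel removes the first step; the proof derives the
recursion that removes the last step, which has the same form in the second argument.\<close>

lemma p_commute: "p n x y = p n y x"
proof -
  have sym0: "p 0 x y = p 0 y x" for x y by auto
  \<comment> \<open>the recursion over the last step\<close>
  have last: "y \<in> B \<Longrightarrow> \<mu> y * p (Suc n) x y = (\<Sum>w\<in>B. a y w * p n x w)" for n x y
  proof (induction n arbitrary: x)
    case 0
    show ?case
    proof (cases "x \<in> B")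
      case True
      have "p (Suc 0) x y = (\<Sum>w\<in>B. if w = y then step_prob E x y / \<mu> y else 0)"
        using True 0 by (auto intro!: sum.cong)
      then have L: "\<mu> y * p (Suc 0) x y = step_prob E x y"
        using 0 finite_B mu_pos[OF 0] by simp
      have "(\<Sum>w\<in>B. a y w * p 0 x w) = (\<Sum>w\<in>B. if w = x then a y x / \<mu> x else 0)"
        using True by (intro sum.cong) auto
      also have "\<dots> = a y x / \<mu> x" using True finite_B by simp
      finally show ?thesis using L step_eq[OF True, of y] a_commute[of x y] by simp
    qed (simp add: p_outside1)
  next
    case (Suc n)
    show ?case
    proof (cases "x \<in> B")
      case True
      have "\<mu> y * p (Suc (Suc n)) x y = (\<Sum>w\<in>B. step_prob E x w * (\<mu> y * p (Suc n) w y))"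
        using True by (simp only: killed_kernel.simps if_True sum_distrib_left)
          (simp add: mult_ac sum_distrib_left)
      also have "\<dots> = (\<Sum>w\<in>B. step_prob E x w * (\<Sum>u\<in>B. a y u * p n w u))"
        using Suc by (simp del: killed_kernel.simps)
      also have "\<dots> = (\<Sum>u\<in>B. a y u * (\<Sum>w\<in>B. step_prob E x w * p n w u))"
        unfolding sum_distrib_left by (subst sum.swap) (simp add: mult_ac)
      also have "\<dots> = (\<Sum>u\<in>B. a y u * p (Suc n) x u)"
        using True by simp
      finally show ?thesis .
    qed (simp add: p_outside1 del: killed_kernel.simps)
  qed
  show ?thesis
  proof (induction n arbitrary: x y)
    case (Suc n)
    show ?case
    proof (cases "x \<in> B")
      case True
      have "\<mu> x * p (Suc n) x y = (\<Sum>w\<in>B. a x w * p n w y)" by (rule p_Suc[OF True])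
      also have "\<dots> = (\<Sum>w\<in>B. a x w * p n y w)" using Suc by simp
      also have "\<dots> = \<mu> x * p (Suc n) y x" using last[OF True] by simp
      finally show ?thesis using mu_pos[OF True] by simp
    next
      case False
      then show ?thesis by (metis p_outside1 p_outside2)
    qed
  qed (rule sym0)
qed

lemma sum_delta_p0: "x \<in> B \<Longrightarrow> (\<Sum>y\<in>B. p 0 x y * \<mu> y * f y) = f x"
proof -
  assume x: "x \<in> B"
  have "(\<Sum>y\<in>B. p 0 x y * \<mu> y * f y) = (\<Sum>y\<in>B. if y = x then f x else 0)"
    using x mu_pos[OF x] by (intro sum.cong) auto
  then show ?thesis using x finite_B by simp
qed

lemma Chapman_Kolmogorov: "(\<Sum>y\<in>B. p n x y * \<mu> y * p m y w) = p (n + m) x w"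
proof (induction n arbitrary: x)
  case 0
  then show ?case by (cases "x \<in> B") (simp_all add: sum_delta_p0 p_outside1 del: killed_kernel.simps)
next
  case (Suc n)
  show ?case
  proof (cases "x \<in> B")
    case True
    have "(\<Sum>y\<in>B. p (Suc n) x y * \<mu> y * p m y w)
        = (\<Sum>y\<in>B. \<Sum>u\<in>B. step_prob E x u * (p n u y * \<mu> y * p m y w))"
      using True by (simp add: sum_distrib_left sum_distrib_right mult_ac)
    also have "\<dots> = (\<Sum>u\<in>B. step_prob E x u * (\<Sum>y\<in>B. p n u y * \<mu> y * p m y w))"
      unfolding sum_distrib_left by (rule sum.swap)
    also have "\<dots> = p (Suc n + m) x w" using True Suc by simp
    finally show ?thesis .
  qed (simp add: p_outside1 del: killed_kernel.simps)
qed

definition survival :: "nat \<Rightarrow> 'v \<Rightarrow> real" where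
  "survival n x = (\<Sum>y\<in>B. p n x y * \<mu> y)"

lemma survival_nonneg: "survival n x \<ge> 0"
  unfolding survival_def by (intro sum_nonneg mult_nonneg_nonneg p_nonneg) auto

lemma survival_0: "survival 0 x = of_bool (x \<in> B)"
  using sum_delta_p0[of x "\<lambda>_. 1"]
  by (cases "x \<in> B") (simp_all add: survival_def p_outside1 del: killed_kernel.simps)

lemma survival_Suc: "survival (Suc n) x = (if x \<in> B then \<Sum>w\<in>B. step_prob E x w * survival n w else 0)"
proof (cases "x \<in> B")
  case True
  have "survival (Suc n) x = (\<Sum>y\<in>B. \<Sum>w\<in>B. step_prob E x w * (p n w y * \<mu> y))"
    using True by (simp add: survival_def sum_distrib_left sum_distrib_right mult_ac)
  also have "\<dots> = (\<Sum>w\<in>B. step_prob E x w * survival n w)"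
    unfolding survival_def sum_distrib_left by (rule sum.swap)
  finally show ?thesis using True by simp
qed (simp add: survival_def p_outside1 del: killed_kernel.simps)

lemma sum_step_le_1: "x \<in> B \<Longrightarrow> (\<Sum>w\<in>B. step_prob E x w) \<le> 1"
  using sum_adj_le[OF finite_B, of x] B_subset mu_pos[of x]
  by (auto simp: step_eq sum_divide_distrib[symmetric] divide_le_eq_1)

lemma survival_antimono: "survival (Suc n) x \<le> survival n x"
proof (induction n arbitrary: x)
  case 0
  then show ?case using sum_step_le_1[of x]
    by (auto simp: survival_Suc survival_0)
next
  case (Suc n)
  show ?case
    by (subst survival_Suc, subst (2) survival_Suc)
      (auto intro!: sum_mono mult_left_mono Suc step_prob_nonneg)
qed

lemma survival_decseq: "m \<le> n \<Longrightarrow> survival n x \<le> survival m x"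
  by (rule lift_Suc_antimono_le[of "\<lambda>n. survival n x"]) (auto intro: survival_antimono)

lemma survival_le_1: "survival n x \<le> 1"
  using survival_decseq[of 0 n x] by (cases "x \<in> B") (simp_all add: survival_0)

section \<open>The Dirichlet form of a finite set\<close>

text \<open>The form \<open>\<E>(f, g)\<close> of functions that vanish off \<open>B\<close>, after summation by parts.\<close>

definition dir :: "('v \<Rightarrow> real) \<Rightarrow> ('v \<Rightarrow> real) \<Rightarrow> real" where
  "dir f g = (\<Sum>x\<in>B. f x * (\<mu> x * g x - (\<Sum>y\<in>B. a x y * g y)))"

lemma dir_commute: "dir f g = dir g f"
proof -
  have "(\<Sum>x\<in>B. f x * (\<Sum>y\<in>B. a x y * g y)) = (\<Sum>x\<in>B. g x * (\<Sum>y\<in>B. a x y * f y))"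
    unfolding sum_distrib_left by (subst sum.swap) (simp add: a_commute mult_ac cong: sum.cong)
  then show ?thesis
    unfolding dir_def right_diff_distrib sum_subtractf by (simp add: mult_ac)
qed

lemma dir_add_right: "dir f (\<lambda>y. g y + h y) = dir f g + dir f h"
  unfolding dir_def by (simp add: algebra_simps sum.distrib sum_subtractf)

lemma dir_scale_right: "dir f (\<lambda>y. c * g y) = c * dir f g"
proof -
  have "(\<Sum>y\<in>B. a x y * (c * g y)) = c * (\<Sum>y\<in>B. a x y * g y)" for x
    by (simp add: sum_distrib_left mult_ac)
  then show ?thesis
    unfolding dir_def sum_distrib_left[of c _ B, symmetric]
    by (simp only: sum_distrib_left[of c "\<lambda>x. f x * _ x"]) (simp add: algebra_simps)
qed

lemma dir_add_left: "dir (\<lambda>y. g y + h y) f = dir g f + dir h f"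
  by (metis dir_commute dir_add_right)

lemma dir_scale_left: "dir (\<lambda>y. c * g y) f = c * dir g f"
  by (metis dir_commute dir_scale_right)

text \<open>The second sum is the contribution of the edges that leave \<open>B\<close>. Both sums consist of
nonnegative terms.\<close>

lemma dir_squares:
  "dir f f = (\<Sum>x\<in>B. \<Sum>y\<in>B. a x y * (f x - f y)\<^sup>2) / 2
     + (\<Sum>x\<in>B. (\<mu> x - (\<Sum>y\<in>B. a x y)) * (f x)\<^sup>2)"
proof -
  let ?d = "\<Sum>x\<in>B. (\<Sum>y\<in>B. a x y) * (f x)\<^sup>2"
  let ?m = "\<Sum>x\<in>B. \<Sum>y\<in>B. a x y * (f x * f y)"
  have 1: "(\<Sum>x\<in>B. \<Sum>y\<in>B. a x y * (f x)\<^sup>2) = ?d"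
    by (simp add: sum_distrib_right)
  have 2: "(\<Sum>x\<in>B. \<Sum>y\<in>B. a x y * (f y)\<^sup>2) = ?d"
    by (subst sum.swap) (simp add: a_commute sum_distrib_right cong: sum.cong)
  have "(\<Sum>x\<in>B. \<Sum>y\<in>B. a x y * (f x - f y)\<^sup>2)
      = (\<Sum>x\<in>B. \<Sum>y\<in>B. a x y * (f x)\<^sup>2 + a x y * (f y)\<^sup>2 - 2 * (a x y * (f x * f y)))"
    by (intro sum.cong) (simp_all add: power2_eq_square algebra_simps)
  also have "\<dots> = 2 * ?d - 2 * ?m"
    unfolding sum.distrib sum_subtractf 1 2 by (simp add: sum_distrib_left)
  finally have 3: "(\<Sum>x\<in>B. \<Sum>y\<in>B. a x y * (f x - f y)\<^sup>2) = 2 * ?d - 2 * ?m" .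
  have "dir f f = (\<Sum>x\<in>B. \<mu> x * (f x)\<^sup>2) - ?m"
    unfolding dir_def right_diff_distrib sum_subtractf
    by (simp add: sum_distrib_left power2_eq_square mult_ac)
  then show ?thesis unfolding 3 by (simp add: left_diff_distrib sum_subtractf diff_divide_distrib)
qed

lemma dir_nonneg: "dir f f \<ge> 0"
proof -
  have "(\<Sum>x\<in>B. (\<mu> x - (\<Sum>y\<in>B. a x y)) * (f x)\<^sup>2) \<ge> 0"
    using sum_adj_le[OF finite_B] B_subset by (intro sum_nonneg mult_nonneg_nonneg) auto
  then show ?thesis unfolding dir_squares by (auto intro!: add_nonneg_nonneg sum_nonneg)
qed

lemma dir_Cauchy_Schwarz: "(dir f g)\<^sup>2 \<le> dir f f * dir g g"
proof -
  have quad: "0 \<le> dir f f + 2 * t * dir f g + t\<^sup>2 * dir g g" for t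
    using dir_nonneg[of "\<lambda>y. f y + t * g y"]
    by (simp add: dir_add_left dir_add_right dir_scale_left dir_scale_right dir_commute[of g f]
        algebra_simps power2_eq_square)
  show ?thesis
  proof (cases "dir g g = 0")
    case True
    have "dir f g = 0"
    proof (rule ccontr)
      assume "dir f g \<noteq> 0"
      then show False
        using quad[of "- (dir f f + 1) / (2 * dir f g)"] True by (simp add: field_simps)
    qed
    with True show ?thesis by simp
  next
    case False
    with dir_nonneg[of g] have pos: "dir g g > 0" by simp
    have "0 \<le> dir f f - (dir f g)\<^sup>2 / dir g g"
      using quad[of "- dir f g / dir g g"] pos
      by (simp add: field_simps power2_eq_square)
    with pos show ?thesis by (simp add: field_simps)
  qed
qed

text \<open>For functions that vanish off \<open>B\<close>, the extended-real energy is the finite form: of the ordered pairs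
of neighbours, those inside \<open>B\<close> give the first sum of \<open>dir_squares\<close>, and those that cross the boundary of
\<open>B\<close>, which occur in both orders, give the second.\<close>

lemma energy_eq_dir:
  assumes f: "supported B f"
  shows "energy E f = ennreal (dir f f)"
proof -
  define S1 where "S1 = (\<Union>x\<in>B. {x} \<times> {y\<in>B. adj E x y})"
  define S2 where "S2 = (\<Union>x\<in>B. {x} \<times> (nbs E x - B))"
  define S3 where "S3 = prod.swap ` S2"
  define F where "F = (\<lambda>(x, y). (f x - f y)\<^sup>2)"
  have S1_mem: "(x, y) \<in> S1 \<longleftrightarrow> x \<in> B \<and> y \<in> B \<and> adj E x y"
    and S2_mem: "(x, y) \<in> S2 \<longleftrightarrow> x \<in> B \<and> y \<notin> B \<and> adj E x y" for x y
    by (auto simp: S1_def S2_def nbs_def)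
  have finS2: "finite S2" unfolding S2_def using finite_B finite_nbs B_subset by auto
  have fin: "finite S1" "finite S3"
    unfolding S1_def S3_def using finite_B finS2 by auto
  have S2F: "sum F S2 = (\<Sum>x\<in>B. (\<mu> x - (\<Sum>y\<in>B. a x y)) * (f x)\<^sup>2)"
  proof -
    have "sum F S2 = (\<Sum>x\<in>B. sum F ({x} \<times> (nbs E x - B)))"
      unfolding S2_def using finite_B finite_nbs B_subset by (intro sum.UNION_disjoint) auto
    also have "\<dots> = (\<Sum>x\<in>B. real (card (nbs E x - B)) * (f x)\<^sup>2)"
    proof (intro sum.cong refl)
      fix x assume "x \<in> B"
      have "sum F ({x} \<times> (nbs E x - B)) = (\<Sum>y\<in>{x} \<times> (nbs E x - B). (f x)\<^sup>2)"
        using f by (intro sum.cong) (auto simp: F_def supported_def)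
      then show "sum F ({x} \<times> (nbs E x - B)) = real (card (nbs E x - B)) * (f x)\<^sup>2"
        by (simp add: card_cartesian_product)
    qed
    also have "\<dots> = (\<Sum>x\<in>B. (\<mu> x - (\<Sum>y\<in>B. a x y)) * (f x)\<^sup>2)"
    proof (intro sum.cong refl arg_cong2[where f="(*)"])
      fix x assume x: "x \<in> B"
      then have fx: "finite (nbs E x)" using finite_nbs B_subset by auto
      have "(\<Sum>y\<in>B. a x y) = real (card (B \<inter> nbs E x))"
        using finite_B by (simp add: nbs_def of_bool_def sum.If_cases)
      moreover have "card (nbs E x - B) + card (B \<inter> nbs E x) = card (nbs E x)"
        using card_Diff_subset_Int[of "nbs E x" B] fx card_mono[OF fx, of "nbs E x \<inter> B"]
        by (simp add: Int_commute)
      ultimately show "real (card (nbs E x - B)) = \<mu> x - (\<Sum>y\<in>B. a x y)"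
        by (simp add: card_nbs[symmetric] del: of_nat_add flip: of_nat_add)
    qed
    finally show ?thesis .
  qed
  have S3F: "sum F S3 = sum F S2"
    unfolding S3_def by (subst sum.reindex) (auto simp: inj_on_def F_def power2_commute intro!: sum.cong)
  have S1F: "sum F S1 = (\<Sum>x\<in>B. \<Sum>y\<in>B. a x y * (f x - f y)\<^sup>2)"
  proof -
    have "sum F S1 = (\<Sum>x\<in>B. sum F ({x} \<times> {y\<in>B. adj E x y}))"
      unfolding S1_def using finite_B by (intro sum.UNION_disjoint) auto
    also have "\<dots> = (\<Sum>x\<in>B. \<Sum>y\<in>B. a x y * (f x - f y)\<^sup>2)"
    proof (intro sum.cong refl)
      fix x
      have "sum F ({x} \<times> {y\<in>B. adj E x y}) = (\<Sum>y | y \<in> B \<and> adj E x y. (f x - f y)\<^sup>2)"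
        by (subst sum.cartesian_product[symmetric, where A="{x}", simplified, symmetric])
          (simp add: F_def)
      also have "\<dots> = (\<Sum>y\<in>B. a x y * (f x - f y)\<^sup>2)"
        using finite_B by (intro sum.mono_neutral_cong_left) auto
      finally show "sum F ({x} \<times> {y\<in>B. adj E x y}) = (\<Sum>y\<in>B. a x y * (f x - f y)\<^sup>2)" .
    qed
    finally show ?thesis .
  qed
  have "(\<integral>\<^sup>+ (x, y). ennreal ((f x - f y)\<^sup>2) \<partial>count_space {(x, y). adj E x y})
      = (\<integral>\<^sup>+ z. ennreal (F z) \<partial>count_space {(x, y). adj E x y})"
    by (intro nn_integral_cong) (auto simp: F_def)
  also have "\<dots> = (\<Sum>z\<in>S1 \<union> S2 \<union> S3. ennreal (F z))"
  proof (rule nn_integral_count_space')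
    show "finite (S1 \<union> S2 \<union> S3)" using fin finS2 by auto
    show "S1 \<union> S2 \<union> S3 \<subseteq> {(x, y). adj E x y}"
      by (auto simp: S1_def S2_def S3_def nbs_def adj_commute)
    fix z assume z: "z \<in> {(x, y). adj E x y}" "z \<notin> S1 \<union> S2 \<union> S3"
    obtain x y where [simp]: "z = (x, y)" by force
    have "adj E x y" "adj E y x" using z by (auto simp: adj_commute[of E y x])
    moreover have "(y, x) \<notin> S2"
      using z by (metis S3_def UnCI \<open>z = (x, y)\<close> image_eqI swap_simp)
    moreover have "(x, y) \<notin> S1" "(x, y) \<notin> S2" using z by simp_all
    ultimately have "x \<notin> B" "y \<notin> B"
      unfolding S1_mem S2_mem by blast+
    then show "ennreal (F z) = 0" using f by (simp add: F_def supported_def)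
  qed
  also have "\<dots> = ennreal (sum F (S1 \<union> S2 \<union> S3))"
    by (intro sum_ennreal) (auto simp: F_def)
  also have "sum F (S1 \<union> S2 \<union> S3) = sum F S1 + sum F S2 + sum F S3"
    using fin finS2 by (subst sum.union_disjoint, simp, simp, force simp: S1_def S2_def S3_def,
      subst sum.union_disjoint, simp, simp, force simp: S1_def S2_def S3_def, simp)
  also have "\<dots> = 2 * dir f f"
    unfolding S3F S2F S1F dir_squares by simp
  finally show ?thesis
    unfolding energy_def using dir_nonneg[of f]
    by (simp add: ennreal_divide_numeral divide_ennreal[symmetric])
qed

lemma supported_p: "supported B (p n x)"
  by (auto simp: supported_def p_outside2)

lemma p_inner: "(\<Sum>y\<in>B. p i x y * \<mu> y * p j x y) = p (i + j) x x"
  using Chapman_Kolmogorov[of i x j x] by (simp add: p_commute[of j x])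

lemma generator_p: "y \<in> B \<Longrightarrow> \<mu> y * p n x y - (\<Sum>w\<in>B. a y w * p n x w) = \<mu> y * (p n x y - p (Suc n) x y)"
  using p_Suc[of y n x] by (simp add: p_commute[of n x] p_commute[of "Suc n" x] right_diff_distrib
      del: killed_kernel.simps)

lemma dir_p: "dir f (p n x) = (\<Sum>y\<in>B. f y * \<mu> y * (p n x y - p (Suc n) x y))"
  unfolding dir_def by (intro sum.cong refl) (simp only: generator_p mult.assoc)

lemma p_odd_le: "p (Suc (2 * i)) x x \<le> p (2 * i) x x"
proof -
  have "dir (p i x) (p i x) = p (i + i) x x - p (i + Suc i) x x"
    unfolding dir_p right_diff_distrib sum_subtractf p_inner ..
  then show ?thesis using dir_nonneg[of "p i x"] by (simp add: mult_2 del: killed_kernel.simps)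
qed

text \<open>The energy of \<open>p k x\<close> alone is \<open>p (2 * k) x x - p (2 * k + 1) x x\<close>, which does not telescope in \<open>k\<close>. That of
the sum of two consecutive kernels does.\<close>

lemma dir_consecutive:
  "dir (\<lambda>y. p k x y + p (Suc k) x y) (\<lambda>y. p k x y + p (Suc k) x y)
     = (p (2 * k) x x + p (Suc (2 * k)) x x) - (p (2 * Suc k) x x + p (Suc (2 * Suc k)) x x)"
  (is "dir ?f ?f = _")
proof -
  have "dir ?f ?f = (\<Sum>y\<in>B. ?f y * \<mu> y * (p k x y - p (Suc k) x y))
       + (\<Sum>y\<in>B. ?f y * \<mu> y * (p (Suc k) x y - p (Suc (Suc k)) x y))"
    by (simp only: dir_add_right dir_p)
  also have "\<dots> = (\<Sum>y\<in>B. p k x y * \<mu> y * p k x y) + (\<Sum>y\<in>B. p (Suc k) x y * \<mu> y * p k x y)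
       - (\<Sum>y\<in>B. p k x y * \<mu> y * p (Suc (Suc k)) x y)
       - (\<Sum>y\<in>B. p (Suc k) x y * \<mu> y * p (Suc (Suc k)) x y)"
    by (simp add: algebra_simps sum.distrib sum_subtractf del: killed_kernel.simps)
  finally show ?thesis
    unfolding p_inner by (simp add: mult_2 del: killed_kernel.simps)
qed

text \<open>A Nash-type argument for strongly recurrent walks. It is applied with a ball \<open>A\<close> and arbitrarily large finite sets
\<open>B\<close>, and thus gives a bound for the walk without killing.\<close>

lemma on_diagonal_upper:
  assumes A: "finite A" "A \<subseteq> G" "x \<in> A" and \<rho>: "\<rho> \<ge> 0" and n: "n \<ge> 1"
    and osc: "\<And>f u w. supported B f \<Longrightarrow> u \<in> A \<Longrightarrow> w \<in> A \<Longrightarrow> (f u - f w)\<^sup>2 \<le> \<rho> * dir f f"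
  shows "p (2 * n) x x \<le> 8 / (\<Sum>y\<in>A. \<mu> y) + 16 * \<rho> / real n"
proof -
  define q where "q j = p (2 * j) x x + p (Suc (2 * j)) x x" for j
  define f where "f k y = p k x y + p (Suc k) x y" for k y
  define V where "V = (\<Sum>y\<in>A. \<mu> y)"
  have muA: "\<mu> y > 0" if "y \<in> A" for y using that A deg_pos by auto
  have V: "V > 0" unfolding V_def using A muA by (intro sum_pos2[of A x]) auto
  have Ek: "dir (f k) (f k) = q k - q (Suc k)" for k
    using dir_consecutive[of k x] unfolding f_def q_def .
  have qmono: "i \<le> j \<Longrightarrow> q j \<le> q i" for i j
    by (rule lift_Suc_antimono_le[of q]) (use Ek dir_nonneg in \<open>smt (verit)\<close>)+
  have q0: "q j \<ge> 0" for j unfolding q_def by (intro add_nonneg_nonneg p_nonneg)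
  \<comment> \<open>the energies at the times in \<open>{n..<2 * n}\<close> add up to at most \<open>q n\<close>\<close>
  have "\<exists>k\<in>{n..<2 * n}. dir (f k) (f k) \<le> q n / n"
  proof (rule ccontr)
    assume "\<not> ?thesis"
    then have "(\<Sum>k\<in>{n..<2 * n}. q n / n) < (\<Sum>k\<in>{n..<2 * n}. dir (f k) (f k))"
      using n by (intro sum_strict_mono) (simp_all add: not_le)
    also have "\<dots> = q n - q (2 * n)"
      unfolding Ek using sum_Suc_diff'[of n "2 * n" "\<lambda>k. - q k"] by simp
    finally show False using n q0[of "2 * n"] by simp
  qed
  then obtain k where k: "n \<le> k" "k < 2 * n" "dir (f k) (f k) \<le> q n / n" by auto
  \<comment> \<open>the mass of \<open>f k\<close> is at most 2\<close>
  have "\<exists>y\<in>A. f k y \<le> 2 / V"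
  proof (rule ccontr)
    assume "\<not> ?thesis"
    then have "(\<Sum>y\<in>A. 2 / V * \<mu> y) < (\<Sum>y\<in>A. f k y * \<mu> y)"
      using A muA by (intro sum_strict_mono mult_strict_right_mono) auto
    moreover have "(\<Sum>y\<in>A. 2 / V * \<mu> y) = 2"
      unfolding sum_distrib_left[symmetric] V_def[symmetric] using V by simp
    moreover have "(\<Sum>y\<in>A. f k y * \<mu> y) \<le> (\<Sum>y\<in>B. f k y * \<mu> y)"
    proof -
      have "(\<Sum>y\<in>A. f k y * \<mu> y) = (\<Sum>y\<in>A \<inter> B. f k y * \<mu> y)"
        using A by (intro sum.mono_neutral_right) (auto simp: f_def p_outside2 simp del: killed_kernel.simps)
      also have "\<dots> \<le> (\<Sum>y\<in>B. f k y * \<mu> y)"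
        using finite_B p_nonneg by (intro sum_mono2) (auto simp: f_def simp del: killed_kernel.simps)
      finally show ?thesis .
    qed
    moreover have "(\<Sum>y\<in>B. f k y * \<mu> y) = survival k x + survival (Suc k) x"
      unfolding f_def survival_def by (simp add: distrib_right sum.distrib del: killed_kernel.simps)
    ultimately show False using survival_le_1[of k x] survival_le_1[of "Suc k" x] by linarith
  qed
  then obtain y where y: "y \<in> A" "f k y \<le> 2 / V" by auto
  have fy: "f k y \<ge> 0" unfolding f_def using p_nonneg by (simp del: killed_kernel.simps)
  \<comment> \<open>one of \<open>k\<close> and \<open>k + 1\<close> is even and at most \<open>2 * n\<close>\<close>
  have fx: "q n / 2 \<le> f k x"
  proof (cases "even k")
    case True
    then obtain j where j: "k = 2 * j" by (elim evenE)
    have "q n \<le> q j" using j k by (intro qmono) simp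
    then have "q n \<le> f k x" by (simp only: j f_def q_def)
    with q0[of n] show ?thesis by linarith
  next
    case False
    then obtain j where j: "k = Suc (2 * j)" by (metis oddE Suc_eq_plus1)
    have "q n \<le> q (Suc j)" using j k by (intro qmono) simp
    moreover have "q (Suc j) \<le> 2 * p (2 * Suc j) x x"
      using p_odd_le[of "Suc j" x] unfolding q_def by linarith
    moreover have "p (2 * Suc j) x x \<le> f k x"
      using p_nonneg[of k x x] unfolding f_def j by (simp del: killed_kernel.simps)
    ultimately show ?thesis by linarith
  qed
  have "q n \<le> 8 / V + 16 * \<rho> / n"
  proof (rule ccontr)
    assume c: "\<not> ?thesis"
    have t: "8 / V > 0" "16 * \<rho> / n \<ge> 0" using V \<rho> by auto
    with c have q: "q n > 8 / V" "q n > 16 * \<rho> / n" by linarith+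
    with t have qp: "q n > 0" by linarith
    have "(q n / 2)\<^sup>2 \<le> (f k x)\<^sup>2" using fx qp by (intro power_mono) auto
    also have "\<dots> \<le> 2 * (f k y)\<^sup>2 + 2 * (f k x - f k y)\<^sup>2"
      using zero_le_power2[of "2 * f k y - f k x"] by (simp add: power2_eq_square algebra_simps)
    also have "(f k y)\<^sup>2 \<le> (2 / V)\<^sup>2" using y fy by (intro power_mono) auto
    also have "(f k x - f k y)\<^sup>2 \<le> \<rho> * dir (f k) (f k)"
      by (rule osc) (use A y p_outside2 in \<open>auto simp: supported_def f_def simp del: killed_kernel.simps\<close>)
    also have "\<dots> \<le> \<rho> * (q n / n)" using k \<rho> by (intro mult_left_mono) auto
    also have "\<dots> = (16 * \<rho> / n) * q n / 16" by simp
    also have "(16 * \<rho> / n) * q n \<le> q n * q n" using q qp by (intro mult_right_mono) auto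
    also have "(2 / V)\<^sup>2 = (8 / V)\<^sup>2 / 16" by (simp add: power2_eq_square)
    also have "(8 / V)\<^sup>2 < (q n)\<^sup>2" using q t by (intro power_strict_mono) auto
    finally show False by (simp add: power2_eq_square field_simps)
  qed
  moreover have "p (2 * n) x x \<le> q n" unfolding q_def using p_nonneg[of "Suc (2 * n)" x x] by linarith
  ultimately show ?thesis unfolding V_def by linarith
qed

text \<open>Cauchy and Schwarz for \<open>survival n x = (\<Sum>y\<in>B. p n x y * \<mu> y)\<close>.\<close>

lemma on_diagonal_lower: "(survival n x)\<^sup>2 \<le> p (2 * n) x x * (\<Sum>y\<in>B. \<mu> y)"
proof -
  have "(survival n x)\<^sup>2 = (\<Sum>y\<in>B. (p n x y * sqrt (\<mu> y)) * sqrt (\<mu> y))\<^sup>2"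
    unfolding survival_def by (simp add: mult.assoc)
  also have "\<dots> \<le> (\<Sum>y\<in>B. (p n x y * sqrt (\<mu> y))\<^sup>2) * (\<Sum>y\<in>B. (sqrt (\<mu> y))\<^sup>2)"
    by (rule Cauchy_Schwarz_ineq_sum)
  also have "(\<Sum>y\<in>B. (p n x y * sqrt (\<mu> y))\<^sup>2) = p (n + n) x x"
    unfolding p_inner[symmetric] by (intro sum.cong) (auto simp: power_mult_distrib power2_eq_square mult_ac)
  finally show ?thesis by (simp add: mult_2)
qed

end

section \<open>Green functions\<close>

text \<open>The assumption says that point evaluations are bounded in the energy norm. It holds with \<open>\<rho>\<close> a bound for the
resistances between the vertices of \<open>B\<close> and a vertex outside \<open>B\<close>.\<close>

locale transient_killed_walk = killed_walk G E B for G :: "'v set" and E B +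
  fixes \<rho> :: real
  assumes evaluation: "x \<in> B \<Longrightarrow> supported B f \<Longrightarrow> (f x)\<^sup>2 \<le> \<rho> * dir f f"
begin

text \<open>For \<open>f = (\<lambda>y. \<Sum>k<N. p k x y)\<close>, summation of the generator over \<open>k\<close> gives \<open>dir f f \<le> f x\<close>. Bounded evaluation
then yields \<open>(f x)\<^sup>2 \<le> \<rho> * f x\<close>, so that \<open>f x \<le> \<rho>\<close> uniformly in \<open>N\<close>. This proves both convergence of the
Green function and the upper bound on it.\<close>

lemma partial_green_bound: "(\<Sum>k<N. p k x y) \<le> \<rho>" if x: "x \<in> B"
proof -
  define f where "f y = (\<Sum>k<N. p k x y)" for y
  have fnn: "f y \<ge> 0" for y unfolding f_def by (intro sum_nonneg p_nonneg)
  have sup: "supported B f" by (simp add: supported_def f_def p_outside2)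
  have gen: "\<mu> y * f y - (\<Sum>w\<in>B. a y w * f w) = \<mu> y * (p 0 x y - p N x y)" if "y \<in> B" for y
  proof -
    have "\<mu> y * f y - (\<Sum>w\<in>B. a y w * f w) = (\<Sum>k<N. \<mu> y * p k x y - (\<Sum>w\<in>B. a y w * p k x w))"
      unfolding f_def sum_subtractf sum_distrib_left by (subst (2) sum.swap) simp
    also have "\<dots> = (\<Sum>k<N. \<mu> y * (p k x y - p (Suc k) x y))"
      using that by (simp only: generator_p)
    also have "\<dots> = \<mu> y * (p 0 x y - p N x y)"
      by (simp only: sum_distrib_left[symmetric] sum_lessThan_telescope'[of "\<lambda>k. p k x y"])
    finally show ?thesis .
  qed
  have "dir f f = (\<Sum>y\<in>B. f y * (\<mu> y * (p 0 x y - p N x y)))"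
    unfolding dir_def by (intro sum.cong refl) (simp only: gen)
  also have "\<dots> \<le> (\<Sum>y\<in>B. p 0 x y * \<mu> y * f y)"
    using fnn p_nonneg by (intro sum_mono) (simp add: algebra_simps del: killed_kernel.simps)
  also have "\<dots> = f x" by (rule sum_delta_p0[OF x])
  finally have dle: "dir f f \<le> f x" .
  have "\<rho> \<ge> 0"
  proof -
    have "(p 0 x x)\<^sup>2 \<le> \<rho> * dir (p 0 x) (p 0 x)" using evaluation[OF x supported_p] .
    moreover have "(p 0 x x)\<^sup>2 > 0" using x mu_pos[OF x] by simp
    moreover have "\<rho> * dir (p 0 x) (p 0 x) \<le> 0" if "\<rho> < 0"
      using that dir_nonneg[of "p 0 x"] by (simp add: mult_nonpos_nonneg)
    ultimately show ?thesis by linarith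
  qed
  have sq: "(f u)\<^sup>2 \<le> \<rho> * f x" if "u \<in> B" for u
    using evaluation[OF that sup] mult_left_mono[OF dle \<open>\<rho> \<ge> 0\<close>] by linarith
  have fx: "f x \<le> \<rho>"
  proof (cases "f x = 0")
    case False
    then show ?thesis using sq[OF x] fnn[of x] by (simp add: power2_eq_square)
  qed (use \<open>\<rho> \<ge> 0\<close> in simp)
  show ?thesis
  proof (cases "y \<in> B")
    case True
    have "(f y)\<^sup>2 \<le> \<rho>\<^sup>2"
      using sq[OF True] mult_left_mono[OF fx \<open>\<rho> \<ge> 0\<close>] by (simp add: power2_eq_square)
    then show ?thesis using \<open>\<rho> \<ge> 0\<close> f_def by (metis power2_le_imp_le)
  qed (use \<open>\<rho> \<ge> 0\<close> in \<open>simp add: p_outside2\<close>)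
qed

lemma summable_p: "summable (\<lambda>k. p k x y)"
proof (cases "x \<in> B")
  case True
  show ?thesis
    by (rule summableI_nonneg_bounded[OF p_nonneg partial_green_bound[OF True]])
qed (simp add: p_outside1)

definition green :: "'v \<Rightarrow> 'v \<Rightarrow> real" where
  "green x y = (\<Sum>k. p k x y)"

lemma green_nonneg: "green x y \<ge> 0"
  unfolding green_def by (intro suminf_nonneg summable_p p_nonneg)

lemma green_commute: "green x y = green y x"
  unfolding green_def by (simp add: p_commute)

lemma green_le: "x \<in> B \<Longrightarrow> green x y \<le> \<rho>"
  unfolding green_def by (rule suminf_le_const[OF summable_p partial_green_bound])

lemma supported_green: "supported B (green x)"
  by (simp add: supported_def green_def p_outside2)

lemma green_sums_from: "(\<Sum>k. p (n + k) x y) = (\<Sum>w\<in>B. p n x w * \<mu> w * green w y)"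
proof -
  have "(\<Sum>k. p (n + k) x y) = (\<Sum>k. \<Sum>w\<in>B. p n x w * \<mu> w * p k w y)"
    using Chapman_Kolmogorov[of n x _ y] by presburger
  also have "\<dots> = (\<Sum>w\<in>B. \<Sum>k. p n x w * \<mu> w * p k w y)"
    by (intro suminf_sum summable_mult summable_p)
  also have "\<dots> = (\<Sum>w\<in>B. p n x w * \<mu> w * green w y)"
    unfolding green_def by (simp only: suminf_mult[OF summable_p])
  finally show ?thesis .
qed

lemma green_split: "green x y = (\<Sum>k<n. p k x y) + (\<Sum>w\<in>B. p n x w * \<mu> w * green w y)"
  using suminf_split_initial_segment[OF summable_p[of x y], of n]
  unfolding green_def[symmetric] green_sums_from[symmetric] by (simp add: add.commute)

lemma green_generator:
  assumes y: "y \<in> B"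
  shows "\<mu> y * green x y - (\<Sum>w\<in>B. a y w * green x w) = \<mu> y * p 0 x y"
proof -
  have "(\<Sum>w\<in>B. a y w * green x w) = (\<Sum>k. \<Sum>w\<in>B. a y w * p k x w)"
    unfolding green_def suminf_mult[OF summable_p, symmetric]
    by (intro suminf_sum[symmetric] summable_mult summable_p)
  also have "\<dots> = (\<Sum>k. \<mu> y * p (Suc k) x y)"
    using p_Suc[OF y] by (simp add: p_commute[of _ x] del: killed_kernel.simps)
  also have "\<dots> = \<mu> y * (\<Sum>k. p (Suc k) x y)"
    using summable_p[of x y] by (intro suminf_mult) (subst summable_Suc_iff)
  also have "(\<Sum>k. p (Suc k) x y) = green x y - p 0 x y"
    unfolding green_def using suminf_split_head[OF summable_p[of x y]] .
  finally show ?thesis by (simp add: algebra_simps del: killed_kernel.simps)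
qed

text \<open>The reproducing property, on which all Green function estimates rest.\<close>

lemma dir_green:
  assumes "x \<in> B" shows "dir f (green x) = f x"
proof -
  have "dir f (green x) = (\<Sum>y\<in>B. p 0 x y * \<mu> y * f y)"
    unfolding dir_def by (intro sum.cong refl) (simp only: green_generator, simp only: mult_ac)
  then show ?thesis using sum_delta_p0[OF assms] by simp
qed

lemma green_pos: "x \<in> B \<Longrightarrow> green x x > 0"
  using green_split[of x x 1] mu_pos[of x] green_nonneg p_nonneg
  by (auto intro!: add_pos_nonneg sum_nonneg mult_nonneg_nonneg simp del: killed_kernel.simps(2))

lemma evaluation_green: "x \<in> B \<Longrightarrow> (f x)\<^sup>2 \<le> dir f f * green x x"
  using dir_Cauchy_Schwarz[of f "green x"] by (simp add: dir_green)

text \<open>Maximum principle: the walk from \<open>y\<close> has to reach \<open>x\<close> before it can be counted there. For the partial sums this is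
an induction over the number of terms, since the sum at \<open>y \<noteq> x\<close> is an average of shorter sums at the neighbours.\<close>

lemma green_max: "green y x \<le> green x x"
proof (cases "x \<in> B")
  case x: True
  have fin: "(\<Sum>k<N. p k y x) \<le> (\<Sum>k<N. p k x x)" for N y
  proof (induction N arbitrary: y)
    case (Suc N)
    show ?case
    proof (cases "y = x \<or> y \<notin> B")
      case True
      then show ?thesis
        by (auto simp: p_outside1 simp del: killed_kernel.simps intro!: add_nonneg_nonneg sum_nonneg p_nonneg)
    next
      case False
      have "(\<Sum>k<Suc N. p k y x) = (\<Sum>k<N. \<Sum>w\<in>B. step_prob E y w * p k w x)"
        unfolding sum.lessThan_Suc_shift using False by simp
      also have "\<dots> = (\<Sum>w\<in>B. step_prob E y w * (\<Sum>k<N. p k w x))"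
        unfolding sum_distrib_left by (rule sum.swap)
      also have "\<dots> \<le> (\<Sum>w\<in>B. step_prob E y w * (\<Sum>k<N. p k x x))"
        by (rule sum_mono, rule mult_left_mono[OF Suc step_prob_nonneg])
      also have "\<dots> = (\<Sum>w\<in>B. step_prob E y w) * (\<Sum>k<N. p k x x)"
        by (simp only: sum_distrib_right)
      also have "\<dots> \<le> 1 * (\<Sum>k<N. p k x x)"
        using False by (intro mult_right_mono sum_step_le_1 sum_nonneg p_nonneg) auto
      also have "\<dots> \<le> (\<Sum>k<Suc N. p k x x)" using p_nonneg by simp
      finally show ?thesis .
    qed
  qed simp
  show ?thesis
    unfolding green_def
    by (rule LIMSEQ_le[OF summable_LIMSEQ[OF summable_p] summable_LIMSEQ[OF summable_p]])
      (use fin in auto)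
qed (simp add: green_def p_outside2)

section \<open>Survival probabilities and mean exit times\<close>

definition mean_exit :: "'v \<Rightarrow> real" where
  "mean_exit x = (\<Sum>y\<in>B. green x y * \<mu> y)"

lemma survival_sums: "(\<lambda>n. survival n x) sums mean_exit x"
  unfolding survival_def mean_exit_def green_def
  by (intro sums_sum sums_mult2 summable_sums summable_p)

lemma mean_exit_nonneg: "mean_exit x \<ge> 0"
  unfolding mean_exit_def by (intro sum_nonneg mult_nonneg_nonneg green_nonneg) auto

lemma mean_exit_le: "mean_exit x \<le> \<rho> * (\<Sum>y\<in>B. \<mu> y)" if "x \<in> B"
  unfolding mean_exit_def sum_distrib_left
  using green_le[OF that] by (intro sum_mono mult_right_mono) auto

text \<open>Markov's inequality for the exit time, whose tail is \<open>survival\<close>.\<close>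

lemma survival_le_mean_exit: "real n * survival n x \<le> mean_exit x"
proof -
  have "real n * survival n x = (\<Sum>k<n. survival n x)" by simp
  also have "\<dots> \<le> (\<Sum>k<n. survival k x)"
    by (intro sum_mono survival_decseq) auto
  also have "\<dots> \<le> mean_exit x"
    using survival_sums[of x] survival_nonneg
    by (metis sum_le_suminf finite_lessThan sums_iff)
  finally show ?thesis .
qed

text \<open>The Markov property at time \<open>n\<close> bounds the mean exit time from above by
  \<open>n + survival n x * sup mean_exit\<close>; read backwards, this is a lower bound on survival.\<close>

lemma mean_exit_le_survival:
  "mean_exit x \<le> real n + survival n x * (\<rho> * (\<Sum>y\<in>B. \<mu> y))"
proof -
  have "mean_exit x = (\<Sum>y\<in>B. (\<Sum>k<n. p k x y) * \<mu> y) + (\<Sum>y\<in>B. (\<Sum>w\<in>B. p n x w * \<mu> w * green w y) * \<mu> y)"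
    unfolding mean_exit_def green_split[of x _ n] by (simp only: distrib_right sum.distrib)
  also have "(\<Sum>y\<in>B. (\<Sum>k<n. p k x y) * \<mu> y) = (\<Sum>k<n. survival k x)"
    unfolding survival_def sum_distrib_right by (rule sum.swap)
  also have "\<dots> \<le> (\<Sum>k<n. 1)" by (intro sum_mono survival_le_1)
  also have "(\<Sum>y\<in>B. (\<Sum>w\<in>B. p n x w * \<mu> w * green w y) * \<mu> y) = (\<Sum>w\<in>B. p n x w * \<mu> w * mean_exit w)"
    unfolding mean_exit_def sum_distrib_right sum_distrib_left by (subst sum.swap) (simp only: mult.assoc)
  also have "\<dots> \<le> (\<Sum>w\<in>B. p n x w * \<mu> w * (\<rho> * (\<Sum>y\<in>B. \<mu> y)))"
    by (intro sum_mono mult_left_mono mean_exit_le mult_nonneg_nonneg p_nonneg) auto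
  also have "\<dots> = survival n x * (\<rho> * (\<Sum>y\<in>B. \<mu> y))"
    unfolding survival_def sum_distrib_right ..
  finally show ?thesis by simp
qed

text \<open>Leaving \<open>B\<close> quickly means that few of the \<open>\<mu> x * green x x\<close> visits to \<open>x\<close> that are expected
  before the exit have taken place: by the maximum principle the expected number of visits that are
  still to come is at most \<open>survival n x * \<mu> x * green x x\<close>.\<close>

lemma early_exit_le: "(1 - survival n x) * green x x \<le> (\<Sum>k<n. p k x x)"
proof -
  have "green x x = (\<Sum>k<n. p k x x) + (\<Sum>w\<in>B. p n x w * \<mu> w * green w x)" by (rule green_split)
  also have "(\<Sum>w\<in>B. p n x w * \<mu> w * green w x) \<le> (\<Sum>w\<in>B. p n x w * \<mu> w * green x x)"
    by (intro sum_mono mult_left_mono green_max mult_nonneg_nonneg p_nonneg) auto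
  also have "\<dots> = survival n x * green x x" unfolding survival_def sum_distrib_right ..
  finally show ?thesis by (simp add: algebra_simps)
qed

text \<open>The probability of hitting \<open>y\<close> before leaving \<open>B\<close>, as the function that is harmonic on \<open>B - {y}\<close>, 1 at \<open>y\<close> and
0 outside \<open>B\<close>.\<close>

definition hit :: "'v \<Rightarrow> 'v \<Rightarrow> real" where
  "hit y x = green x y / green y y"

lemma hit_step:
  assumes "y \<in> B" "x \<in> B"
  shows "hit y x = (\<Sum>w\<in>B. step_prob E x w * hit y w) + of_bool (x = y) / (\<mu> y * green y y)"
proof -
  have "green x y = p 0 x y + (\<Sum>w\<in>B. step_prob E x w * green w y)"
  proof -
    have "\<mu> x * green x y = \<mu> x * p 0 x y + (\<Sum>w\<in>B. a x w * green w y)"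
      using green_generator[OF assms(2), of y]
      by (simp add: green_commute[of y] p_commute[of 0 y] del: killed_kernel.simps)
    then have "\<mu> x * green x y = \<mu> x * (p 0 x y + (\<Sum>w\<in>B. step_prob E x w * green w y))"
      by (simp only: mu_step[OF assms(2), symmetric] distrib_left sum_distrib_left mult.assoc)
    then show ?thesis using mu_pos[OF assms(2)] by simp
  qed
  then show ?thesis
    using assms unfolding hit_def by (simp add: add_divide_distrib sum_divide_distrib)
qed

lemma hit_self: "y \<in> B \<Longrightarrow> hit y y = 1"
  using green_pos[of y] by (simp add: hit_def)

lemma hit_outside: "x \<notin> B \<Longrightarrow> hit y x = 0"
  by (simp add: hit_def green_def p_outside1)

lemma dir_hit: "y \<in> B \<Longrightarrow> dir (hit y) (hit y) = 1 / green y y"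
proof -
  assume y: "y \<in> B"
  have "hit y = (\<lambda>x. (1 / green y y) * green y x)"
    by (simp add: fun_eq_iff hit_def green_commute)
  then show ?thesis
    using green_pos[OF y] by (simp only: dir_scale_left dir_scale_right dir_green[OF y]) simp
qed

lemma supported_hit: "supported B (hit y)"
  by (simp add: supported_def hit_outside)

end

section \<open>The path measure of the simple random walk\<close>

text \<open>Quantities of the killed walk are defined by recursion over the first step, so the path
  measure enters through a single fact: conditioning on the first step, \<open>first_step\<close> below, for
  events that are determined by finitely many coordinates.\<close>

definition determined_by :: "nat \<Rightarrow> ((nat \<Rightarrow> 'v) \<Rightarrow> bool) \<Rightarrow> bool" where
  "determined_by n Q \<longleftrightarrow> (\<forall>u u'. (\<forall>i\<le>n. u i = u' i) \<longrightarrow> Q u = Q u')"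

lemma all_le_Suc_split: "(\<forall>i\<le>Suc n. Q i) \<longleftrightarrow> Q 0 \<and> (\<forall>i\<le>n. Q (Suc i))"
  by (metis Suc_le_mono not0_implies_Suc zero_le)

locale graph_random_walk = locally_finite_graph G E for G :: "'v set" and E +
  fixes N :: "'b measure" and X :: "nat \<Rightarrow> 'b \<Rightarrow> 'v" and P :: "'v \<Rightarrow> 'b measure"
  assumes walk: "simple_random_walk G E N X P" and countable_G: "countable G"
begin

lemma measurable_X: "X n \<in> N \<rightarrow>\<^sub>M count_space G"
  using walk by (simp add: simple_random_walk_def)

lemma X_in: "b \<in> space N \<Longrightarrow> X n b \<in> G"
  using measurable_space[OF measurable_X] by simp

lemma prob_space_P: "x \<in> G \<Longrightarrow> prob_space (P x)"
  and sets_P: "x \<in> G \<Longrightarrow> sets (P x) = sets N"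
  and prob_start: "x \<in> G \<Longrightarrow> measure (P x) {b \<in> space N. X 0 b = x} = 1"
  and prob_extend: "x \<in> G \<Longrightarrow> measure (P x) {b \<in> space N. \<forall>i\<le>Suc n. X i b = u i} =
               measure (P x) {b \<in> space N. \<forall>i\<le>n. X i b = u i} * step_prob E (u n) (u (Suc n))"
  using walk by (auto simp: simple_random_walk_def)

lemma space_P: "x \<in> G \<Longrightarrow> space (P x) = space N"
  by (rule sets_eq_imp_space_eq) (rule sets_P)

lemma X_eq_sets: "{b \<in> space N. X n b = y} \<in> sets N"
proof -
  have "{b \<in> space N. X n b = y} = X n -` ({y} \<inter> G) \<inter> space N" using X_in by auto
  then show ?thesis using measurable_sets[OF measurable_X, of "{y} \<inter> G"] by simp
qed

definition cylinder :: "nat \<Rightarrow> (nat \<Rightarrow> 'v) \<Rightarrow> 'b set" where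
  "cylinder n u = {b \<in> space N. \<forall>i\<le>n. X i b = u i}"

definition path_weight :: "nat \<Rightarrow> (nat \<Rightarrow> 'v) \<Rightarrow> real" where
  "path_weight n u = (\<Prod>i<n. step_prob E (u i) (u (Suc i)))"

lemma path_weight_nonneg: "path_weight n u \<ge> 0"
  unfolding path_weight_def by (intro prod_nonneg) (simp add: step_prob_nonneg)

lemma block_sets: "{b \<in> space N. \<forall>i\<le>n. X (i + k) b = u i} \<in> sets N"
proof -
  have "{b \<in> space N. \<forall>i\<in>{..n}. X (i + k) b = u i} \<in> sets N"
    by (intro sets.sets_Collect_finite_All X_eq_sets) simp
  then show ?thesis by (simp only: atMost_iff Ball_def)
qed

lemma cylinder_sets: "cylinder n u \<in> sets N"
  using block_sets[of n 0 u] by (simp only: cylinder_def add_0_right)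

lemma shifted_cylinder_sets: "{b \<in> space N. \<forall>i\<le>n. X (Suc i) b = u i} \<in> sets N"
  using block_sets[of n 1 u] by (simp only: Suc_eq_plus1)

lemma AE_start: "x \<in> G \<Longrightarrow> AE b in P x. X 0 b = x"
  using prob_space.prob_eq_1[OF prob_space_P, of x "{b \<in> space N. X 0 b = x}"]
    prob_start[of x] X_eq_sets[of 0 x] by (auto simp: sets_P)

text \<open>The path measure is determined by its values on cylinders, which are products of step probabilities.\<close>

lemma prob_cylinder:
  assumes x: "x \<in> G"
  shows "measure (P x) (cylinder n u) = of_bool (u 0 = x) * path_weight n u"
proof (induction n)
  case 0
  interpret prob_space "P x" by (rule prob_space_P[OF x])
  have *: "cylinder 0 u = {b \<in> space N. X 0 b = u 0}" by (simp add: cylinder_def)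
  show ?case
  proof (cases "u 0 = x")
    case False
    then have "AE b in P x. b \<notin> cylinder 0 u" using AE_start[OF x] * by auto
    then have "measure (P x) (cylinder 0 u) = measure (P x) {}"
      by (intro measure_eq_AE) (auto simp: sets_P x cylinder_sets)
    then show ?thesis using False by simp
  qed (use prob_start[OF x] * in \<open>simp add: path_weight_def\<close>)
next
  case (Suc n)
  then show ?case using prob_extend[OF x, of n u] by (simp add: cylinder_def path_weight_def)
qed

definition paths :: "nat \<Rightarrow> ((nat \<Rightarrow> 'v) \<Rightarrow> bool) \<Rightarrow> (nat \<Rightarrow> 'v) set" where
  "paths n Q = {u \<in> PiE {..n} (\<lambda>_. G). Q u}"

lemma countable_paths: "countable (paths n Q)"
  unfolding paths_def by (rule countable_subset[OF _ countable_PiE[of "{..n}" "\<lambda>_. G"]])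
    (auto simp: countable_G)

lemma paths_decomposition:
  assumes Q: "determined_by n Q"
  shows "{b \<in> space N. Q (\<lambda>i. X (i + k) b)} = (\<Union>u\<in>paths n Q. {b \<in> space N. \<forall>i\<le>n. X (i + k) b = u i})"
    and "disjoint_family_on (\<lambda>u. {b \<in> space N. \<forall>i\<le>n. X (i + k) b = u i}) (paths n Q)"
proof -
  show "{b \<in> space N. Q (\<lambda>i. X (i + k) b)} = (\<Union>u\<in>paths n Q. {b \<in> space N. \<forall>i\<le>n. X (i + k) b = u i})"
  proof (intro equalityI subsetI)
    fix b assume b: "b \<in> {b \<in> space N. Q (\<lambda>i. X (i + k) b)}"
    define u where "u = restrict (\<lambda>i. X (i + k) b) {..n}"
    have "Q u = Q (\<lambda>i. X (i + k) b)"
      using Q unfolding determined_by_def u_def by (metis atMost_iff restrict_apply)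
    then have "u \<in> paths n Q" using b X_in unfolding paths_def u_def by auto
    then show "b \<in> (\<Union>u\<in>paths n Q. {b \<in> space N. \<forall>i\<le>n. X (i + k) b = u i})"
      using b by (auto simp: u_def intro!: bexI[of _ u])
  next
    fix b assume "b \<in> (\<Union>u\<in>paths n Q. {b \<in> space N. \<forall>i\<le>n. X (i + k) b = u i})"
    then obtain u where u: "Q u" "b \<in> space N" "\<forall>i\<le>n. X (i + k) b = u i" by (auto simp: paths_def)
    have "Q u = Q (\<lambda>i. X (i + k) b)"
      by (rule Q[unfolded determined_by_def, rule_format]) (use u in simp)
    with u show "b \<in> {b \<in> space N. Q (\<lambda>i. X (i + k) b)}" by simp
  qed
  have eq: "u = u'" if "u \<in> paths n Q" "u' \<in> paths n Q" "\<forall>i\<le>n. u i = u' i" for u u'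
    using that unfolding paths_def by (metis (mono_tags, lifting) PiE_ext atMost_iff mem_Collect_eq)
  show "disjoint_family_on (\<lambda>u. {b \<in> space N. \<forall>i\<le>n. X (i + k) b = u i}) (paths n Q)"
    unfolding disjoint_family_on_def
  proof (intro ballI impI)
    fix u u' assume "u \<in> paths n Q" "u' \<in> paths n Q" "u \<noteq> u'"
    then obtain i where "i \<le> n" "u i \<noteq> u' i" using eq by blast
    then show "{b \<in> space N. \<forall>i\<le>n. X (i + k) b = u i} \<inter> {b \<in> space N. \<forall>i\<le>n. X (i + k) b = u' i} = {}"
      by fastforce
  qed
qed

lemma shifted_event_sets:
  assumes "determined_by n Q"
  shows "{b \<in> space N. Q (\<lambda>i. X (i + k) b)} \<in> sets N"
  unfolding paths_decomposition(1)[OF assms]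
  by (intro sets.countable_UN' countable_paths image_subsetI block_sets)

lemma event_sets: "determined_by n Q \<Longrightarrow> {b \<in> space N. Q (\<lambda>i. X i b)} \<in> sets N"
  using shifted_event_sets[of n Q 0] by (simp only: add_0_right)

lemma stay_sets: "{b \<in> space N. \<forall>i\<le>n. X i b \<in> B} \<in> sets N"
  by (rule event_sets[of n]) (simp add: determined_by_def)

lemma avoid_sets: "{b \<in> space N. \<forall>i\<le>n. X i b \<noteq> y} \<in> sets N"
  by (rule event_sets[of n]) (simp add: determined_by_def)

lemma emeasure_event:
  assumes Q: "determined_by n Q" and x: "x \<in> G"
  shows "emeasure (P x) {b \<in> space N. Q (\<lambda>i. X i b)}
       = (\<integral>\<^sup>+u. ennreal (of_bool (u 0 = x) * path_weight n u) \<partial>count_space (paths n Q))"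
proof -
  interpret prob_space "P x" by (rule prob_space_P[OF x])
  have "emeasure (P x) {b \<in> space N. Q (\<lambda>i. X i b)} = (\<integral>\<^sup>+u. emeasure (P x) (cylinder n u) \<partial>count_space (paths n Q))"
    using paths_decomposition[OF Q, of 0] unfolding cylinder_def[symmetric] add_0_right
    by (simp only:) (intro emeasure_UN_countable, auto simp: sets_P x cylinder_sets countable_paths)
  then show ?thesis by (simp add: emeasure_eq_measure prob_cylinder[OF x])
qed

lemma emeasure_shifted_event:
  assumes Q: "determined_by n Q" and x: "x \<in> G"
  shows "emeasure (P x) {b \<in> space N. Q (\<lambda>i. X (Suc i) b)}
       = (\<integral>\<^sup>+u. ennreal (step_prob E x (u 0) * path_weight n u) \<partial>count_space (paths n Q))"
proof -
  interpret prob_space "P x" by (rule prob_space_P[OF x])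
  let ?C = "\<lambda>u. {b \<in> space N. \<forall>i\<le>n. X (Suc i) b = u i}"
  have C: "measure (P x) (?C u) = step_prob E x (u 0) * path_weight n u" for u
  proof -
    have "measure (P x) (?C u) = measure (P x) (cylinder (Suc n) (case_nat x u))"
    proof (rule measure_eq_AE)
      have "AE b in P x. b \<in> space N" using AE_space[of "P x"] by (simp add: space_P[OF x])
      with AE_start[OF x] show "AE b in P x. (b \<in> ?C u) = (b \<in> cylinder (Suc n) (case_nat x u))"
      proof eventually_elim
        case (elim b)
        have "(\<forall>i\<le>Suc n. X i b = (case i of 0 \<Rightarrow> x | Suc j \<Rightarrow> u j)) \<longleftrightarrow> (\<forall>i\<le>n. X (Suc i) b = u i)"
          using elim(1) by (auto split: nat.split)
        then show ?case by (auto simp: cylinder_def)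
      qed
    qed (auto simp: sets_P x cylinder_sets shifted_cylinder_sets)
    also have "\<dots> = step_prob E x (u 0) * path_weight n u"
      by (simp add: prob_cylinder[OF x] path_weight_def prod.lessThan_Suc_shift del: prod.lessThan_Suc)
    finally show ?thesis .
  qed
  have "emeasure (P x) {b \<in> space N. Q (\<lambda>i. X (Suc i) b)} = (\<integral>\<^sup>+u. emeasure (P x) (?C u) \<partial>count_space (paths n Q))"
    using paths_decomposition[OF Q, of 1] unfolding Suc_eq_plus1[symmetric]
    by (simp only:) (intro emeasure_UN_countable, auto simp: sets_P x shifted_cylinder_sets countable_paths)
  then show ?thesis by (simp add: emeasure_eq_measure C)
qed

text \<open>Both sides are sums over the countably many paths of length \<open>n\<close> that satisfy \<open>Q\<close>; a path that starts at \<open>w\<close>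
contributes to the term of \<open>w\<close> only.\<close>

lemma first_step:
  assumes Q: "determined_by n Q" and x: "x \<in> G"
  shows "measure (P x) {b \<in> space N. Q (\<lambda>i. X (Suc i) b)}
       = (\<Sum>w\<in>nbs E x. step_prob E x w * measure (P w) {b \<in> space N. Q (\<lambda>i. X i b)})"
proof -
  interpret prob_space "P x" by (rule prob_space_P[OF x])
  have nG: "w \<in> nbs E x \<Longrightarrow> w \<in> G" for w using nbs_subset by auto
  have fin: "finite (nbs E x)" by (rule finite_nbs[OF x])
  have step: "ennreal (step_prob E x (u 0) * path_weight n u)
      = (\<Sum>w\<in>nbs E x. ennreal (step_prob E x w) * ennreal (of_bool (u 0 = w) * path_weight n u))" for u
  proof -
    have "(\<Sum>w\<in>nbs E x. step_prob E x w * (of_bool (u 0 = w) * path_weight n u))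
        = (\<Sum>w\<in>nbs E x. if u 0 = w then step_prob E x w * path_weight n u else 0)"
      by (intro sum.cong) auto
    also have "\<dots> = step_prob E x (u 0) * path_weight n u"
      using fin by (auto simp: step_prob_def nbs_def)
    finally show ?thesis
      by (simp add: ennreal_mult[symmetric] step_prob_nonneg path_weight_nonneg sum_ennreal)
  qed
  have "ennreal (measure (P x) {b \<in> space N. Q (\<lambda>i. X (Suc i) b)})
      = (\<integral>\<^sup>+u. (\<Sum>w\<in>nbs E x. ennreal (step_prob E x w) * ennreal (of_bool (u 0 = w) * path_weight n u)) \<partial>count_space (paths n Q))"
    unfolding emeasure_eq_measure[symmetric] emeasure_shifted_event[OF Q x] step ..
  also have "\<dots> = (\<Sum>w\<in>nbs E x. ennreal (step_prob E x w) * emeasure (P w) {b \<in> space N. Q (\<lambda>i. X i b)})"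
    using nG by (simp add: nn_integral_sum nn_integral_cmult emeasure_event[OF Q])
  also have "\<dots> = (\<Sum>w\<in>nbs E x. ennreal (step_prob E x w * measure (P w) {b \<in> space N. Q (\<lambda>i. X i b)}))"
    using nG prob_space_P
    by (intro sum.cong refl) (simp add: finite_measure.emeasure_eq_measure[OF prob_space.finite_measure]
        ennreal_mult step_prob_nonneg)
  also have "\<dots> = ennreal (\<Sum>w\<in>nbs E x. step_prob E x w * measure (P w) {b \<in> space N. Q (\<lambda>i. X i b)})"
    by (intro sum_ennreal mult_nonneg_nonneg step_prob_nonneg measure_nonneg)
  finally show ?thesis
    by (subst (asm) ennreal_inj) (auto intro!: sum_nonneg mult_nonneg_nonneg step_prob_nonneg)
qed

lemma sum_step_nbs: "x \<in> G \<Longrightarrow> (\<Sum>w\<in>nbs E x. step_prob E x w) = 1"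
  using deg_pos[of x] by (simp add: step_prob_def nbs_def card_nbs[unfolded nbs_def])

end

locale killed_random_walk = graph_random_walk G E N X P + killed_walk G E B
  for G :: "'v set" and E and N :: "'b measure" and X P B
begin

lemma sum_nbs_eq_sum_B:
  assumes "x \<in> G" "\<And>w. w \<in> G \<Longrightarrow> w \<notin> B \<Longrightarrow> F w = 0"
  shows "(\<Sum>w\<in>nbs E x. step_prob E x w * F w) = (\<Sum>w\<in>B. step_prob E x w * F w)"
proof -
  have "(\<Sum>w\<in>nbs E x. step_prob E x w * F w) = (\<Sum>w\<in>nbs E x \<inter> B. step_prob E x w * F w)"
    using assms nbs_subset by (intro sum.mono_neutral_right finite_nbs) auto
  also have "\<dots> = (\<Sum>w\<in>B. step_prob E x w * F w)"
    using finite_B by (intro sum.mono_neutral_left) (auto simp: step_prob_def nbs_def)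
  finally show ?thesis .
qed

lemma prob_outside_start:
  assumes "x \<in> G" "x \<notin> B"
  shows "measure (P x) {b \<in> space N. (\<forall>i\<le>n. X i b \<in> B) \<and> R b} = 0"
proof -
  have "AE b in P x. \<not> ((\<forall>i\<le>n. X i b \<in> B) \<and> R b)"
    using AE_start[OF assms(1)] by eventually_elim (use assms in auto)
  then have "emeasure (P x) {b \<in> space (P x). (\<forall>i\<le>n. X i b \<in> B) \<and> R b} = 0"
    by (rule emeasure_eq_0_AE)
  then have "emeasure (P x) {b \<in> space N. (\<forall>i\<le>n. X i b \<in> B) \<and> R b} = 0"
    by (simp only: space_P[OF assms(1)])
  then show ?thesis by (simp add: measure_def)
qed

text \<open>A first step from a vertex of \<open>B\<close>, where the condition on the starting point is satisfied.\<close>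

lemma killed_first_step:
  assumes Q: "determined_by n Q" and x: "x \<in> B"
  shows "measure (P x) {b \<in> space N. X 0 b \<in> B \<and> Q (\<lambda>i. X (Suc i) b)}
       = (\<Sum>w\<in>nbs E x. step_prob E x w * measure (P w) {b \<in> space N. Q (\<lambda>i. X i b)})"
proof -
  have xG: "x \<in> G" using x B_subset by auto
  have "measure (P x) {b \<in> space N. X 0 b \<in> B \<and> Q (\<lambda>i. X (Suc i) b)}
      = measure (P x) {b \<in> space N. Q (\<lambda>i. X (Suc i) b)}"
  proof (rule measure_eq_AE)
    show "AE b in P x. (b \<in> {b \<in> space N. X 0 b \<in> B \<and> Q (\<lambda>i. X (Suc i) b)})
       = (b \<in> {b \<in> space N. Q (\<lambda>i. X (Suc i) b)})"
      using AE_start[OF xG] by eventually_elim (use x in auto)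
    show "{b \<in> space N. Q (\<lambda>i. X (Suc i) b)} \<in> sets (P x)"
      using shifted_event_sets[OF Q, of 1] by (simp only: sets_P[OF xG] Suc_eq_plus1)
    have "determined_by (Suc n) (\<lambda>u. u 0 \<in> B \<and> Q (\<lambda>i. u (Suc i)))"
      using Q unfolding determined_by_def by (metis Suc_le_mono zero_le)
    from event_sets[OF this] show "{b \<in> space N. X 0 b \<in> B \<and> Q (\<lambda>i. X (Suc i) b)} \<in> sets (P x)"
      by (simp only: sets_P[OF xG])
  qed
  with first_step[OF Q xG] show ?thesis by simp
qed

lemma prob_killed_at:
  assumes "x \<in> G" "y \<in> B"
  shows "measure (P x) {b \<in> space N. (\<forall>i\<le>n. X i b \<in> B) \<and> X n b = y} = p n x y * \<mu> y"
  using assms(1)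
proof (induction n arbitrary: x)
  case (0 x)
  have *: "{b \<in> space N. (\<forall>i\<le>0. X i b \<in> B) \<and> X 0 b = y} = cylinder 0 (\<lambda>_. y)"
    using assms(2) by (auto simp: cylinder_def)
  show ?case using assms(2) mu_pos[OF assms(2)]
    unfolding * prob_cylinder[OF 0] by (simp add: path_weight_def)
next
  case (Suc n x)
  show ?case
  proof (cases "x \<in> B")
    case False
    then show ?thesis using prob_outside_start[OF Suc.prems False] by (simp add: p_outside1 del: killed_kernel.simps)
  next
    case True
    have "{b \<in> space N. (\<forall>i\<le>Suc n. X i b \<in> B) \<and> X (Suc n) b = y}
      = {b \<in> space N. X 0 b \<in> B \<and> ((\<forall>i\<le>n. X (Suc i) b \<in> B) \<and> X (Suc n) b = y)}"
      by (simp only: all_le_Suc_split conj_assoc)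
    then have "measure (P x) {b \<in> space N. (\<forall>i\<le>Suc n. X i b \<in> B) \<and> X (Suc n) b = y}
       = (\<Sum>w\<in>nbs E x. step_prob E x w * measure (P w) {b \<in> space N. (\<forall>i\<le>n. X i b \<in> B) \<and> X n b = y})"
      using killed_first_step[where Q="\<lambda>u. (\<forall>i\<le>n. u i \<in> B) \<and> u n = y" and n=n, OF _ True]
      by (simp add: determined_by_def)
    also have "\<dots> = (\<Sum>w\<in>B. step_prob E x w * measure (P w) {b \<in> space N. (\<forall>i\<le>n. X i b \<in> B) \<and> X n b = y})"
      by (rule sum_nbs_eq_sum_B[OF Suc.prems prob_outside_start])
    also have "\<dots> = (\<Sum>w\<in>B. step_prob E x w * (p n w y * \<mu> y))"
      using B_subset by (intro sum.cong refl) (simp add: Suc.IH subset_iff)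
    also have "\<dots> = p (Suc n) x y * \<mu> y" using True by (simp add: sum_distrib_right mult.assoc)
    finally show ?thesis .
  qed
qed

lemma prob_survival:
  assumes "x \<in> G"
  shows "measure (P x) {b \<in> space N. \<forall>i\<le>n. X i b \<in> B} = survival n x"
  using assms
proof (induction n arbitrary: x)
  case (0 x)
  show ?case
  proof (cases "x \<in> B")
    case True
    have "measure (P x) {b \<in> space N. \<forall>i\<le>0. X i b \<in> B} = 1"
    proof -
      interpret prob_space "P x" by (rule prob_space_P[OF 0])
      have "measure (P x) {b \<in> space N. X 0 b = x} \<le> measure (P x) {b \<in> space N. \<forall>i\<le>0. X i b \<in> B}"
      proof (rule finite_measure_mono)
        show "{b \<in> space N. \<forall>i\<le>0. X i b \<in> B} \<in> sets (P x)"
          unfolding sets_P[OF 0] by (rule stay_sets)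
      qed (use True in auto)
      then show ?thesis
        using prob_start[OF 0] prob_le_1[of "{b \<in> space N. \<forall>i\<le>0. X i b \<in> B}"] by linarith
    qed
    then show ?thesis using True by (simp add: survival_0)
  next
    case False
    then show ?thesis using prob_outside_start[OF 0 False, of 0 "\<lambda>_. True"] by (simp add: survival_0)
  qed
next
  case (Suc n x)
  show ?case
  proof (cases "x \<in> B")
    case False
    then show ?thesis using prob_outside_start[OF Suc.prems False, of "Suc n" "\<lambda>_. True"]
      by (simp add: survival_Suc)
  next
    case True
    have "{b \<in> space N. \<forall>i\<le>Suc n. X i b \<in> B}
      = {b \<in> space N. X 0 b \<in> B \<and> (\<forall>i\<le>n. X (Suc i) b \<in> B)}"
      by (simp only: all_le_Suc_split conj_assoc)
    then have "measure (P x) {b \<in> space N. \<forall>i\<le>Suc n. X i b \<in> B}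
       = (\<Sum>w\<in>nbs E x. step_prob E x w * measure (P w) {b \<in> space N. \<forall>i\<le>n. X i b \<in> B})"
      using killed_first_step[where Q="\<lambda>u. \<forall>i\<le>n. u i \<in> B" and n=n, OF _ True]
      by (simp add: determined_by_def)
    also have "\<dots> = (\<Sum>w\<in>B. step_prob E x w * measure (P w) {b \<in> space N. \<forall>i\<le>n. X i b \<in> B})"
      using prob_outside_start[where R="\<lambda>_. True" and n=n] by (intro sum_nbs_eq_sum_B[OF Suc.prems]) simp
    also have "\<dots> = survival (Suc n) x"
      using B_subset True unfolding survival_Suc
      by (simp add: Suc.IH subset_iff cong: sum.cong)
    finally show ?thesis .
  qed
qed

end

locale transient_random_walk =
  killed_random_walk G E N X P B + transient_killed_walk G E B \<rho>
  for G :: "'v set" and E and N :: "'b measure" and X P B \<rho>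
begin

text \<open>The function \<open>1 - hit y + survival n\<close> dominates the probability of avoiding \<open>y\<close> because
  both are averaged by a step from a vertex of \<open>B - {y}\<close>.\<close>

lemma prob_avoid_le:
  assumes "x \<in> G" "y \<in> B"
  shows "measure (P x) {b \<in> space N. \<forall>i\<le>n. X i b \<noteq> y} \<le> 1 - hit y x + survival n x"
  using assms(1)
proof (induction n arbitrary: x)
  case (0 x)
  interpret prob_space "P x" by (rule prob_space_P[OF 0])
  show ?case
  proof (cases "x = y")
    case True
    have "measure (P x) {b \<in> space N. \<forall>i\<le>0. X i b \<noteq> y} = measure (P x) {}"
    proof (rule measure_eq_AE)
      show "AE b in P x. (b \<in> {b \<in> space N. \<forall>i\<le>0. X i b \<noteq> y}) = (b \<in> {})"
        using AE_start[OF 0] by eventually_elim (auto simp: True)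
      show "{b \<in> space N. \<forall>i\<le>0. X i b \<noteq> y} \<in> sets (P x)"
        unfolding sets_P[OF 0] by (rule avoid_sets)
    qed simp
    then show ?thesis using True assms(2) hit_self survival_nonneg[of 0 x] by simp
  next
    case False
    have "hit y x \<le> 1"
      using green_max[of x y] green_pos[OF assms(2)] by (simp add: hit_def)
    then show ?thesis
      using prob_le_1[of "{b \<in> space N. \<forall>i\<le>0. X i b \<noteq> y}"] 
      by (cases "x \<in> B") (auto simp: survival_0 hit_outside intro: order_trans)
  qed
next
  case (Suc n x)
  interpret prob_space "P x" by (rule prob_space_P[OF Suc.prems])
  consider "x = y" | "x \<notin> B" | "x \<in> B" "x \<noteq> y" by blast
  then show ?case
  proof cases
    case 1
    have "measure (P x) {b \<in> space N. \<forall>i\<le>Suc n. X i b \<noteq> y} = measure (P x) {}"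
    proof (rule measure_eq_AE)
      show "AE b in P x. (b \<in> {b \<in> space N. \<forall>i\<le>Suc n. X i b \<noteq> y}) = (b \<in> {})"
        using AE_start[OF Suc.prems] by eventually_elim (auto simp: 1)
      show "{b \<in> space N. \<forall>i\<le>Suc n. X i b \<noteq> y} \<in> sets (P x)"
        unfolding sets_P[OF Suc.prems] by (rule avoid_sets)
    qed simp
    then show ?thesis using 1 assms(2) hit_self survival_nonneg[of "Suc n" x] by simp
  next
    case 2
    then show ?thesis using prob_le_1 survival_nonneg[of "Suc n" x]
      by (auto simp: hit_outside intro: order_trans)
  next
    case 3
    have Q: "determined_by n (\<lambda>u. \<forall>i\<le>n. u i \<noteq> y)" by (auto simp: determined_by_def)
    have "measure (P x) {b \<in> space N. \<forall>i\<le>Suc n. X i b \<noteq> y}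
        \<le> measure (P x) {b \<in> space N. \<forall>i\<le>n. X (Suc i) b \<noteq> y}"
    proof (rule finite_measure_mono)
      show "{b \<in> space N. \<forall>i\<le>n. X (Suc i) b \<noteq> y} \<in> events"
        using shifted_event_sets[OF Q, of 1] by (simp only: sets_P[OF Suc.prems] Suc_eq_plus1)
    qed (unfold all_le_Suc_split, blast)
    also have "\<dots> = (\<Sum>w\<in>nbs E x. step_prob E x w * measure (P w) {b \<in> space N. \<forall>i\<le>n. X i b \<noteq> y})"
      by (rule first_step[OF Q Suc.prems])
    also have "\<dots> \<le> (\<Sum>w\<in>nbs E x. step_prob E x w * (1 - hit y w + survival n w))"
      using nbs_subset by (intro sum_mono mult_left_mono Suc.IH step_prob_nonneg) auto
    also have "\<dots> = (\<Sum>w\<in>nbs E x. step_prob E x w) - (\<Sum>w\<in>nbs E x. step_prob E x w * hit y w)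
        + (\<Sum>w\<in>nbs E x. step_prob E x w * survival n w)"
      by (simp add: algebra_simps sum.distrib sum_subtractf)
    also have "\<dots> = 1 - (\<Sum>w\<in>B. step_prob E x w * hit y w) + (\<Sum>w\<in>B. step_prob E x w * survival n w)"
      using Suc.prems by (simp add: sum_step_nbs sum_nbs_eq_sum_B hit_outside survival_def p_outside1)
    also have "\<dots> = 1 - hit y x + survival (Suc n) x"
      using 3 hit_step[OF assms(2), of x] by (simp add: survival_Suc)
    finally show ?thesis .
  qed
qed

text \<open>The first term is the probability that the killed walk never returns to \<open>y\<close>, the reciprocal of the expected
number of its visits to \<open>y\<close>.\<close>

lemma prob_no_return_le:
  assumes y: "y \<in> B"
  shows "measure (P y) {b \<in> space N. \<forall>i\<le>n. X (Suc i) b \<noteq> y} \<le> 1 / (\<mu> y * green y y) + survival (Suc n) y"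
proof -
  have yG: "y \<in> G" using y B_subset by auto
  have Q: "determined_by n (\<lambda>u. \<forall>i\<le>n. u i \<noteq> y)" by (auto simp: determined_by_def)
  have "measure (P y) {b \<in> space N. \<forall>i\<le>n. X (Suc i) b \<noteq> y}
      = (\<Sum>w\<in>nbs E y. step_prob E y w * measure (P w) {b \<in> space N. \<forall>i\<le>n. X i b \<noteq> y})"
    by (rule first_step[OF Q yG])
  also have "\<dots> \<le> (\<Sum>w\<in>nbs E y. step_prob E y w * (1 - hit y w + survival n w))"
    using nbs_subset y by (intro sum_mono mult_left_mono prob_avoid_le step_prob_nonneg) auto
  also have "\<dots> = (\<Sum>w\<in>nbs E y. step_prob E y w) - (\<Sum>w\<in>nbs E y. step_prob E y w * hit y w)
      + (\<Sum>w\<in>nbs E y. step_prob E y w * survival n w)"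
    by (simp add: algebra_simps sum.distrib sum_subtractf)
  also have "\<dots> = 1 - (\<Sum>w\<in>B. step_prob E y w * hit y w) + (\<Sum>w\<in>B. step_prob E y w * survival n w)"
    using yG by (simp add: sum_step_nbs sum_nbs_eq_sum_B hit_outside survival_def p_outside1)
  also have "\<dots> = 1 / (\<mu> y * green y y) + survival (Suc n) y"
    using hit_step[OF y y] hit_self[OF y] y by (simp add: survival_Suc)
  finally show ?thesis .
qed

end

text \<open>The first time at which a path leaves \<open>B\<close> counts the times up to which it has stayed in \<open>B\<close>.\<close>

lemma exit_time_eq_suminf:
  fixes X :: "nat \<Rightarrow> 'v"
  shows "(INF n\<in>{n. X n \<notin> B}. of_nat n :: ennreal) = (\<Sum>n. of_bool (\<forall>i\<le>n. X i \<in> B))"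
proof (cases "\<exists>n. X n \<notin> B")
  case True
  define K where "K = (LEAST n. X n \<notin> B)"
  have K: "X K \<notin> B" unfolding K_def using True by (rule LeastI_ex)
  have least: "X n \<notin> B \<Longrightarrow> K \<le> n" for n unfolding K_def by (rule Least_le)
  have iff: "(\<forall>i\<le>n. X i \<in> B) \<longleftrightarrow> n < K" for n using K least by (meson not_le le_trans)
  have "(INF n\<in>{n. X n \<notin> B}. of_nat n :: ennreal) = of_nat K"
    using K least by (intro antisym INF_lower INF_greatest) auto
  moreover have "(\<Sum>n. of_bool (\<forall>i\<le>n. X i \<in> B) :: ennreal) = (\<Sum>n<K. of_bool (\<forall>i\<le>n. X i \<in> B))"
    by (rule suminf_finite) (auto simp: iff)
  ultimately show ?thesis by (simp add: iff)
next
  case False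
  have "(\<Sum>n. 1 :: ennreal) = (SUP n. of_nat n)"
    by (subst suminf_eq_SUP) auto
  then show ?thesis using False by (simp add: ennreal_SUP_of_nat_eq_top)
qed

lemma exit_time_le_iff:
  fixes X :: "nat \<Rightarrow> 'v"
  shows "(INF n\<in>{n. X n \<notin> B}. of_nat n :: ennreal) \<le> of_nat m \<longleftrightarrow> (\<exists>k\<le>m. X k \<notin> B)"
proof
  assume *: "(INF n\<in>{n. X n \<notin> B}. of_nat n :: ennreal) \<le> of_nat m"
  show "\<exists>k\<le>m. X k \<notin> B"
  proof (rule ccontr)
    assume "\<not> ?thesis"
    then have "n \<ge> Suc m" if "X n \<notin> B" for n using that by (meson not_less_eq_eq)
    then have "of_nat (Suc m) \<le> (INF n\<in>{n. X n \<notin> B}. of_nat n :: ennreal)"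
      by (intro INF_greatest) (simp del: of_nat_Suc)
    from this * have "(of_nat (Suc m) :: ennreal) \<le> of_nat m" by (rule order_trans)
    then show False by (simp add: ennreal_of_nat_eq_real_of_nat del: of_nat_Suc)
  qed
next
  assume "\<exists>k\<le>m. X k \<notin> B"
  then obtain k where k: "k \<le> m" "X k \<notin> B" by blast
  then have "(INF n\<in>{n. X n \<notin> B}. of_nat n :: ennreal) \<le> of_nat k" by (intro INF_lower) auto
  also have "\<dots> \<le> of_nat m" using k by simp
  finally show "(INF n\<in>{n. X n \<notin> B}. of_nat n :: ennreal) \<le> of_nat m" .
qed

context transient_random_walk
begin

lemma nn_integral_exit_time:
  assumes x: "x \<in> G"
  shows "(\<integral>\<^sup>+ b. (INF n\<in>{n. X n b \<notin> B}. of_nat n) \<partial>P x) = ennreal (mean_exit x)"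
proof -
  interpret prob_space "P x" by (rule prob_space_P[OF x])
  have S: "{b \<in> space N. \<forall>i\<le>n. X i b \<in> B} \<in> sets (P x)" for n
    unfolding sets_P[OF x] by (rule stay_sets)
  have "(\<integral>\<^sup>+ b. (INF n\<in>{n. X n b \<notin> B}. of_nat n) \<partial>P x)
      = (\<integral>\<^sup>+ b. (\<Sum>n. indicator {b \<in> space N. \<forall>i\<le>n. X i b \<in> B} b) \<partial>P x)"
    unfolding exit_time_eq_suminf
    by (intro nn_integral_cong suminf_cong)
      (simp only: space_P[OF x] indicator_def mem_Collect_eq simp_thms)
  also have "\<dots> = (\<Sum>n. emeasure (P x) {b \<in> space N. \<forall>i\<le>n. X i b \<in> B})"
    by (simp only: nn_integral_suminf[OF borel_measurable_indicator[OF S]] nn_integral_indicator[OF S])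
  also have "\<dots> = (\<Sum>n. ennreal (survival n x))"
    by (simp add: emeasure_eq_measure prob_survival[OF x])
  also have "\<dots> = ennreal (mean_exit x)"
    using survival_sums[of x] survival_nonneg by (metis suminf_ennreal_eq)
  finally show ?thesis .
qed

end

section \<open>Volume and resistance bounds at one radius\<close>

text \<open>A weakened form of the growth conditions, in which all the prefactors are the same. The exponents 1 for the lower
bound of \<open>v\<close> and for the upper bound of \<open>r\<close> come from \<open>1 \<le> d1\<close> and \<open>\<alpha>2 \<le> 1\<close>. The number \<open>q\<close> fixes how many
powers of the error parameter a ratio of radii has to beat: by \<open>q_large\<close>, a ratio \<open>l ^ q\<close> of radii changes \<open>r\<close>
by a factor of order \<open>l ^ 6\<close> at least.\<close>

locale growth =
  fixes v r :: "real \<Rightarrow> real" and K \<alpha> :: real and b q :: nat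
  assumes v_pos: "0 < R \<Longrightarrow> 0 < v R" and r_pos: "0 < R \<Longrightarrow> 0 < r R"
    and v_mono: "0 \<le> R \<Longrightarrow> R \<le> R' \<Longrightarrow> v R \<le> v R'" and r_mono: "0 \<le> R \<Longrightarrow> R \<le> R' \<Longrightarrow> r R \<le> r R'"
    and v_1: "v 1 = 1" and r_1: "r 1 = 1" and r_0: "r 0 = 0"
    and v_lower: "0 < R \<Longrightarrow> s \<ge> 1 \<Longrightarrow> s * v R \<le> K * v (s * R)"
    and v_upper: "0 < R \<Longrightarrow> s \<ge> 1 \<Longrightarrow> v (s * R) \<le> K * s ^ b * v R"
    and r_lower: "0 < R \<Longrightarrow> s \<ge> 1 \<Longrightarrow> s powr \<alpha> * r R \<le> K * r (s * R)"
    and r_upper: "0 < R \<Longrightarrow> s \<ge> 1 \<Longrightarrow> r (s * R) \<le> K * s * r R"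
    and K_ge_1: "K \<ge> 1" and \<alpha>_pos: "\<alpha> > 0" and \<alpha>_le_1: "\<alpha> \<le> 1" and q_large: "\<alpha> * real q \<ge> 6"
begin

definition w :: "real \<Rightarrow> real" where "w R = v R * r R"

text \<open>The number of powers of the error parameter \<open>l\<close> that suffice to absorb all numerical constants and the change of
\<open>v\<close> and \<open>r\<close> when the radius changes by a factor of order \<open>l ^ q\<close>. It depends on the growth exponents only, and this
is why the final exponents do not depend on the environment or on the starting point.\<close>

definition loss :: nat where "loss = (q + 1) * (b + 1) + 4"

text \<open>The number of powers that are lost on passing from one scale to all times and radii.\<close>

definition total_loss :: nat where "total_loss = 4 * loss + 6 + (loss + 4) * b"

lemma w_pos: "0 < R \<Longrightarrow> 0 < w R" by (simp add: w_def v_pos r_pos)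

lemma r_nonneg: "0 \<le> R \<Longrightarrow> 0 \<le> r R" using r_mono[of 0 R] r_0 by simp

lemma v_nonneg: "0 < R \<Longrightarrow> 0 \<le> v R" using v_pos[of R] by simp

lemma w_mono: "0 < R \<Longrightarrow> R \<le> R' \<Longrightarrow> w R \<le> w R'"
  unfolding w_def by (intro mult_mono v_mono r_mono r_nonneg v_nonneg) auto

lemma w_upper: "0 < R \<Longrightarrow> s \<ge> 1 \<Longrightarrow> w (s * R) \<le> K\<^sup>2 * s ^ (b + 1) * w R"
proof -
  assume R: "0 < R" and s: "s \<ge> 1"
  have "w (s * R) \<le> (K * s ^ b * v R) * (K * s * r R)"
    unfolding w_def using R s v_upper[OF R s] r_upper[OF R s] K_ge_1 v_nonneg[OF R]
    by (intro mult_mono r_nonneg mult_nonneg_nonneg) auto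
  then show ?thesis by (simp add: w_def power2_eq_square mult_ac)
qed

lemma w_lower: "0 < R \<Longrightarrow> s \<ge> 1 \<Longrightarrow> s * w R \<le> K * w (s * R)"
proof -
  assume R: "0 < R" and s: "s \<ge> 1"
  have "s * v R * r R \<le> K * v (s * R) * r (s * R)"
  proof (rule mult_mono[OF v_lower[OF R s]])
    show "r R \<le> r (s * R)" using R mult_right_mono[OF s, of R] by (intro r_mono) auto
  qed (use R s K_ge_1 v_nonneg r_nonneg in auto)
  then show ?thesis by (simp add: w_def mult_ac)
qed

end

definition dform :: "'v set set \<Rightarrow> ('v \<Rightarrow> real) \<Rightarrow> real" where
  "dform E f = enn2real (energy E f)"

lemma (in killed_walk) dform_eq_dir: "supported B f \<Longrightarrow> dform E f = dir f f"
  by (simp add: dform_def energy_eq_dir dir_nonneg)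

lemma energy_affine: "energy E (\<lambda>y. k * (f y - c)) = ennreal (k\<^sup>2) * energy E f"
proof -
  have "(k * (f x - c) - k * (f y - c))\<^sup>2 = k\<^sup>2 * (f x - f y)\<^sup>2" for x y
    by (simp add: power2_eq_square algebra_simps)
  then have "(\<integral>\<^sup>+ (x, y). ennreal ((k * (f x - c) - k * (f y - c))\<^sup>2) \<partial>count_space {(x, y). adj E x y})
     = (\<integral>\<^sup>+ z. ennreal (k\<^sup>2) * (case z of (x, y) \<Rightarrow> ennreal ((f x - f y)\<^sup>2)) \<partial>count_space {(x, y). adj E x y})"
    by (intro nn_integral_cong) (auto simp: ennreal_mult split: prod.split)
  also have "\<dots> = ennreal (k\<^sup>2) * (\<integral>\<^sup>+ (x, y). ennreal ((f x - f y)\<^sup>2) \<partial>count_space {(x, y). adj E x y})"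
    by (rule nn_integral_cmult) simp
  finally show ?thesis unfolding energy_def by (simp add: ennreal_times_divide)
qed

lemma le_inverse_ennrealD:
  assumes "0 < c" "ennreal c \<le> inverse I" shows "I \<le> ennreal (inverse c)"
proof (cases I)
  case (real x)
  show ?thesis
  proof (cases "x = 0")
    case False
    then have "c \<le> inverse x" using assms real by (simp add: inverse_ennreal)
    then have "x \<le> inverse c" using assms real False by (simp add: field_simps)
    then show ?thesis using real by (simp add: ennreal_leI)
  qed (use real in simp)
qed (use assms in simp)

lemma inverse_le_ennrealD:
  assumes "0 < c" "inverse I \<le> ennreal c" shows "ennreal (inverse c) \<le> I"
proof (cases I)
  case (real x)
  have "x \<noteq> 0" using assms real by (auto simp: top_unique)
  then have "inverse x \<le> c" using assms real by (simp add: inverse_ennreal)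
  then have "inverse c \<le> x" using assms real \<open>x \<noteq> 0\<close> by (simp add: field_simps)
  then show ?thesis using real by (simp add: ennreal_leI)
qed simp

locale marked_graph =
  fixes G :: "'v set" and E :: "'v set set" and z :: 'v and d :: "'v \<Rightarrow> 'v \<Rightarrow> real"
  assumes mmg: "marked_metric_graph G E z d"
begin

lemma infinite_G: "infinite G" and z_in: "z \<in> G" and metric: "Metric_space G d"
  and connected: "x \<in> G \<Longrightarrow> y \<in> G \<Longrightarrow> (adj E)\<^sup>*\<^sup>* x y"
  using mmg by (auto simp: marked_metric_graph_def)

end

sublocale marked_graph \<subseteq> locally_finite_graph G E
proof
  show "E \<subseteq> {{x, y} | x y. x \<in> G \<and> y \<in> G}" and fin: "x \<in> G \<Longrightarrow> finite {e \<in> E. x \<in> e}" for x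
    using mmg by (auto simp: marked_metric_graph_def)
  fix x assume x: "x \<in> G"
  obtain y where y: "y \<in> G" "y \<noteq> x"
    using infinite_G by (metis finite.emptyI finite_insert finite_subset insertI1 subsetI)
  from connected[OF x y(1)] y(2) obtain u where "adj E x u"
    by (metis converse_rtranclpE)
  then have "{x, u} \<in> {e \<in> E. x \<in> e}" by (simp add: adj_def)
  then show "deg E x > 0" unfolding deg_def using fin[OF x] by (metis card_gt_0_iff empty_iff)
qed

context marked_graph
begin

lemma countable_G: "countable G"
proof -
  have "finite {y. (adj E ^^ n) z y}" for n
  proof (induction n)
    case (Suc n)
    have sub: "{y. (adj E ^^ n) z y} \<subseteq> G"
      using z_in adj_in by (cases n) auto
    have "{y. (adj E ^^ Suc n) z y} \<subseteq> (\<Union>x\<in>{y. (adj E ^^ n) z y}. nbs E x)"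
      by (auto simp: nbs_def)
    then show ?case
      by (rule finite_subset) (use Suc sub finite_nbs in auto)
  qed simp
  then have "countable (\<Union>n. {y. (adj E ^^ n) z y})" by (intro countable_UN[OF countableI_type] countable_finite)
  moreover have "G \<subseteq> (\<Union>n. {y. (adj E ^^ n) z y})"
    using connected[OF z_in] by (auto simp: rtranclp_power)
  ultimately show ?thesis by (rule countable_subset[rotated])
qed

definition vball :: "real \<Rightarrow> 'v set" where "vball R = {y \<in> G. d z y < R}"

definition vol :: "real \<Rightarrow> real" where "vol R = (\<Sum>y\<in>vball R. real (deg E y))"

lemma d_nonneg: "d x y \<ge> 0" using metric by (simp add: Metric_space_def)

lemma d_zz: "d z z = 0" using metric z_in by (simp add: Metric_space_def)

lemma gball_eq: "gball G d z (ennreal R) = vball R"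
  unfolding gball_def vball_def using d_nonneg by (auto simp: ennreal_less_iff)

lemma vball_subset: "vball R \<subseteq> G" by (auto simp: vball_def)

lemma z_in_vball: "R > 0 \<Longrightarrow> z \<in> vball R" by (simp add: vball_def z_in d_zz)

lemma vball_mono: "R \<le> R' \<Longrightarrow> vball R \<subseteq> vball R'" by (auto simp: vball_def)

lemma emeasure_deg_finite:
  assumes "finite S" "S \<subseteq> G"
  shows "emeasure (deg_measure G E) S = ennreal (\<Sum>y\<in>S. real (deg E y))"
  unfolding deg_measure_def using assms
  by (subst emeasure_point_measure_finite2) (simp_all add: ennreal_of_nat_eq_real_of_nat sum_ennreal)

text \<open>The volume is defined for infinite sets as well, and as each vertex has degree at least 1, a ball of finite
volume is a finite set.\<close>

lemma finite_of_volume: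
  assumes fin: "volume G E z d (ennreal R) < \<infinity>"
  shows "finite (vball R)" and "volume G E z d (ennreal R) = ennreal (vol R)"
proof -
  show f: "finite (vball R)"
  proof (rule ccontr)
    assume inf: "infinite (vball R)"
    have "of_nat n \<le> volume G E z d (ennreal R)" for n
    proof -
      obtain S where S: "finite S" "card S = n" "S \<subseteq> vball R"
        using infinite_arbitrarily_large[OF inf] by blast
      then have SG: "S \<subseteq> G" using vball_subset by auto
      have "real n \<le> (\<Sum>y\<in>S. real (deg E y))"
        using sum_mono[of S "\<lambda>_. 1" "\<lambda>y. real (deg E y)"] deg_pos SG S by (force simp: Suc_le_eq)
      then have "of_nat n \<le> emeasure (deg_measure G E) S"
        unfolding emeasure_deg_finite[OF S(1) SG] ennreal_of_nat_eq_real_of_nat by (rule ennreal_leI)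
      also have "\<dots> \<le> emeasure (deg_measure G E) (vball R)"
        using S vball_subset by (intro emeasure_mono) (auto simp: deg_measure_def sets_point_measure)
      finally show ?thesis by (simp add: volume_def gball_eq)
    qed
    then have "(SUP n. of_nat n :: ennreal) \<le> volume G E z d (ennreal R)" by (rule SUP_least)
    then show False using fin by (simp add: ennreal_SUP_of_nat_eq_top top_unique)
  qed
  show "volume G E z d (ennreal R) = ennreal (vol R)"
    unfolding volume_def gball_eq vol_def by (rule emeasure_deg_finite[OF f vball_subset])
qed

end

locale scaled_graph = marked_graph G E z d + growth v r K \<alpha> b q
  for G :: "'v set" and E z d v r K \<alpha> b q
begin

text \<open>The bounds that define a good radius, in the form in which they are used: a test function in
  place of the lower bound on the resistance to the complement, and oscillation estimates in place of
  the upper bounds on point resistances.\<close>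

definition good :: "real \<Rightarrow> real \<Rightarrow> bool" where
  "good l R \<longleftrightarrow> finite (vball R) \<and> v R \<le> l * vol R \<and> vol R \<le> l * v R \<and>
     (\<exists>u. supported (vball R) u \<and> u z = 1 \<and> r R * dform E u \<le> 2 * l) \<and>
     (\<forall>y\<in>vball R. \<forall>S f. finite S \<and> S \<subseteq> G \<and> supported S f \<longrightarrow>
        (f z - f y)\<^sup>2 \<le> l * r (d z y) * dform E f)"

lemma dform_nonneg: "dform E f \<ge> 0" by (simp add: dform_def)

lemma good_mono:
  assumes g: "good l R" and l: "0 < l" "l \<le> l'" and R: "0 < R"
  shows "good l' R"
proof -
  have vol: "vol R \<ge> 0" unfolding vol_def by (intro sum_nonneg) auto
  have "l * vol R \<le> l' * vol R" "l * v R \<le> l' * v R" using l vol v_nonneg[OF R] by (auto intro: mult_right_mono)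
  moreover have "l * r (d z y) * dform E f \<le> l' * r (d z y) * dform E f" for y f
    using l dform_nonneg r_nonneg[OF d_nonneg] by (intro mult_right_mono) auto
  ultimately show ?thesis using g l unfolding good_def
    by (smt (verit) mult_left_mono)
qed

text \<open>An almost optimal function in the definition of the resistance; the factor 2 makes up for the infimum possibly
not being attained. Its values off the vertex set do not matter for the energy and are set to 0.\<close>

lemma resistance_test_function:
  assumes R: "R > 0" and fin: "finite (vball R)" and l: "l > 0"
    and res: "ennreal (inverse l) * ennreal (r R) \<le> R_eff E {z} (G - vball R)"
  shows "\<exists>u. supported (vball R) u \<and> u z = 1 \<and> r R * dform E u \<le> 2 * l"
proof -
  define I where "I = (INF f \<in> {f \<in> H2 E. (\<forall>x\<in>{z}. f x = 1) \<and> (\<forall>x\<in>G - vball R. f x = 0)}. energy E f)"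
  have rR: "r R > 0" using r_pos[OF R] .
  have "ennreal (r R / l) \<le> inverse I"
    using res l rR unfolding R_eff_def I_def[symmetric]
    by (simp add: ennreal_mult[symmetric] divide_inverse mult.commute)
  from le_inverse_ennrealD[OF _ this] have "I \<le> ennreal (l / r R)" using l rR by simp
  also have "\<dots> < ennreal (2 * l / r R)" using l rR by (simp add: ennreal_less_iff divide_strict_right_mono)
  finally obtain f where f: "f z = 1" "\<forall>x\<in>G - vball R. f x = 0" "energy E f < ennreal (2 * l / r R)"
    unfolding I_def INF_less_iff by auto
  define u where "u = (\<lambda>y. if y \<in> vball R then f y else 0)"
  have "u x = f x" if "x \<in> G" for x using f(2) that by (auto simp: u_def)
  then have "energy E u = energy E f"
    unfolding energy_def using adj_in by (intro arg_cong2[where f="(/)"] nn_integral_cong refl) auto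
  then have "dform E u \<le> 2 * l / r R"
    using f(3) l rR unfolding dform_def by (intro enn2real_leI) auto
  then have "r R * dform E u \<le> 2 * l" using rR by (simp add: field_simps)
  moreover have "supported (vball R) u" "u z = 1"
    using f(1) z_in_vball[OF R] by (auto simp: supported_def u_def)
  ultimately show ?thesis by blast
qed

text \<open>If \<open>f z \<noteq> f y\<close>, then the affine image of \<open>f\<close> with values 1 at \<open>z\<close> and 0 at \<open>y\<close> is admissible in the definition of
\<open>R_eff\<close>.\<close>

lemma resistance_oscillation:
  assumes y: "y \<in> G" and res: "R_eff_pt E z y \<le> ennreal l * ennreal (r (d z y))" and l: "l > 0"
    and S: "finite S" "S \<subseteq> G" "supported S f"
  shows "(f z - f y)\<^sup>2 \<le> l * r (d z y) * dform E f"
proof (cases "f z = f y")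
  case True
  then show ?thesis using l dform_nonneg r_nonneg[OF d_nonneg] by simp
next
  case False
  then have "z \<noteq> y" by auto
  then have d: "d z y > 0" using metric z_in y d_nonneg[of z y] by (auto simp: Metric_space_def less_le)
  define \<rho> where "\<rho> = l * r (d z y)"
  have \<rho>: "\<rho> > 0" unfolding \<rho>_def using l r_pos[OF d] by simp
  define \<delta> where "\<delta> = f z - f y"
  have \<delta>: "\<delta> \<noteq> 0" using False by (simp add: \<delta>_def)
  interpret killed_walk G E S using S by unfold_locales
  have en: "energy E f = ennreal (dform E f)" using S by (simp add: energy_eq_dir dform_eq_dir)
  define u where "u = (\<lambda>x. inverse \<delta> * (f x - f y))"
  have eu: "energy E u = ennreal ((inverse \<delta>)\<^sup>2 * dform E f)"
    unfolding u_def energy_affine en by (simp add: ennreal_mult dform_nonneg)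
  define I where "I = (INF f \<in> {f \<in> H2 E. (\<forall>x\<in>{z}. f x = 1) \<and> (\<forall>x\<in>{y}. f x = 0)}. energy E f)"
  have "I \<le> energy E u"
    unfolding I_def using \<delta> eu by (intro INF_lower) (auto simp: H2_def u_def \<delta>_def)
  moreover have "inverse I \<le> ennreal \<rho>"
    using res \<open>z \<noteq> y\<close> l r_nonneg[OF d_nonneg] unfolding R_eff_pt_def R_eff_def I_def[symmetric]
    by (simp add: ennreal_mult[symmetric] \<rho>_def)
  then have "ennreal (inverse \<rho>) \<le> I" by (rule inverse_le_ennrealD[OF \<rho>])
  ultimately have "ennreal (inverse \<rho>) \<le> ennreal ((inverse \<delta>)\<^sup>2 * dform E f)"
    using eu by simp
  then have "inverse \<rho> \<le> (inverse \<delta>)\<^sup>2 * dform E f"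
    by (subst (asm) ennreal_le_iff) (simp_all add: dform_nonneg)
  then have "(\<rho> * \<delta>\<^sup>2) * inverse \<rho> \<le> (\<rho> * \<delta>\<^sup>2) * ((inverse \<delta>)\<^sup>2 * dform E f)"
    using \<rho> by (intro mult_left_mono) auto
  moreover have "(\<rho> * \<delta>\<^sup>2) * inverse \<rho> = \<delta>\<^sup>2" using \<rho> by simp
  moreover have "(\<rho> * \<delta>\<^sup>2) * ((inverse \<delta>)\<^sup>2 * dform E f) = \<rho> * dform E f"
    using \<delta> by (simp add: power2_eq_square field_simps)
  ultimately have "\<delta>\<^sup>2 \<le> \<rho> * dform E f" by linarith
  then show ?thesis by (simp add: \<delta>_def \<rho>_def)
qed

text \<open>Two vertices of the ball are compared through the marked vertex; the factor 4 comes from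
\<open>(s + t)\<^sup>2 \<le> 2 * s\<^sup>2 + 2 * t\<^sup>2\<close>.\<close>

lemma good_oscillation:
  assumes g: "good l R" and l: "l > 0" and xy: "x \<in> vball R" "y \<in> vball R"
    and S: "finite S" "S \<subseteq> G" "supported S f"
  shows "(f x - f y)\<^sup>2 \<le> 4 * l * r R * dform E f"
proof -
  have *: "(f z - f y)\<^sup>2 \<le> l * r R * dform E f" if "y \<in> vball R" for y
  proof -
    have "(f z - f y)\<^sup>2 \<le> l * r (d z y) * dform E f" using g that S unfolding good_def by blast
    also have "\<dots> \<le> l * r R * dform E f"
      using that l dform_nonneg d_nonneg
      by (intro mult_right_mono mult_left_mono r_mono) (auto simp: vball_def)
    finally show ?thesis .
  qed
  have "(f x - f y)\<^sup>2 \<le> 2 * (f z - f x)\<^sup>2 + 2 * (f z - f y)\<^sup>2"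
    using zero_le_power2[of "(f z - f x) + (f z - f y)"] by (simp add: power2_eq_square algebra_simps)
  with *[OF xy(1)] *[OF xy(2)] show ?thesis by linarith
qed

lemma vol_pos: "R > 0 \<Longrightarrow> finite (vball R) \<Longrightarrow> vol R > 0"
  unfolding vol_def using z_in_vball[of R] deg_pos vball_subset
  by (intro sum_pos2[of _ z]) auto

lemma kernel_upper:
  assumes g: "good l R" and l: "l > 0" and R: "R > 0" and x: "x \<in> vball R" and n: "n \<ge> 1"
    and S: "finite S" "S \<subseteq> G"
  shows "killed_kernel E S (2 * n) x x \<le> 8 * l / v R + 64 * l * r R / real n"
proof -
  interpret killed_walk G E S using S by unfold_locales
  have fin: "finite (vball R)" using g by (simp add: good_def)
  have "killed_kernel E S (2 * n) x x \<le> 8 / (\<Sum>y\<in>vball R. \<mu> y) + 16 * (4 * l * r R) / real n"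
  proof (rule on_diagonal_upper[OF fin vball_subset x _ n])
    show "0 \<le> 4 * l * r R" using l r_nonneg[of R] R by simp
    show "(f u - f w)\<^sup>2 \<le> 4 * l * r R * dir f f" if "supported S f" "u \<in> vball R" "w \<in> vball R" for f u w
      using good_oscillation[OF g l that(2,3) S that(1)] dform_eq_dir[OF that(1)] by simp
  qed
  moreover have "8 / vol R \<le> 8 * l / v R"
    using g l v_pos[OF R] vol_pos[OF R fin] by (simp add: good_def field_simps)
  ultimately show ?thesis by (simp add: vol_def)
qed

end

lemma sum_inverse_le_ln:
  assumes "n \<ge> 1" shows "(\<Sum>i=1..n. 1 / real i) \<le> 1 + ln (real n)"
  using assms
proof (induction n rule: dec_induct)
  case (step n)
  have "ln (1 - 1 / real (Suc n)) \<le> - (1 / real (Suc n))"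
    using step by (intro ln_le_minus_one[THEN order_trans]) auto
  moreover have "1 - 1 / real (Suc n) = real n / real (Suc n)" by (simp add: field_simps)
  ultimately have "1 / real (Suc n) \<le> ln (real (Suc n)) - ln (real n)"
    using step by (simp add: ln_div)
  with step show ?case by simp
qed simp

section \<open>The random walk at one scale\<close>

text \<open>Three good radii \<open>Rm < R < Rp\<close> with the same error parameter \<open>l\<close> and ratio about \<open>l ^ q\<close>. The
large ball provides a vertex outside the ball of radius \<open>R\<close> that is close in resistance, which bounds
Green functions from above; on the small ball the Green functions are nearly constant. The number 1200
exceeds all numerical constants that have to be absorbed, the largest of which is 1168 in \<open>early_exit\<close>.\<close>

locale at_scale = scaled_graph G E z d v r K \<alpha> b q + graph_random_walk G E N X P
  for G :: "'v set" and E z d v r K \<alpha> b q and N :: "'b measure" and X P +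
  fixes l Rm R Rp s :: real
  assumes good_Rm: "good l Rm" and good_R: "good l R" and good_Rp: "good l Rp"
    and Rm_ge_1: "Rm \<ge> 1" and R_eq: "R = s * Rm" and Rp_eq: "Rp = s * R"
    and s_lower: "l ^ q \<le> s" and s_upper: "s \<le> 2 * l ^ q" and l_large: "l \<ge> 1200 * K"
begin

lemma l_ge: "l \<ge> 1200" "l > 0" "l \<ge> 1"
  using l_large K_ge_1 by auto

lemma s_ge_1: "s \<ge> 1"
  using s_lower one_le_power[OF l_ge(3), of q] by linarith

lemma R_ge_1: "R \<ge> 1" "R > 0" "Rm > 0" "Rp > 0" "Rm \<le> R" "R \<le> Rp"
proof -
  show "Rm > 0" using Rm_ge_1 by simp
  show "Rm \<le> R" unfolding R_eq using mult_right_mono[OF s_ge_1, of Rm] \<open>Rm > 0\<close> by simp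
  then show "R \<ge> 1" "R > 0" using Rm_ge_1 by auto
  then show "R \<le> Rp" unfolding Rp_eq using mult_right_mono[OF s_ge_1, of R] by simp
  then show "Rp > 0" using \<open>R > 0\<close> by simp
qed

lemma l6_le: "l ^ 6 \<le> s powr \<alpha>"
proof -
  have "l ^ 6 = l powr 6" using l_ge by simp
  also have "\<dots> \<le> l powr (real q * \<alpha>)" using q_large l_ge by (intro powr_mono) (auto simp: mult.commute)
  also have "\<dots> = (l ^ q) powr \<alpha>" by (simp only: powr_powr[symmetric] powr_realpow[OF l_ge(2)])
  also have "\<dots> \<le> s powr \<alpha>" using s_lower \<alpha>_pos l_ge by (intro powr_mono2) auto
  finally show ?thesis .
qed

lemma r_gain: "l ^ 6 * r Rm \<le> K * r R"
  unfolding R_eq using mult_right_mono[OF l6_le r_nonneg[of Rm]] r_lower[OF R_ge_1(3) s_ge_1] R_ge_1(3)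
  by linarith

lemma v_gain: "l ^ 6 * v R \<le> K * v Rp"
proof -
  have "6 \<le> q"
  proof -
    have "\<alpha> * real q \<le> 1 * real q" using \<alpha>_le_1 by (intro mult_right_mono) auto
    then show ?thesis using q_large by simp
  qed
  then have "l ^ 6 \<le> l ^ q" using l_ge by (intro power_increasing) auto
  then have "l ^ 6 \<le> s" using s_lower by linarith
  then have "l ^ 6 * v R \<le> s * v R" using v_nonneg[OF R_ge_1(2)] by (rule mult_right_mono)
  also have "\<dots> \<le> K * v Rp" unfolding Rp_eq by (rule v_lower[OF R_ge_1(2) s_ge_1])
  finally show ?thesis .
qed

text \<open>As \<open>Rp / R\<close> is a large power of \<open>l\<close>, the volume bounds are incompatible with equality of the two balls. Following
an edge out of the smaller ball would not do: \<open>d\<close> is an arbitrary metric, and neighbours may be far apart.\<close>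

lemma outer_vertex: "\<exists>y\<in>vball Rp. y \<notin> vball R"
proof (rule ccontr)
  assume "\<not> ?thesis"
  then have "vball Rp \<subseteq> vball R" by auto
  then have "vol Rp \<le> vol R"
    unfolding vol_def using good_R by (intro sum_mono2) (auto simp: good_def)
  then have "v Rp \<le> l * (l * v R)"
    using good_R good_Rp l_ge unfolding good_def by (smt (verit) mult_left_mono)
  then have "l ^ 6 * v R \<le> K * (l * (l * v R))"
    using v_gain mult_left_mono[of "v Rp" "l * (l * v R)" K] K_ge_1 by linarith
  also have "\<dots> < l * (l * (l * v R))"
    using l_large K_ge_1 v_pos[OF R_ge_1(2)] l_ge by (intro mult_strict_right_mono) auto
  also have "\<dots> = l ^ 3 * v R" by (simp add: power3_eq_cube)
  also have "\<dots> \<le> l ^ 6 * v R"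
    using l_ge v_nonneg[OF R_ge_1(2)] by (intro mult_right_mono power_increasing) auto
  finally show False by simp
qed

end

sublocale at_scale \<subseteq> transient_random_walk G E N X P "vball R" "4 * l * r Rp"
proof
  show fin: "finite (vball R)" using good_R by (simp add: good_def)
  show "vball R \<subseteq> G" by (rule vball_subset)
  interpret killed_walk G E "vball R" by unfold_locales (fact fin, fact vball_subset)
  fix x f assume x: "x \<in> vball R" and f: "supported (vball R) f"
  obtain y where y: "y \<in> vball Rp" "y \<notin> vball R" using outer_vertex by blast
  have "x \<in> vball Rp" using x vball_mono[of R Rp] R_ge_1 by auto
  from good_oscillation[OF good_Rp l_ge(2) this y(1) fin vball_subset f]
  show "(f x)\<^sup>2 \<le> 4 * l * r Rp * dir f f"
    using f y(2) dform_eq_dir[OF f] by (simp add: supported_def)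
qed

context at_scale
begin

lemma Rm_in: "x \<in> vball Rm \<Longrightarrow> x \<in> vball R"
  using vball_mono[of Rm R] R_ge_1 by auto

lemma inner_oscillation:
  assumes "supported (vball R) f" "x \<in> vball Rm" "y \<in> vball Rm"
  shows "(f x - f y)\<^sup>2 \<le> 4 * l * r Rm * dir f f"
  using good_oscillation[OF good_Rm l_ge(2) assms(2,3) finite_B B_subset assms(1)]
    dform_eq_dir[OF assms(1)] by simp

lemma K_r_bound: "c * K \<le> l ^ 4 \<Longrightarrow> c \<ge> 0 \<Longrightarrow> c * l\<^sup>2 * r Rm \<le> r R"
proof -
  assume c: "c * K \<le> l ^ 4" "c \<ge> 0"
  have "K * (c * l\<^sup>2 * r Rm) = (c * K) * l\<^sup>2 * r Rm" by simp
  also have "\<dots> \<le> l ^ 4 * l\<^sup>2 * r Rm"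
    using c r_nonneg[of Rm] R_ge_1 by (intro mult_right_mono) auto
  also have "\<dots> \<le> K * r R" using r_gain by (simp add: power_add[symmetric])
  finally show ?thesis using K_ge_1 by simp
qed

lemma l_powers: "l\<^sup>2 \<ge> 1200 * K" "l ^ 4 \<ge> 1200 * K"
  using power_increasing[of 1 2 l] power_increasing[of 1 4 l] l_large l_ge by auto

text \<open>The test function \<open>u\<close> has \<open>u z = 1\<close>, and \<open>(u z)\<^sup>2 \<le> dir u u * green z z\<close>.\<close>

lemma green_center: "r R \<le> 2 * l * green z z"
proof -
  obtain u where u: "supported (vball R) u" "u z = 1" "r R * dform E u \<le> 2 * l"
    using good_R by (auto simp: good_def)
  have g: "green z z \<ge> 0" by (rule green_nonneg)
  have "1 \<le> dir u u * green z z"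
    using evaluation_green[OF z_in_vball[OF R_ge_1(2)], of u] u(2) by simp
  then have "r R \<le> r R * (dir u u * green z z)"
    using r_nonneg[of R] R_ge_1 by (simp add: mult_le_cancel_left1)
  also have "\<dots> = (r R * dform E u) * green z z" using dform_eq_dir[OF u(1)] by simp
  also have "\<dots> \<le> 2 * l * green z z" using u(3) g by (rule mult_right_mono)
  finally show ?thesis .
qed

lemma near_of_sq: "(e - c)\<^sup>2 \<le> (t * e)\<^sup>2 \<Longrightarrow> e \<ge> 0 \<Longrightarrow> t \<ge> 0 \<Longrightarrow> c \<ge> (1 - t) * (e::real)"
  using abs_le_square_iff[of "e - c" "t * e"] by (simp add: algebra_simps abs_le_iff)

text \<open>The resistance across the small ball is at most 1/16 of \<open>green z z\<close>. The bound is transported first from \<open>(z, z)\<close>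
to \<open>(z, x)\<close>, then by Cauchy and Schwarz to \<open>(x, x)\<close>, and from there to \<open>(x, y)\<close>.\<close>

lemma green_lower:
  assumes x: "x \<in> vball Rm" and y: "y \<in> vball Rm"
  shows "r R \<le> 8 * l * green x y"
proof -
  define g where "g = green z z"
  define \<rho> where "\<rho> = 4 * l * r Rm"
  have zm: "z \<in> vball Rm" using z_in_vball R_ge_1 by auto
  have zB: "z \<in> vball R" and xB: "x \<in> vball R" using zm x Rm_in by auto
  have g: "g > 0" unfolding g_def by (rule green_pos[OF zB])
  have "128 * l\<^sup>2 * r Rm \<le> r R" using l_powers K_ge_1 by (intro K_r_bound) auto
  then have "128 * l\<^sup>2 * r Rm \<le> 2 * l * g" unfolding g_def using green_center by linarith
  then have "2 * l * (16 * \<rho>) \<le> 2 * l * g" by (simp add: \<rho>_def power2_eq_square)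
  then have \<rho>g: "16 * \<rho> \<le> g" using l_ge by (simp only: mult_le_cancel_left_pos[of "2 * l"])
  have "(green z z - green z x)\<^sup>2 \<le> \<rho> * g"
    using inner_oscillation[OF supported_green zm x, of z] dir_green[OF zB] by (simp add: \<rho>_def g_def)
  also have "\<dots> \<le> (1/4 * g)\<^sup>2" using mult_right_mono[OF \<rho>g, of g] g by (simp add: power2_eq_square)
  finally have gzx: "3/4 * g \<le> green z x" using near_of_sq[of g "green z x" "1/4"] g by (simp add: g_def)
  have "(3/4 * g)\<^sup>2 \<le> (green z x)\<^sup>2" using gzx g by (intro power_mono) auto
  also have "\<dots> \<le> g * green x x" using evaluation_green[OF xB, of "green z"] dir_green[OF zB] by (simp add: g_def)
  finally have gx: "9/16 * g \<le> green x x" using g by (simp add: power2_eq_square)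
  define h where "h = green x x"
  have h: "9/16 * g \<le> h" "h > 0" using gx g by (auto simp: h_def)
  have "(green x x - green x y)\<^sup>2 \<le> \<rho> * h"
    using inner_oscillation[OF supported_green x y, of x] dir_green[OF xB] by (simp add: \<rho>_def h_def)
  also have "\<dots> \<le> (1/9 * h) * h" using \<rho>g h by (intro mult_right_mono) auto
  also have "\<dots> = (1/3 * h)\<^sup>2" by (simp add: power2_eq_square)
  finally have "2/3 * h \<le> green x y" using near_of_sq[of h "green x y" "1/3"] h by (simp add: h_def)
  with h have "1/4 * g \<le> green x y" using g by linarith
  then have "2 * l * g \<le> 2 * l * (4 * green x y)" using l_ge by (intro mult_left_mono) auto
  with green_center show ?thesis by (simp add: g_def)
qed

text \<open>\<open>hit y\<close> has energy \<open>1 / green y y\<close>, which is so small that \<open>hit y\<close> hardly varies on the small ball.\<close>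

lemma hit_inner:
  assumes x: "x \<in> vball Rm" and y: "y \<in> vball Rm"
  shows "1 - hit y x \<le> 1 / l"
proof -
  have yB: "y \<in> vball R" using y Rm_in by auto
  have gpos: "green y y > 0" by (rule green_pos[OF yB])
  have rR: "r R > 0" using r_pos R_ge_1 by auto
  have l2: "l\<^sup>2 > 0" using l_ge by simp
  have "(hit y y - hit y x)\<^sup>2 \<le> 4 * l * r Rm * (1 / green y y)"
    using inner_oscillation[OF supported_hit y x, of y] dir_hit[OF yB] by simp
  also have "1 / green y y \<le> 8 * l / r R"
    using green_lower[OF y y] rR gpos by (simp add: field_simps)
  also have "4 * l * r Rm * (8 * l / r R) = 32 * l\<^sup>2 * r Rm / r R" by (simp add: power2_eq_square)
  also have "\<dots> \<le> 1 / l\<^sup>2"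
  proof -
    have "(32 * l\<^sup>2) * l\<^sup>2 * r Rm \<le> r R"
    proof (rule K_r_bound)
      have "(32 * l\<^sup>2) * K \<le> l\<^sup>2 * l\<^sup>2"
        using l_powers K_ge_1 mult_left_mono[of "32 * K" "l\<^sup>2" "l\<^sup>2"] by (simp add: mult_ac)
      then show "32 * l\<^sup>2 * K \<le> l ^ 4" by (simp add: power_add[symmetric])
    qed simp
    then show ?thesis using rR l2 by (simp add: field_simps)
  qed
  also have "1 / l\<^sup>2 = (1 / l)\<^sup>2" by (simp add: power_divide)
  finally have "\<bar>hit y y - hit y x\<bar> \<le> \<bar>1 / l\<bar>"
    using r_nonneg[of Rm] R_ge_1 l_ge by (subst abs_le_square_iff) (auto simp: mult_left_mono)
  then show ?thesis using hit_self[OF yB] l_ge by (simp add: abs_le_iff)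
qed

lemma s_power: "K\<^sup>2 * s ^ (b + 1) \<le> l ^ (loss - 2)" and s_power': "K * s ^ b \<le> l ^ (loss - 3)"
  and s_power1: "K * s \<le> l ^ (loss - 3)"
proof -
  have Kl: "K \<le> l" using l_large K_ge_1 by linarith
  have "2 * l ^ q \<le> l * l ^ q" using l_ge by (intro mult_right_mono) auto
  then have "s \<le> l * l ^ q" using s_upper by linarith
  then have s: "s \<le> l ^ (q + 1)" by simp
  have sp: "s ^ k \<le> l ^ ((q + 1) * k)" for k
    using power_mono[OF s, of k] s_ge_1 by (simp only: power_mult)
  have "K\<^sup>2 * s ^ (b + 1) \<le> l\<^sup>2 * l ^ ((q + 1) * (b + 1))"
    using Kl K_ge_1 s_ge_1 by (intro mult_mono sp power_mono) auto
  moreover have "loss - 2 = 2 + (q + 1) * (b + 1)" by (simp add: loss_def)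
  ultimately show "K\<^sup>2 * s ^ (b + 1) \<le> l ^ (loss - 2)" by (simp only: power_add[symmetric])
  have "K * s ^ b \<le> l ^ 1 * l ^ ((q + 1) * b)"
    using Kl K_ge_1 s_ge_1 by (intro mult_mono sp) auto
  also have "\<dots> \<le> l ^ (loss - 3)"
    unfolding power_add[symmetric] loss_def using l_ge by (intro power_increasing) auto
  finally show "K * s ^ b \<le> l ^ (loss - 3)" .
  have "K * s \<le> l ^ 1 * l ^ (q + 1)"
    using Kl K_ge_1 s_ge_1 s l_ge by (intro mult_mono) auto
  also have "\<dots> \<le> l ^ (loss - 3)"
    unfolding power_add[symmetric] loss_def using l_ge by (intro power_increasing) auto
  finally show "K * s \<le> l ^ (loss - 3)" .
qed

lemma mean_exit_lower:
  assumes x: "x \<in> vball Rm" shows "w R \<le> l ^ loss * mean_exit x"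
proof -
  have rR: "r R > 0" using r_pos R_ge_1 by auto
  have fin: "finite (vball Rm)" using good_Rm by (simp add: good_def)
  have "r R * vol Rm = (\<Sum>y\<in>vball Rm. r R * \<mu> y)" by (simp add: vol_def sum_distrib_left)
  also have "\<dots> \<le> (\<Sum>y\<in>vball Rm. 8 * l * green x y * \<mu> y)"
    using green_lower[OF x] by (intro sum_mono mult_right_mono) auto
  also have "\<dots> \<le> (\<Sum>y\<in>vball R. 8 * l * green x y * \<mu> y)"
    using finite_B Rm_in l_ge green_nonneg by (intro sum_mono2) auto
  also have "\<dots> = 8 * l * mean_exit x" by (simp add: mean_exit_def sum_distrib_left mult.assoc)
  finally have 1: "r R * vol Rm \<le> 8 * l * mean_exit x" .
  have vm: "v Rm \<le> l * vol Rm" using good_Rm by (simp add: good_def)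
  have m: "mean_exit x \<ge> 0" by (rule mean_exit_nonneg)
  have "v R \<le> K * s ^ b * v Rm" unfolding R_eq by (rule v_upper[OF R_ge_1(3) s_ge_1])
  also have "\<dots> \<le> l ^ (loss - 3) * (l * vol Rm)"
    using s_power' vm v_nonneg[OF R_ge_1(3)] l_ge by (intro mult_mono) auto
  finally have "w R \<le> l ^ (loss - 3) * (l * vol Rm) * r R"
    unfolding w_def using rR by (intro mult_right_mono) auto
  also have "\<dots> = l ^ (loss - 3) * l * (r R * vol Rm)" by simp
  also have "\<dots> \<le> l ^ (loss - 3) * l * (8 * l * mean_exit x)"
    using 1 l_ge by (intro mult_left_mono) auto
  also have "\<dots> \<le> l ^ (loss - 3) * l * (l * l * mean_exit x)"
    using l_ge m by (intro mult_left_mono mult_right_mono) auto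
  also have "\<dots> = l ^ (loss - 3 + 3) * mean_exit x" by (simp only: power_add power3_eq_cube mult_ac)
  also have "loss - 3 + 3 = loss" by (simp add: loss_def)
  finally show ?thesis .
qed

lemma exit_constant: "4 * l * r Rp * (\<Sum>y\<in>vball R. \<mu> y) \<le> l ^ loss * w R"
proof -
  have rR: "r R > 0" using r_pos R_ge_1 by auto
  have "r Rp \<le> K * s * r R" unfolding Rp_eq by (rule r_upper[OF R_ge_1(2) s_ge_1])
  also have "\<dots> \<le> l ^ (loss - 3) * r R" using s_power1 rR by (intro mult_right_mono) auto
  finally have "4 * l * r Rp * vol R \<le> l * l * (l ^ (loss - 3) * r R) * (l * v R)"
    using l_ge good_R r_nonneg[of Rp] R_ge_1 vol_pos[of R] rR
    by (intro mult_mono) (auto simp: good_def)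
  also have "\<dots> = l ^ (loss - 3 + 3) * w R" by (simp only: power_add power3_eq_cube mult_ac w_def)
  also have "loss - 3 + 3 = loss" by (simp add: loss_def)
  finally show ?thesis by (simp add: vol_def)
qed

lemma mean_exit_upper:
  assumes "x \<in> vball R" shows "mean_exit x \<le> l ^ loss * w R"
  using mean_exit_le[OF assms] exit_constant by linarith

text \<open>At a time \<open>n\<close> well below the mean exit time, the walk must survive with a probability of at least the order of
the ratio of the mean exit time to its maximum over starting points.\<close>

lemma survival_lower:
  assumes x: "x \<in> vball Rm" and n: "real n * l ^ (loss + 1) \<le> w R"
  shows "1 \<le> l ^ (2 * loss + 1) * survival n x"
proof -
  have wR: "w R > 0" using w_pos R_ge_1 by auto
  have L: "l ^ loss > 0" using l_ge by simp
  have "mean_exit x \<le> real n + survival n x * (l ^ loss * w R)"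
    using mean_exit_le_survival[of x n] mult_left_mono[OF exit_constant survival_nonneg[of n x]] by linarith
  then have "w R \<le> l ^ loss * real n + l ^ loss * (survival n x * (l ^ loss * w R))"
    using mean_exit_lower[OF x] mult_left_mono[of "mean_exit x" "real n + survival n x * (l ^ loss * w R)" "l ^ loss"] L
    by (simp add: algebra_simps)
  moreover have "2 * (l ^ loss * real n) \<le> w R"
  proof -
    have "2 * (l ^ loss * real n) \<le> l * (l ^ loss * real n)" using l_ge by (intro mult_right_mono) auto
    then show ?thesis using n by (simp add: mult_ac)
  qed
  ultimately have "w R \<le> 2 * (l ^ loss * (survival n x * (l ^ loss * w R)))" by linarith
  also have "\<dots> \<le> l * (l ^ loss * (survival n x * (l ^ loss * w R)))"
    using l_ge survival_nonneg[of n x] wR by (intro mult_right_mono) auto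
  also have "\<dots> = l ^ (2 * loss + 1) * survival n x * w R" by (simp add: power_add mult_2 mult_ac)
  finally show ?thesis using wR by simp
qed

lemma survival_upper:
  assumes x: "x \<in> vball R" and n: "l ^ (loss + 1) * w R \<le> real n"
  shows "survival n x \<le> 1 / l"
proof -
  have wR: "w R > 0" using w_pos R_ge_1 by auto
  have L: "l ^ loss * w R > 0" using l_ge wR by simp
  have "l ^ (loss + 1) * w R * survival n x \<le> real n * survival n x"
    using n survival_nonneg by (rule mult_right_mono)
  also have "\<dots> \<le> l ^ loss * w R"
    using survival_le_mean_exit[of n x] mean_exit_upper[OF x] by linarith
  finally have "(l ^ loss * w R) * (l * survival n x) \<le> (l ^ loss * w R) * 1" by (simp add: mult_ac)
  then have "l * survival n x \<le> 1" using L by (simp only: mult_le_cancel_left_pos)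
  then show ?thesis using l_ge by (simp add: field_simps)
qed

lemma kernel_lower:
  assumes x: "x \<in> vball Rm" and n: "real n * l ^ (loss + 1) \<le> w R"
  shows "1 \<le> l ^ (4 * loss + 3) * v R * p (2 * n) x x"
proof -
  have "1 \<le> (l ^ (2 * loss + 1) * survival n x)\<^sup>2"
    using survival_lower[OF assms] by (simp add: one_le_power)
  also have "\<dots> = l ^ (4 * loss + 2) * (survival n x)\<^sup>2"
  proof -
    have "(2 * loss + 1) * 2 = 4 * loss + 2" by simp
    then show ?thesis by (simp only: power_mult_distrib power_mult[symmetric])
  qed
  also have "\<dots> \<le> l ^ (4 * loss + 2) * (p (2 * n) x x * vol R)"
    using on_diagonal_lower[of n x] l_ge unfolding vol_def by (intro mult_left_mono) auto
  also have "\<dots> \<le> l ^ (4 * loss + 2) * (p (2 * n) x x * (l * v R))"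
    using good_R l_ge p_nonneg by (intro mult_left_mono) (auto simp: good_def)
  also have "\<dots> = l ^ (4 * loss + 2 + 1) * v R * p (2 * n) x x" by (simp only: power_add power_one_right mult_ac)
  also have "4 * loss + 2 + 1 = 4 * loss + 3" by simp
  finally show ?thesis .
qed

text \<open>The heat kernel bound for the small ball, summed over the times up to \<open>n\<close>, bounds the expected number of visits
up to time \<open>n\<close> by \<open>r Rm\<close> times powers of \<open>l\<close>, which is much less than \<open>green x x\<close>. The sum of \<open>1 / i\<close> costs a
logarithm of \<open>n\<close>; this is why \<open>l\<close> has to be of at least logarithmic size here.\<close>

lemma early_exit:
  assumes x: "x \<in> vball Rm" and n: "real n * l ^ loss \<le> w R" "1 + ln (real n) \<le> l"
  shows "1 - survival n x \<le> 1 / l"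
proof (cases "n = 0")
  case True
  then show ?thesis using x Rm_in l_ge by (simp add: survival_0)
next
  case False
  have xB: "x \<in> vball R" using x Rm_in by auto
  have rm: "r Rm \<ge> 1" using r_mono[of 1 Rm] r_1 Rm_ge_1 by simp
  have vm: "v Rm > 0" using v_pos R_ge_1 by auto
  have rR: "r R > 0" using r_pos R_ge_1 by auto
  have nw: "real n \<le> w Rm"
  proof -
    have "w R \<le> K\<^sup>2 * s ^ (b + 1) * w Rm" unfolding R_eq by (rule w_upper[OF R_ge_1(3) s_ge_1])
    also have "\<dots> \<le> l ^ (loss - 2) * w Rm" using s_power w_pos[OF R_ge_1(3)] by (intro mult_right_mono) auto
    also have "\<dots> \<le> l ^ loss * w Rm" using l_ge w_pos[OF R_ge_1(3)] by (intro mult_right_mono power_increasing) auto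
    finally have "l ^ loss * real n \<le> l ^ loss * w Rm" using n by (simp add: mult_ac)
    moreover have "l ^ loss > 0" using l_ge by simp
    ultimately show ?thesis by (simp only: mult_le_cancel_left_pos)
  qed
  have p0: "p 0 x x \<le> 1" using mu_ge_1[OF xB] xB by simp
  have "(\<Sum>k<n. p k x x) \<le> (\<Sum>k<2 * n. p k x x)"
    using p_nonneg by (intro sum_mono2) auto
  also have "\<dots> = (\<Sum>i<n. p (2 * i) x x + p (Suc (2 * i)) x x)"
    by (induction n) (simp_all del: killed_kernel.simps)
  also have "\<dots> \<le> (\<Sum>i<n. 2 * p (2 * i) x x)"
    using p_odd_le[of _ x] by (intro sum_mono) (simp del: killed_kernel.simps)
  also have "\<dots> = 2 * p 0 x x + (\<Sum>i\<in>{1..<n}. 2 * p (2 * i) x x)"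
    using False by (simp add: lessThan_atLeast0 sum.atLeast_Suc_lessThan del: killed_kernel.simps)
  also have "\<dots> \<le> 2 + (\<Sum>i\<in>{1..<n}. 2 * (8 * l / v Rm + 64 * l * r Rm / real i))"
    using p0 kernel_upper[OF good_Rm l_ge(2) R_ge_1(3) x _ finite_B B_subset]
    by (intro add_mono sum_mono mult_left_mono) auto
  also have "\<dots> \<le> 2 + (\<Sum>i\<in>{1..n}. 2 * (8 * l / v Rm + 64 * l * r Rm / real i))"
    using l_ge vm rm by (intro add_left_mono sum_mono2) auto
  also have "\<dots> = 2 + real n * (16 * l / v Rm) + 128 * l * r Rm * (\<Sum>i=1..n. 1 / real i)"
    by (simp add: sum.distrib sum_distrib_left algebra_simps)
  also have "\<dots> \<le> 2 + w Rm * (16 * l / v Rm) + 128 * l * r Rm * l"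
    using nw sum_inverse_le_ln[of n] False n l_ge vm rm
    by (intro add_mono mult_left_mono mult_right_mono order_refl) auto
  also have "\<dots> = 2 + 16 * l * r Rm + 128 * l\<^sup>2 * r Rm"
    using vm by (simp add: w_def power2_eq_square)
  also have "\<dots> \<le> 2 * l\<^sup>2 * r Rm + 16 * l\<^sup>2 * r Rm + 128 * l\<^sup>2 * r Rm"
  proof -
    have l2: "l \<le> l\<^sup>2" "1 \<le> l\<^sup>2" using l_ge power_increasing[of 1 2 l] by auto
    then have "1 * 1 \<le> l\<^sup>2 * r Rm" using rm by (intro mult_mono) auto
    moreover have "l * r Rm \<le> l\<^sup>2 * r Rm" using l2 rm by (intro mult_right_mono) auto
    ultimately show ?thesis by linarith
  qed
  finally have S: "(\<Sum>k<n. p k x x) \<le> 146 * l\<^sup>2 * r Rm" by linarith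
  have one: "1 - survival n x \<ge> 0" using survival_le_1[of n x] by simp
  have "(1 - survival n x) * r R \<le> (1 - survival n x) * (8 * l * green x x)"
    using green_lower[OF x x] one by (rule mult_left_mono)
  also have "\<dots> \<le> 8 * l * (146 * l\<^sup>2 * r Rm)"
    using early_exit_le[of n x] S l_ge mult_left_mono[of "(1 - survival n x) * green x x" "146 * l\<^sup>2 * r Rm" "8 * l"]
    by (simp add: mult_ac)
  finally have 1: "l * ((1 - survival n x) * r R) \<le> l * (8 * l * (146 * l\<^sup>2 * r Rm))"
    using l_ge by (intro mult_left_mono) auto
  have "l * (8 * l * (146 * l\<^sup>2 * r Rm)) = (1168 * l\<^sup>2) * l\<^sup>2 * r Rm"
    by (simp add: power2_eq_square)
  also have "\<dots> \<le> r R"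
  proof (rule K_r_bound)
    have "(1168 * l\<^sup>2) * K \<le> l\<^sup>2 * l\<^sup>2"
      using l_powers K_ge_1 mult_left_mono[of "1168 * K" "l\<^sup>2" "l\<^sup>2"] by (simp add: mult_ac)
    then show "1168 * l\<^sup>2 * K \<le> l ^ 4" by (simp add: power_add[symmetric])
  qed simp
  finally have "(l * (1 - survival n x)) * r R \<le> 1 * r R" using 1 by simp
  then have "l * (1 - survival n x) \<le> 1" using rR by (simp only: mult_le_cancel_right_pos)
  then show ?thesis using l_ge by (simp add: field_simps)
qed

end

lemma (in killed_random_walk) kernel_le_heat_kernel:
  assumes "x \<in> G" "y \<in> B"
  shows "p n x y \<le> heat_kernel E X P n x y"
proof -
  interpret prob_space "P x" by (rule prob_space_P[OF assms(1)])
  have "p n x y * \<mu> y = measure (P x) {b \<in> space N. (\<forall>i\<le>n. X i b \<in> B) \<and> X n b = y}"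
    by (rule prob_killed_at[OF assms, symmetric])
  also have "\<dots> \<le> measure (P x) {b \<in> space N. X n b = y}"
    using X_eq_sets by (intro finite_measure_mono) (auto simp: sets_P assms(1))
  finally show ?thesis
    using mu_pos[OF assms(2)] by (simp add: heat_kernel_def space_P[OF assms(1)] field_simps)
qed

context graph_random_walk
begin

text \<open>The heat kernel is the limit of the kernels killed outside an exhausting sequence of finite sets.\<close>

lemma heat_kernel_le:
  assumes x: "x \<in> G" and y: "y \<in> G"
    and c: "\<And>S. finite S \<Longrightarrow> S \<subseteq> G \<Longrightarrow> killed_kernel E S n x y \<le> c"
  shows "heat_kernel E X P n x y \<le> c"
proof -
  interpret prob_space "P x" by (rule prob_space_P[OF x])
  define F where "F j = from_nat_into G ` {..j}" for j
  have range: "range (from_nat_into G) = G"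
    using x countable_G by (intro range_from_nat_into) auto
  have F: "finite (F j)" "F j \<subseteq> G" for j using range by (auto simp: F_def)
  have deg: "real (deg E y) > 0" using deg_pos[OF y] by simp
  have c0: "c \<ge> 0" using c[of "{}"] by (cases n) auto
  define ev where "ev j = {b \<in> space N. (\<forall>i\<le>n. X i b \<in> F j) \<and> X n b = y}" for j
  have ev_sets: "ev j \<in> sets (P x)" for j
    unfolding ev_def sets_P[OF x] by (rule event_sets[of n]) (simp add: determined_by_def)
  have le: "measure (P x) (ev j) \<le> c * deg E y" for j
  proof (cases "y \<in> F j")
    case True
    interpret killed_random_walk G E N X P "F j" using F by unfold_locales
    show ?thesis
      unfolding ev_def prob_killed_at[OF x True] using c[OF F] deg by (intro mult_right_mono) auto
  next
    case False
    then have "ev j = {}" by (auto simp: ev_def)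
    then show ?thesis using c0 by simp
  qed
  have "incseq ev" unfolding incseq_def ev_def F_def by (auto 4 4)
  moreover have "(\<Union>j. ev j) = {b \<in> space N. X n b = y}"
  proof
    show "{b \<in> space N. X n b = y} \<subseteq> (\<Union>j. ev j)"
    proof
      fix b assume b: "b \<in> {b \<in> space N. X n b = y}"
      have "\<exists>k. X i b = from_nat_into G k" for i using X_in[of b i] b range by (metis (mono_tags, lifting) mem_Collect_eq rangeE)
      then obtain k where k: "\<And>i. X i b = from_nat_into G (k i)" by metis
      have "X i b \<in> F (Max (k ` {..n}))" if "i \<le> n" for i
        unfolding F_def using that by (auto simp: k intro!: imageI)
      then show "b \<in> (\<Union>j. ev j)" using b by (auto simp: ev_def)
    qed
  qed (auto simp: ev_def)
  ultimately have "(\<lambda>j. measure (P x) (ev j)) \<longlonglongrightarrow> measure (P x) {b \<in> space N. X n b = y}"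
    using finite_Lim_measure_incseq[of ev] ev_sets by auto
  then have "measure (P x) {b \<in> space N. X n b = y} \<le> c * deg E y"
    by (rule LIMSEQ_le_const2) (use le in auto)
  then show ?thesis using deg by (simp add: heat_kernel_def space_P[OF x] field_simps)
qed

lemma range_volume_nonneg: "range_volume E X n b \<ge> 0"
  unfolding range_volume_def by (intro sum_nonneg) auto

text \<open>Markov's inequality for the volume of the part of \<open>A\<close> that has not been visited.\<close>

lemma prob_range_volume:
  assumes x: "x \<in> G" and A: "finite A" "A \<subseteq> G" and V: "(\<Sum>y\<in>A. real (deg E y)) > 0"
    and avoid: "\<And>y. y \<in> A \<Longrightarrow> measure (P x) {b \<in> space N. \<forall>i\<le>n. X i b \<noteq> y} \<le> \<epsilon>"
  shows "measure (P x) {b \<in> space N. 2 * range_volume E X n b < (\<Sum>y\<in>A. real (deg E y))} \<le> 2 * \<epsilon>"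
proof -
  interpret prob_space "P x" by (rule prob_space_P[OF x])
  define V where "V = (\<Sum>y\<in>A. real (deg E y))"
  define ev where "ev y = {b \<in> space N. \<forall>i\<le>n. X i b \<noteq> y}" for y
  have ev_sets: "ev y \<in> events" for y unfolding ev_def sets_P[OF x] by (rule avoid_sets)
  define u where "u b = (\<Sum>y\<in>A. real (deg E y) * indicator (ev y) b)" for b
  have int: "integrable (P x) u"
    unfolding u_def using ev_sets by (intro Bochner_Integration.integrable_sum integrable_mult_right integrable_real_indicator)
      (auto simp: emeasure_eq_measure)
  have "(\<integral>b. u b \<partial>P x) = (\<Sum>y\<in>A. real (deg E y) * measure (P x) (ev y))"
    unfolding u_def using ev_sets
    by (subst Bochner_Integration.integral_sum)
      (auto intro!: integrable_mult_right integrable_real_indicator simp: emeasure_eq_measure)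
  also have "\<dots> \<le> (\<Sum>y\<in>A. real (deg E y) * \<epsilon>)"
    using avoid by (intro sum_mono mult_left_mono) (auto simp: ev_def)
  also have "\<dots> = V * \<epsilon>" by (simp add: V_def sum_distrib_right)
  finally have exp: "(\<integral>b. u b \<partial>P x) \<le> V * \<epsilon>" .
  have "measure (P x) {b \<in> space N. 2 * range_volume E X n b < V} \<le> measure (P x) {b \<in> space (P x). u b \<ge> V / 2}"
  proof (rule finite_measure_mono)
    show "{b \<in> space (P x). u b \<ge> V / 2} \<in> events" using int by measurable
    show "{b \<in> space N. 2 * range_volume E X n b < V} \<subseteq> {b \<in> space (P x). u b \<ge> V / 2}"
    proof
      fix b assume b: "b \<in> {b \<in> space N. 2 * range_volume E X n b < V}"
      define W where "W = (\<lambda>k. X k b) ` {0..n}"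
      have "V = (\<Sum>y\<in>A \<inter> W. real (deg E y)) + (\<Sum>y\<in>A - W. real (deg E y))"
        unfolding V_def by (rule sum.Int_Diff[OF A(1)])
      moreover have "(\<Sum>y\<in>A \<inter> W. real (deg E y)) \<le> range_volume E X n b"
        unfolding range_volume_def W_def[symmetric] by (intro sum_mono2) (auto simp: W_def)
      moreover have "(\<Sum>y\<in>A - W. real (deg E y)) = u b"
        unfolding u_def using A b
        by (intro sum.mono_neutral_cong_left) (auto simp: ev_def W_def indicator_def)
      ultimately show "b \<in> {b \<in> space (P x). u b \<ge> V / 2}" using b by (auto simp: space_P x)
    qed
  qed
  also have "\<dots> \<le> (\<integral>b. u b \<partial>P x) / (V / 2)"
  proof (rule integral_Markov_inequality_measure[OF int sets.empty_sets])
    show "AE b in P x. 0 \<le> u b" unfolding u_def by (intro AE_I2 sum_nonneg) auto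
    show "0 < V / 2" using V by (simp add: V_def)
  qed
  also have "\<dots> \<le> V * \<epsilon> / (V / 2)" using exp V by (intro divide_right_mono) (auto simp: V_def)
  also have "\<dots> = 2 * \<epsilon>" using V by (simp add: V_def)
  finally show ?thesis by (simp add: V_def)
qed

lemma range_volume_sets: "{b \<in> space N. c * range_volume E X n b < t} \<in> sets N"
  unfolding range_volume_def
proof (rule event_sets[of n "\<lambda>u. c * (\<Sum>y\<in>(\<lambda>k. u k) ` {0..n}. real (deg E y)) < t"])
  show "determined_by n (\<lambda>u. c * (\<Sum>y\<in>(\<lambda>k. u k) ` {0..n}. real (deg E y)) < t)"
    unfolding determined_by_def
  proof (intro allI impI)
    fix u u' :: "nat \<Rightarrow> 'v" assume "\<forall>i\<le>n. u i = u' i"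
    then have "(\<lambda>k. u k) ` {0..n} = (\<lambda>k. u' k) ` {0..n}" by (intro image_cong) auto
    then show "(c * (\<Sum>y\<in>(\<lambda>k. u k) ` {0..n}. real (deg E y)) < t) = (c * (\<Sum>y\<in>(\<lambda>k. u' k) ` {0..n}. real (deg E y)) < t)"
      by simp
  qed
qed

end

section \<open>Environments that are good at all large scales\<close>

lemma dyadic_between:
  assumes "L \<ge> (1::real)" obtains m :: nat where "L \<le> 2 ^ m" "2 ^ m \<le> 2 * L"
proof -
  define m where "m = (LEAST m. L \<le> 2 ^ m)"
  have "\<exists>m. L \<le> 2 ^ m" using real_arch_pow[of 2 L] by (auto intro: less_imp_le)
  then have 1: "L \<le> 2 ^ m" unfolding m_def by (rule LeastI_ex)
  have "2 ^ m \<le> 2 * L"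
  proof (cases m)
    case (Suc k)
    then have "\<not> L \<le> 2 ^ k" unfolding m_def using not_less_Least[of k "\<lambda>m. L \<le> 2 ^ m"] by simp
    then show ?thesis using Suc by simp
  qed (use assms in simp)
  with 1 show ?thesis by (rule that)
qed

text \<open>The index \<open>i\<close> stands for the scale \<open>2 ^ i\<close>. The same error parameter \<open>lam i\<close> serves a whole range
  of neighbouring scales, which is wider than all the changes of scale that are made below because
  \<open>lam i\<close> grows more slowly than any power of the scale.\<close>

locale good_environment = scaled_graph G E z d v r K \<alpha> b q + graph_random_walk G E N X P
  for G :: "'v set" and E z d v r K \<alpha> b q and N :: "'b measure" and X P +
  fixes lam :: "nat \<Rightarrow> real"
  assumes good_ev: "\<forall>\<^sub>F i in sequentially. \<forall>j. i \<le> 2 * j \<and> j \<le> 2 * i \<longrightarrow> good (lam i) (2 ^ j)"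
    and lam_at_top: "filterlim lam at_top sequentially"
    and lam_slow: "\<forall>\<^sub>F i in sequentially. lam i ^ k \<le> 2 ^ i"
begin

lemma lam_ge: "\<forall>\<^sub>F i in sequentially. lam i \<ge> c"
  using lam_at_top by (simp add: filterlim_at_top)

text \<open>The ratio of radii is \<open>2 ^ m\<close>, of order \<open>lam i ^ q\<close>. As \<open>lam i\<close> is smaller than any power of \<open>2 ^ i\<close>, the
three radii remain in the range of scales to which \<open>lam i\<close> applies.\<close>

lemma at_scale_eventually:
  "\<forall>\<^sub>F i in sequentially. \<exists>m. 4 * m \<le> i \<and> (\<forall>j. i \<le> j \<and> 2 * j \<le> 3 * i \<longrightarrow>
     at_scale G E z d v r K \<alpha> b q N X P (lam i) (2 ^ (j - m)) (2 ^ j) (2 ^ (j + m)) (2 ^ m))"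
  using good_ev lam_ge[of "1200 * K"] lam_ge[of 16] lam_slow[of "4 * q + 1"]
proof eventually_elim
  case (elim i)
  have l1: "lam i ^ q \<ge> 1" using elim by (intro one_le_power) auto
  obtain m where m: "lam i ^ q \<le> 2 ^ m" "2 ^ m \<le> 2 * lam i ^ q"
    using dyadic_between[OF l1] by blast
  have "(2::real) ^ (4 * m) = (2 ^ m) ^ 4" by (simp add: power_mult[symmetric] mult.commute)
  also have "\<dots> \<le> (2 * lam i ^ q) ^ 4" using m by (intro power_mono) auto
  also have "\<dots> = 16 * lam i ^ (4 * q)" by (simp add: power_mult_distrib power_mult[symmetric] mult.commute)
  also have "\<dots> \<le> lam i * lam i ^ (4 * q)" using elim by (intro mult_right_mono) auto
  also have "\<dots> \<le> 2 ^ i" using elim by simp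
  finally have m4: "4 * m \<le> i" by simp
  have "at_scale G E z d v r K \<alpha> b q N X P (lam i) (2 ^ (j - m)) (2 ^ j) (2 ^ (j + m)) (2 ^ m)"
    if j: "i \<le> j" "2 * j \<le> 3 * i" for j
  proof unfold_locales
    have g: "i \<le> 2 * j' \<and> j' \<le> 2 * i \<Longrightarrow> good (lam i) (2 ^ j')" for j' using elim(1) by blast
    show "good (lam i) (2 ^ (j - m))" using j m4 by (intro g) auto
    show "good (lam i) (2 ^ j)" using j by (intro g) auto
    show "good (lam i) (2 ^ (j + m))" using j m4 by (intro g) auto
    show "(2::real) ^ j = 2 ^ m * 2 ^ (j - m)" using j m4 by (simp add: power_add[symmetric])
    show "(2::real) ^ (j + m) = 2 ^ m * 2 ^ j" by (simp add: power_add)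
  qed (use elim m in auto)
  with m4 show ?case by blast
qed

lemma vertex_eventually:
  "\<forall>\<^sub>F i in sequentially. \<forall>j m. 4 * m \<le> i \<and> i \<le> j \<longrightarrow> d z x < 2 ^ (j - m)"
proof -
  obtain k where k: "d z x < 2 ^ k" using real_arch_pow[of 2 "d z x"] by auto
  show ?thesis
    using eventually_ge_at_top[of "2 * k"]
  proof eventually_elim
    case (elim i)
    show ?case
    proof (intro allI impI)
      fix j m assume "4 * m \<le> i \<and> i \<le> j"
      then have "k \<le> j - m" using elim by linarith
      then have "(2::real) ^ k \<le> 2 ^ (j - m)" by (intro power_increasing) auto
      with k show "d z x < 2 ^ (j - m)" by linarith
    qed
  qed
qed

text \<open>The estimates for a single scale, brought together in terms of the walk itself instead of the killed kernels. They
hold for one and the same \<open>lam i\<close> at all scales \<open>j\<close> between \<open>i\<close> and \<open>3 / 2 * i\<close>, so that the scale can still be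
moved by powers of the error parameter.\<close>

lemma scale_estimates:
  assumes x: "x \<in> G"
  shows "\<forall>\<^sub>F i in sequentially. \<forall>j. i \<le> j \<and> 2 * j \<le> 3 * i \<longrightarrow> (let l = lam i; R = 2 ^ j in
     (\<exists>M. mean_exit_time G z d X P x R = ennreal M \<and> w R \<le> l ^ loss * M \<and> M \<le> l ^ loss * w R) \<and>
     (\<forall>n. real n * l ^ (loss + 1) \<le> w R \<longrightarrow>
        1 \<le> l ^ (4 * loss + 3) * v R * heat_kernel E X P (2 * n) x x) \<and>
     (\<forall>n\<ge>1. heat_kernel E X P (2 * n) x x \<le> 8 * l / v R + 64 * l * r R / real n) \<and>
     (\<forall>n. l ^ (loss + 1) * w R \<le> real n \<longrightarrow>
        measure (P x) {b \<in> space N. \<forall>i\<le>n. X i b \<in> vball R} \<le> 1 / l \<and>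
        measure (P x) {b \<in> space N. 2 * l ^ loss * range_volume E X n b < v R} \<le> 4 / l) \<and>
     (\<forall>n. real n * l ^ loss \<le> w R \<and> 1 + ln (real n) \<le> l \<longrightarrow>
        measure (P x) {b \<in> space N. \<forall>i\<le>n. X i b \<in> vball R} \<ge> 1 - 1 / l) \<and>
     (\<exists>n. measure (P x) {b \<in> space N. \<forall>i\<le>n. X (Suc i) b \<noteq> x} \<le> 2 / l))"
  using at_scale_eventually vertex_eventually[of x]
proof eventually_elim
  case (elim i)
  from elim(1) obtain m where m: "4 * m \<le> i" and
    sc: "\<And>j. i \<le> j \<and> 2 * j \<le> 3 * i \<Longrightarrow>
      at_scale G E z d v r K \<alpha> b q N X P (lam i) (2 ^ (j - m)) (2 ^ j) (2 ^ (j + m)) (2 ^ m)"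
    by blast
  show ?case
    unfolding Let_def
  proof (intro allI impI)
    fix j assume j: "i \<le> j \<and> 2 * j \<le> 3 * i"
    interpret at_scale G E z d v r K \<alpha> b q N X P "lam i" "2 ^ (j - m)" "2 ^ j" "2 ^ (j + m)" "2 ^ m"
      by (rule sc[OF j])
    let ?l = "lam i" and ?R = "2 ^ j :: real" and ?Rm = "2 ^ (j - m) :: real"
    have xm: "x \<in> vball ?Rm" using elim(2) m j x by (auto simp: vball_def)
    have xB: "x \<in> vball ?R" by (rule Rm_in[OF xm])
    have mean: "mean_exit_time G z d X P x ?R = ennreal (mean_exit x)"
      unfolding mean_exit_time_def exit_time_def gball_eq by (rule nn_integral_exit_time[OF x])
    have A: "\<exists>M. mean_exit_time G z d X P x ?R = ennreal M \<and> w ?R \<le> ?l ^ loss * M \<and> M \<le> ?l ^ loss * w ?R"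
      using mean mean_exit_lower[OF xm] mean_exit_upper[OF xB] by blast
    have B: "1 \<le> ?l ^ (4 * loss + 3) * v ?R * heat_kernel E X P (2 * n) x x"
      if "real n * ?l ^ (loss + 1) \<le> w ?R" for n
    proof -
      have "1 \<le> ?l ^ (4 * loss + 3) * v ?R * p (2 * n) x x" by (rule kernel_lower[OF xm that])
      also have "\<dots> \<le> ?l ^ (4 * loss + 3) * v ?R * heat_kernel E X P (2 * n) x x"
        using l_ge v_nonneg[OF R_ge_1(2)] by (intro mult_left_mono kernel_le_heat_kernel x xB) auto
      finally show ?thesis .
    qed
    have C: "heat_kernel E X P (2 * n) x x \<le> 8 * ?l / v ?R + 64 * ?l * r ?R / real n" if "n \<ge> 1" for n
      by (rule heat_kernel_le[OF x x]) (rule kernel_upper[OF good_R l_ge(2) R_ge_1(2) xB that])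
    have D: "measure (P x) {b \<in> space N. \<forall>i\<le>n. X i b \<in> vball ?R} \<le> 1 / ?l"
      if "?l ^ (loss + 1) * w ?R \<le> real n" for n
      using survival_upper[OF xB that] prob_survival[OF x] by simp
    have F: "measure (P x) {b \<in> space N. \<forall>i\<le>n. X i b \<in> vball ?R} \<ge> 1 - 1 / ?l"
      if "real n * ?l ^ loss \<le> w ?R" "1 + ln (real n) \<le> ?l" for n
      using early_exit[OF xm that] prob_survival[OF x, of n] by simp
    have range: "measure (P x) {b \<in> space N. 2 * ?l ^ loss * range_volume E X n b < v ?R} \<le> 4 / ?l"
      if n: "?l ^ (loss + 1) * w ?R \<le> real n" for n
    proof -
      interpret prob_space "P x" by (rule prob_space_P[OF x])
      have fin: "finite (vball ?Rm)" using good_Rm by (simp add: good_def)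
      have "measure (P x) {b \<in> space N. \<forall>i\<le>n. X i b \<noteq> y} \<le> 2 / ?l" if y: "y \<in> vball ?Rm" for y
        using prob_avoid_le[OF x Rm_in[OF y], of n] hit_inner[OF xm y] survival_upper[OF xB n] by simp
      then have "measure (P x) {b \<in> space N. 2 * range_volume E X n b < vol ?Rm} \<le> 2 * (2 / ?l)"
        unfolding vol_def using vol_pos[OF R_ge_1(3) fin]
        by (intro prob_range_volume[OF x fin vball_subset]) (auto simp: vol_def)
      moreover have "v ?R \<le> ?l ^ loss * vol ?Rm"
      proof -
        have "v ?R \<le> K * (2 ^ m) ^ b * v ?Rm"
          by (subst R_eq) (rule v_upper[OF R_ge_1(3) s_ge_1])
        also have "\<dots> \<le> ?l ^ (loss - 3) * (?l * vol ?Rm)"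
          using s_power' good_Rm v_nonneg[OF R_ge_1(3)] l_ge by (intro mult_mono) (auto simp: good_def)
        also have "\<dots> = ?l ^ (loss - 2) * vol ?Rm"
        proof -
          have "loss - 2 = Suc (loss - 3)" by (simp add: loss_def)
          then show ?thesis by (simp only: power_Suc mult_ac)
        qed
        also have "\<dots> \<le> ?l ^ loss * vol ?Rm"
          using vol_pos[OF R_ge_1(3) fin] l_ge by (intro mult_right_mono power_increasing) auto
        finally show ?thesis .
      qed
      have "{b \<in> space N. 2 * ?l ^ loss * range_volume E X n b < v ?R}
         \<subseteq> {b \<in> space N. 2 * range_volume E X n b < vol ?Rm}"
      proof
        fix b assume b: "b \<in> {b \<in> space N. 2 * ?l ^ loss * range_volume E X n b < v ?R}"
        then have "?l ^ loss * (2 * range_volume E X n b) < ?l ^ loss * vol ?Rm"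
          using \<open>v ?R \<le> ?l ^ loss * vol ?Rm\<close> by (simp add: mult_ac)
        then show "b \<in> {b \<in> space N. 2 * range_volume E X n b < vol ?Rm}"
          using b l_ge by (simp add: mult_less_cancel_left_pos)
      qed
      then have "measure (P x) {b \<in> space N. 2 * ?l ^ loss * range_volume E X n b < v ?R}
          \<le> measure (P x) {b \<in> space N. 2 * range_volume E X n b < vol ?Rm}"
        using range_volume_sets by (intro finite_measure_mono) (auto simp: sets_P x)
      ultimately show ?thesis by simp
    qed
    have "\<exists>n. ?l ^ (loss + 1) * w ?R \<le> real (Suc n)"
      using real_arch_simple[of "?l ^ (loss + 1) * w ?R"]
      by (metis le_SucI of_nat_le_iff order_trans order_refl)
    then obtain n where n: "?l ^ (loss + 1) * w ?R \<le> real (Suc n)" by blast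
    have "measure (P x) {b \<in> space N. \<forall>i\<le>n. X (Suc i) b \<noteq> x} \<le> 1 / (\<mu> x * green x x) + 1 / ?l"
      using prob_no_return_le[OF xB, of n] survival_upper[OF xB n] by linarith
    moreover have "?l \<le> \<mu> x * green x x"
    proof -
      have "1 \<le> r ?Rm" using r_mono[of 1 ?Rm] r_1 Rm_ge_1 by simp
      then have "8 * ?l\<^sup>2 * 1 \<le> 8 * ?l\<^sup>2 * r ?Rm" by (intro mult_left_mono) auto
      also have "\<dots> \<le> r ?R" using l_powers K_ge_1 by (intro K_r_bound) auto
      also have "\<dots> \<le> 8 * ?l * green x x" by (rule green_lower[OF xm xm])
      finally have "(8 * ?l) * ?l \<le> (8 * ?l) * green x x" by (simp add: power2_eq_square)
      then have "?l \<le> green x x" using l_ge by (simp only: mult_le_cancel_left_pos)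
      also have "\<dots> \<le> \<mu> x * green x x"
        using mult_right_mono[OF mu_ge_1[OF xB] green_nonneg[of x x]] by simp
      finally show ?thesis .
    qed
    then have "1 / (\<mu> x * green x x) \<le> 1 / ?l" using l_ge by (intro divide_left_mono) auto
    ultimately have H: "\<exists>n. measure (P x) {b \<in> space N. \<forall>i\<le>n. X (Suc i) b \<noteq> x} \<le> 2 / ?l"
      by (intro exI[of _ n]) simp
    from A B C D F range H show "(\<exists>M. mean_exit_time G z d X P x ?R = ennreal M \<and> w ?R \<le> ?l ^ loss * M \<and> M \<le> ?l ^ loss * w ?R) \<and>
     (\<forall>n. real n * ?l ^ (loss + 1) \<le> w ?R \<longrightarrow>
        1 \<le> ?l ^ (4 * loss + 3) * v ?R * heat_kernel E X P (2 * n) x x) \<and>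
     (\<forall>n\<ge>1. heat_kernel E X P (2 * n) x x \<le> 8 * ?l / v ?R + 64 * ?l * r ?R / real n) \<and>
     (\<forall>n. ?l ^ (loss + 1) * w ?R \<le> real n \<longrightarrow>
        measure (P x) {b \<in> space N. \<forall>i\<le>n. X i b \<in> vball ?R} \<le> 1 / ?l \<and>
        measure (P x) {b \<in> space N. 2 * ?l ^ loss * range_volume E X n b < v ?R} \<le> 4 / ?l) \<and>
     (\<forall>n. real n * ?l ^ loss \<le> w ?R \<and> 1 + ln (real n) \<le> ?l \<longrightarrow>
        measure (P x) {b \<in> space N. \<forall>i\<le>n. X i b \<in> vball ?R} \<ge> 1 - 1 / ?l) \<and>
     (\<exists>n. measure (P x) {b \<in> space N. \<forall>i\<le>n. X (Suc i) b \<noteq> x} \<le> 2 / ?l)" by blast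
  qed
qed

text \<open>The probability of no return is at most \<open>2 / lam i\<close> for all large \<open>i\<close>.\<close>

lemma recurrent: "recurrent_walk G X P"
  unfolding recurrent_walk_def
proof
  fix x assume x: "x \<in> G"
  interpret prob_space "P x" by (rule prob_space_P[OF x])
  define S where "S = {b \<in> space N. \<forall>n. X (Suc n) b \<noteq> x}"
  have fin_sets: "{b \<in> space N. \<forall>i\<le>n. X (Suc i) b \<noteq> x} \<in> events" for n
  proof -
    have "determined_by n (\<lambda>u. \<forall>i\<le>n. u i \<noteq> x)" by (simp add: determined_by_def)
    from shifted_event_sets[OF this, of 1] show ?thesis by (simp only: sets_P[OF x] Suc_eq_plus1)
  qed
  have S: "S \<in> events"
  proof -
    have "S = (\<Inter>n. {b \<in> space N. \<forall>i\<le>n. X (Suc i) b \<noteq> x})" by (auto simp: S_def)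
    also have "\<dots> \<in> events" by (rule sets.countable_INT) (use fin_sets in blast)+
    finally show ?thesis .
  qed
  have "\<forall>\<^sub>F i in sequentially. prob S \<le> 2 / lam i"
    using scale_estimates[OF x]
  proof eventually_elim
    case (elim i)
    have "i \<le> i \<and> 2 * i \<le> 3 * i" by simp
    from elim[rule_format, OF this]
    obtain n where "measure (P x) {b \<in> space N. \<forall>i\<le>n. X (Suc i) b \<noteq> x} \<le> 2 / lam i"
      unfolding Let_def by blast
    moreover have "prob S \<le> prob {b \<in> space N. \<forall>i\<le>n. X (Suc i) b \<noteq> x}"
      by (rule finite_measure_mono[OF _ fin_sets]) (unfold S_def, blast)
    ultimately show ?case by linarith
  qed
  moreover have "(\<lambda>i. 2 / lam i) \<longlonglongrightarrow> 0"
    using lam_at_top by (rule real_tendsto_divide_at_top[OF tendsto_const])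
  ultimately have "prob S \<le> 0"
    by (intro tendsto_lowerbound[of _ 0]) auto
  then have "prob S = 0" using measure_nonneg[of "P x" S] by simp
  then have "AE b in P x. b \<notin> S" using S prob_eq_0 by blast
  then show "AE b in P x. \<exists>n\<ge>1. X n b = x"
    using AE_space
  proof eventually_elim
    case (elim b)
    then obtain n where "X (Suc n) b = x" unfolding S_def space_P[OF x] by blast
    moreover have "1 \<le> Suc n" by simp
    ultimately show ?case by blast
  qed
qed

end

section \<open>From dyadic scales to all radii and times\<close>

lemma dyadic_index:
  assumes "(T::real) \<ge> 1" obtains i :: nat where "2 ^ i \<le> T" "T < 2 ^ Suc i"
proof -
  define m where "m = (LEAST m. T < 2 ^ m)"
  have "\<exists>m. T < 2 ^ m" by (rule real_arch_pow) simp
  then have 1: "T < 2 ^ m" unfolding m_def by (rule LeastI_ex)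
  then obtain i where i: "m = Suc i" using assms by (cases m) auto
  then have "\<not> T < 2 ^ i" unfolding m_def using not_less_Least[of i "\<lambda>m. T < 2 ^ m"] by simp
  then show ?thesis using 1 i that[of i] by simp
qed

lemma eventually_dyadic_index:
  assumes "eventually Q sequentially"
  shows "\<forall>\<^sub>F T in at_top. \<forall>i. (T::real) < 2 ^ Suc i \<longrightarrow> Q i"
proof -
  obtain i0 where i0: "\<And>i. i \<ge> i0 \<Longrightarrow> Q i" using assms by (auto simp: eventually_sequentially)
  show ?thesis
    using eventually_ge_at_top[of "2 ^ i0 :: real"]
  proof eventually_elim
    case (elim T)
    have "i \<ge> i0" if "T < 2 ^ Suc i" for i
    proof -
      have "(2::real) ^ i0 < 2 ^ Suc i" using elim that by linarith
      then have "i0 < Suc i" by (simp only: power_strict_increasing_iff one_less_numeral_iff semiring_norm)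
      then show ?thesis by simp
    qed
    then show ?case using i0 by blast
  qed
qed

context growth
begin

lemma eventually_radius_of_time:
  assumes "eventually Q at_top"
  shows "\<forall>\<^sub>F t in at_top. \<forall>T\<ge>1. w T = t \<longrightarrow> Q T"
proof -
  obtain T0 where T0: "\<And>T. T \<ge> T0 \<Longrightarrow> Q T" using assms by (auto simp: eventually_at_top_linorder)
  show ?thesis
    using eventually_gt_at_top[of "w (max 1 T0)"]
  proof eventually_elim
    case (elim t)
    have "T \<ge> T0" if "T \<ge> 1" "w T = t" for T
    proof (rule ccontr)
      assume "\<not> ?thesis"
      then have "w T \<le> w (max 1 T0)" using that by (intro w_mono) auto
      with elim that show False by simp
    qed
    then show ?case using T0 by blast
  qed
qed

lemma w_1: "w 1 = 1" by (simp add: w_def v_1 r_1)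

lemma radius_le_time: "T \<ge> 1 \<Longrightarrow> T \<le> K * w T"
  using w_lower[of 1 T] by (simp add: w_1)

lemma time_le_radius: "T \<ge> 1 \<Longrightarrow> w T \<le> K\<^sup>2 * T ^ (b + 1)"
  using w_upper[of 1 T] by (simp add: w_1)

lemma v_double: "R > 0 \<Longrightarrow> v (2 * R) \<le> K * 2 ^ b * v R"
  using v_upper[of R 2] by simp

lemma w_double: "R > 0 \<Longrightarrow> w (2 * R) \<le> K\<^sup>2 * 2 ^ (b + 1) * w R"
  using w_upper[of R 2] by simp

end

text \<open>The gauge \<open>\<phi>\<close> bounds the error parameter in terms of the radius or the time: a power of the
  logarithm or of the iterated logarithm.\<close>

locale gauged_environment = good_environment G E z d v r K \<alpha> b q N X P lam
  for G :: "'v set" and E z d v r K \<alpha> b q and N :: "'b measure" and X P lam +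
  fixes \<phi> :: "real \<Rightarrow> real"
  assumes gauge: "\<forall>\<^sub>F t in at_top. \<forall>i. 2 ^ i \<le> t\<^sup>2 \<longrightarrow> lam i \<le> \<phi> t"
    and gauge_slow: "\<forall>\<^sub>F t in at_top. \<phi> t ^ k \<le> t"
begin

lemma gauge_ge: "\<forall>\<^sub>F t in at_top. \<phi> t \<ge> c"
proof -
  obtain i where i: "lam i \<ge> c" using lam_ge[of c] by (auto simp: eventually_sequentially)
  show ?thesis
    using gauge eventually_ge_at_top[of "2 ^ i"] eventually_ge_at_top[of 1]
  proof eventually_elim
    case (elim t)
    have "(2::real) ^ i \<le> t * 1" using elim by simp
    also have "\<dots> \<le> t\<^sup>2" unfolding power2_eq_square using elim by (intro mult_left_mono) auto
    finally show ?case using elim(1) i by fastforce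
  qed
qed

text \<open>The radius that corresponds to the time \<open>t\<close> is at least a power of \<open>t\<close>, hence beats any power of the gauge.\<close>

lemma gauge_below_radius: "\<forall>\<^sub>F t in at_top. \<forall>T\<ge>1. w T = t \<longrightarrow> \<phi> t ^ k \<le> T"
  using gauge_slow[of "Suc (k * (b + 1))"] gauge_ge[of "K\<^sup>2"] gauge_ge[of 1]
proof eventually_elim
  case (elim t)
  show ?case
  proof (intro allI impI)
    fix T :: real assume T: "T \<ge> 1" "w T = t"
    have "K\<^sup>2 * (\<phi> t ^ k) ^ (b + 1) \<le> \<phi> t * (\<phi> t ^ k) ^ (b + 1)"
      using elim by (intro mult_right_mono) auto
    also have "\<dots> = \<phi> t ^ Suc (k * (b + 1))" by (simp only: power_Suc power_mult)
    also have "\<dots> \<le> K\<^sup>2 * T ^ (b + 1)" using elim T time_le_radius[OF T(1)] by linarith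
    finally have "(\<phi> t ^ k) ^ Suc b \<le> T ^ Suc b" using K_ge_1 by simp
    then show "\<phi> t ^ k \<le> T" by (rule power_le_imp_le_base) (use T in simp)
  qed
qed

text \<open>Moving up or down from the scale \<open>T\<close> of the time \<open>t\<close> by a factor \<open>\<phi> t ^ k\<close> stays within the
  range of scales whose error parameters are controlled.\<close>

lemma gauge_scales:
  "\<forall>\<^sub>F t in at_top. \<forall>T\<ge>1. w T = t \<longrightarrow> (\<forall>i M. 2 ^ i \<le> T \<and> T < 2 ^ Suc i \<and> 2 ^ M \<le> 2 * \<phi> t ^ k \<longrightarrow>
     4 * M + 4 \<le> i \<and> (\<forall>j\<le>i + 1 + M. lam j \<le> \<phi> t))"
  using gauge gauge_below_radius[of "4 * k + 1"] gauge_slow[of "Suc k"] gauge_ge[of 512]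
    gauge_ge[of "4 * K"] eventually_ge_at_top[of 1]
proof eventually_elim
  case (elim t)
  show ?case
  proof (intro allI impI)
    fix T i M assume T: "T \<ge> 1" "w T = t" and iM: "2 ^ i \<le> T \<and> T < 2 ^ Suc i \<and> 2 ^ M \<le> 2 * \<phi> t ^ k"
    have f0: "\<phi> t \<ge> 0" using elim by simp
    have fk: "\<phi> t ^ k \<ge> 0" using f0 by simp
    have "(2::real) ^ (4 * M + 5) = 32 * (2 ^ M) ^ 4" by (simp add: power_add power_mult[symmetric] mult.commute)
    also have "\<dots> \<le> 32 * (2 * \<phi> t ^ k) ^ 4" using iM by (intro mult_left_mono power_mono) auto
    also have "\<dots> = 512 * \<phi> t ^ (4 * k)" by (simp add: power_mult_distrib power_mult[symmetric] mult.commute)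
    also have "\<dots> \<le> \<phi> t * \<phi> t ^ (4 * k)" using elim f0 by (intro mult_right_mono) auto
    also have "\<dots> = \<phi> t ^ (4 * k + 1)" by simp
    also have "\<dots> \<le> T" using elim T by blast
    also have "\<dots> < 2 ^ Suc i" using iM by simp
    finally have "4 * M + 5 < Suc i" by (simp only: power_strict_increasing_iff one_less_numeral_iff semiring_norm)
    moreover have "lam j \<le> \<phi> t" if "j \<le> i + 1 + M" for j
    proof -
      have "(2::real) ^ j \<le> 2 ^ (i + 1 + M)" using that by (intro power_increasing) auto
      also have "\<dots> = 2 * 2 ^ i * 2 ^ M" by (simp add: power_add)
      also have "\<dots> \<le> 2 * T * (2 * \<phi> t ^ k)" using iM T by (intro mult_mono) auto
      also have "\<dots> \<le> 2 * (K * t) * (2 * \<phi> t ^ k)"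
        using radius_le_time[OF T(1)] T fk by (intro mult_right_mono) auto
      also have "\<dots> = (4 * K * \<phi> t ^ k) * t" by simp
      also have "\<dots> \<le> (\<phi> t * \<phi> t ^ k) * t" using elim fk by (intro mult_right_mono) auto
      also have "\<dots> \<le> t * t" using elim by (intro mult_right_mono) auto
      finally have "2 ^ j \<le> t\<^sup>2" by (simp add: power2_eq_square)
      then show ?thesis using elim(1) by blast
    qed
    ultimately show "4 * M + 4 \<le> i \<and> (\<forall>j\<le>i + 1 + M. lam j \<le> \<phi> t)" by auto
  qed
qed

lemma total_loss_ge:
  "loss + 4 \<le> total_loss" "4 * loss + 3 + (1 + (loss + 3) * b) \<le> total_loss" "loss + 2 + (loss + 4) * b \<le> total_loss"
  "2 \<le> total_loss" "(loss + 4) * b + 2 \<le> total_loss"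
  by (auto simp: total_loss_def algebra_simps)

text \<open>Moving up from \<open>T\<close> by a factor of about \<open>f ^ Suc k\<close> multiplies \<open>w\<close> by at least \<open>f ^ k\<close>, because \<open>w\<close> grows at
least linearly and the remaining factor \<open>f\<close> absorbs \<open>K\<close>. The price is a power of \<open>f\<close> in the volume.\<close>

lemma dyadic_up:
  assumes T: "T \<ge> 1" "2 ^ i \<le> T" "T < 2 ^ Suc i" and M: "f ^ Suc k \<le> 2 ^ M" "2 ^ M \<le> 2 * f ^ Suc k"
    and f: "f \<ge> K" "f \<ge> 4" "f \<ge> 1"
  shows "w T * f ^ k \<le> w (2 ^ (i + 1 + M))" "v (2 ^ (i + 1 + M)) \<le> f ^ (1 + (k + 2) * b) * v T"
    "2 ^ (i + 1 + M) \<le> f ^ (k + 2) * T"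
proof -
  have T0: "T > 0" "(2::real) ^ i > 0" using T by auto
  have s1: "(2::real) ^ Suc M \<ge> 1" by (rule one_le_power) simp
  have MM: "(2::real) ^ Suc M \<le> f ^ (k + 2)"
  proof -
    have "(2::real) ^ Suc M \<le> 4 * f ^ Suc k" using M by simp
    also have "\<dots> \<le> f * f ^ Suc k" using f by (intro mult_right_mono) auto
    finally show ?thesis by simp
  qed
  have e: "(2::real) ^ (i + 1 + M) = 2 ^ M * 2 ^ Suc i" "(2::real) ^ (i + 1 + M) = 2 ^ Suc M * 2 ^ i"
    by (simp_all add: power_add)
  have "K * (w T * f ^ k) \<le> f * (w T * f ^ k)"
    using f w_pos[OF T0(1)] by (intro mult_right_mono) auto
  also have "\<dots> = f ^ Suc k * w T" by simp
  also have "\<dots> \<le> 2 ^ M * w (2 ^ Suc i)"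
    using M f T T0 w_pos[OF T0(1)] by (intro mult_mono w_mono) auto
  also have "\<dots> \<le> K * w (2 ^ (i + 1 + M))" unfolding e(1) by (rule w_lower) auto
  finally show "w T * f ^ k \<le> w (2 ^ (i + 1 + M))" using K_ge_1 by simp
  have "v (2 ^ (i + 1 + M)) \<le> K * (2 ^ Suc M) ^ b * v (2 ^ i)"
    unfolding e(2) by (rule v_upper[OF _ s1]) simp
  also have "\<dots> \<le> f * (f ^ (k + 2)) ^ b * v T"
    using f T T0 MM K_ge_1 v_nonneg[OF T0(2)] by (intro mult_mono power_mono v_mono) auto
  also have "\<dots> = f ^ (1 + (k + 2) * b) * v T" by (simp only: power_add power_mult power_one_right)
  finally show "v (2 ^ (i + 1 + M)) \<le> f ^ (1 + (k + 2) * b) * v T" .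
  show "2 ^ (i + 1 + M) \<le> f ^ (k + 2) * T"
    unfolding e(2) using MM T f by (intro mult_mono) auto
qed

lemma dyadic_down:
  assumes T: "T \<ge> 1" "2 ^ i \<le> T" "T < 2 ^ Suc i" and M: "f ^ Suc k \<le> 2 ^ M" "2 ^ M \<le> 2 * f ^ Suc k" "M \<le> i"
    and f: "f \<ge> K" "f \<ge> 4" "f \<ge> 1"
  shows "w (2 ^ (i - M)) * f ^ k \<le> w T" "v T \<le> f ^ (1 + (k + 2) * b) * v (2 ^ (i - M))"
    "T \<le> f ^ (k + 2) * 2 ^ (i - M)"
proof -
  have T0: "T > 0" "(2::real) ^ (i - M) > 0" using T by auto
  have s1: "(2::real) ^ Suc M \<ge> 1" by (rule one_le_power) simp
  have MM: "(2::real) ^ Suc M \<le> f ^ (k + 2)"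
  proof -
    have "(2::real) ^ Suc M \<le> 4 * f ^ Suc k" using M by simp
    also have "\<dots> \<le> f * f ^ Suc k" using f by (intro mult_right_mono) auto
    finally show ?thesis by simp
  qed
  have e: "(2::real) ^ i = 2 ^ M * 2 ^ (i - M)" "(2::real) ^ Suc i = 2 ^ Suc M * 2 ^ (i - M)"
    using M(3) by (simp_all add: power_add[symmetric])
  have "K * (w (2 ^ (i - M)) * f ^ k) \<le> f * (w (2 ^ (i - M)) * f ^ k)"
    using f w_pos[OF T0(2)] by (intro mult_right_mono) auto
  also have "\<dots> = f ^ Suc k * w (2 ^ (i - M))" by simp
  also have "\<dots> \<le> 2 ^ M * w (2 ^ (i - M))" using M w_pos[OF T0(2)] by (intro mult_right_mono) auto
  also have "\<dots> \<le> K * w (2 ^ i)" unfolding e(1) by (rule w_lower) auto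
  also have "\<dots> \<le> K * w T" using K_ge_1 T by (intro mult_left_mono w_mono) auto
  finally show "w (2 ^ (i - M)) * f ^ k \<le> w T" using K_ge_1 by simp
  have "v T \<le> v (2 ^ Suc i)" using T by (intro v_mono) auto
  also have "\<dots> \<le> K * (2 ^ Suc M) ^ b * v (2 ^ (i - M))"
    unfolding e(2) by (rule v_upper[OF _ s1]) simp
  also have "\<dots> \<le> f * (f ^ (k + 2)) ^ b * v (2 ^ (i - M))"
    using f MM K_ge_1 v_nonneg[OF T0(2)] by (intro mult_right_mono mult_mono power_mono) auto
  also have "\<dots> = f ^ (1 + (k + 2) * b) * v (2 ^ (i - M))" by (simp only: power_add power_mult power_one_right)
  finally show "v T \<le> f ^ (1 + (k + 2) * b) * v (2 ^ (i - M))" .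
  have "T \<le> 2 ^ Suc M * 2 ^ (i - M)" using T(3) unfolding e(2) by simp
  also have "\<dots> \<le> f ^ (k + 2) * 2 ^ (i - M)" using MM by (intro mult_right_mono) auto
  finally show "T \<le> f ^ (k + 2) * 2 ^ (i - M)" .
qed

text \<open>The upper bound is read off at the scale of \<open>T\<close> itself. For the lower bound the scale is raised until the
mean exit time exceeds \<open>n\<close> by the required power of the error parameter.\<close>

lemma heat_kernel_bounds:
  assumes x: "x \<in> G"
  shows "\<forall>\<^sub>F n in sequentially. \<forall>T\<ge>1. w T = real n \<longrightarrow>
     1 \<le> \<phi> (real n) ^ total_loss * v T * heat_kernel E X P (2 * n) x x \<and>
     v T * heat_kernel E X P (2 * n) x x \<le> \<phi> (real n) ^ total_loss"
proof -
  let ?e = loss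
  define C where "C = 8 * K * 2 ^ b + 64 + 4 + K"
  have "\<forall>\<^sub>F t in at_top. \<forall>n T. real n = t \<and> T \<ge> 1 \<and> w T = t \<longrightarrow>
     1 \<le> \<phi> t ^ total_loss * v T * heat_kernel E X P (2 * n) x x \<and>
     v T * heat_kernel E X P (2 * n) x x \<le> \<phi> t ^ total_loss"
    using eventually_radius_of_time[OF eventually_dyadic_index[OF scale_estimates[OF x]]]
      eventually_radius_of_time[OF eventually_dyadic_index[OF lam_ge[of 1]]]
      gauge_scales[of "?e + 2"] gauge_ge[of C] eventually_ge_at_top[of 1]
  proof eventually_elim
    case (elim t)
    define f where "f = \<phi> t"
    show ?case
    proof (intro allI impI)
      fix n T assume nT: "real n = t \<and> T \<ge> 1 \<and> w T = t"
      then have T: "T \<ge> 1" "w T = t" by auto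
      have "C \<ge> K" "C \<ge> 4" "C \<ge> 1" unfolding C_def using K_ge_1 by (auto intro: add_nonneg_nonneg)
      then have f: "f \<ge> K" "f \<ge> 4" "f \<ge> 1" "f \<ge> C" using elim(4) by (auto simp: f_def)
      obtain i where i: "2 ^ i \<le> T" "T < 2 ^ Suc i" using dyadic_index[OF T(1)] .
      have "f ^ Suc (Suc ?e) \<ge> 1" using f by (intro one_le_power) auto
      then obtain M where M: "f ^ Suc (Suc ?e) \<le> 2 ^ M" "2 ^ M \<le> 2 * f ^ Suc (Suc ?e)"
        by (rule dyadic_between)
      have sc: "4 * M + 4 \<le> i" "lam i \<le> f"
        using elim(3) T i M unfolding f_def by auto
      have l1: "lam i \<ge> 1" using elim(2) T i by blast
      define H where "H = heat_kernel E X P (2 * n) x x"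
      have H0: "H \<ge> 0" unfolding H_def heat_kernel_def by simp
      have n1: "n \<ge> 1" using elim(5) nT by simp
      have vT: "v T > 0" and v2: "v (2 ^ i) > 0" using v_pos T by auto
      from elim(1) T i have est: "\<And>j. i \<le> j \<and> 2 * j \<le> 3 * i \<Longrightarrow>
          (\<forall>n. real n * lam i ^ (?e + 1) \<le> w (2 ^ j) \<longrightarrow>
            1 \<le> lam i ^ (4 * ?e + 3) * v (2 ^ j) * heat_kernel E X P (2 * n) x x) \<and>
          (\<forall>n\<ge>1. heat_kernel E X P (2 * n) x x \<le> 8 * lam i / v (2 ^ j) + 64 * lam i * r (2 ^ j) / real n)"
        unfolding Let_def by blast
      have up: "v T * H \<le> f ^ total_loss"
      proof -
        have "H \<le> 8 * lam i / v (2 ^ i) + 64 * lam i * r (2 ^ i) / t"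
          using est[of i] n1 nT unfolding H_def by auto
        then have "v T * H \<le> v T * (8 * lam i / v (2 ^ i) + 64 * lam i * r (2 ^ i) / t)"
          using vT by (intro mult_left_mono) auto
        also have "\<dots> = 8 * lam i * (v T / v (2 ^ i)) + 64 * lam i * (r (2 ^ i) * v T / t)"
          by (simp add: field_simps)
        also have "\<dots> \<le> 8 * f * (K * 2 ^ b) + 64 * f * 1"
        proof (intro add_mono mult_mono)
          have "v T \<le> v (2 * 2 ^ i)" using i T by (intro v_mono) auto
          then show "v T / v (2 ^ i) \<le> K * 2 ^ b" using v_double[of "2 ^ i"] v2 by (simp add: field_simps)
          have "r (2 ^ i) * v T \<le> r T * v T" using i vT by (intro mult_right_mono r_mono) auto
          also have "\<dots> = t" using T by (simp add: w_def mult.commute)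
          finally show "r (2 ^ i) * v T / t \<le> 1" using elim(5) by simp
        qed (use sc f l1 vT v2 r_nonneg elim(5) in auto)
        also have "\<dots> = (8 * K * 2 ^ b + 64) * f" by (simp add: algebra_simps)
        also have "\<dots> \<le> f * f" using f K_ge_1 by (intro mult_right_mono) (auto simp: C_def)
        also have "\<dots> = f ^ 2" by (simp add: power2_eq_square)
        also have "\<dots> \<le> f ^ total_loss" using f total_loss_ge(4) by (intro power_increasing) auto
        finally show ?thesis .
      qed
      have low: "1 \<le> f ^ total_loss * v T * H"
      proof -
        let ?j = "i + 1 + M"
        note U = dyadic_up[OF T(1) i M f(1-3)]
        have j: "i \<le> ?j \<and> 2 * ?j \<le> 3 * i" using sc by auto
        have "lam i ^ (?e + 1) \<le> f ^ Suc ?e"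
          unfolding Suc_eq_plus1 using sc l1 by (intro power_mono) auto
        then have "real n * lam i ^ (?e + 1) \<le> w T * f ^ Suc ?e"
          using nT T l1 by (intro mult_mono) (auto simp del: power_Suc)
        also have "\<dots> \<le> w (2 ^ ?j)" by (rule U(1))
        finally have "1 \<le> lam i ^ (4 * ?e + 3) * v (2 ^ ?j) * H" using est[OF j] unfolding H_def by blast
        also have "\<dots> \<le> f ^ (4 * ?e + 3) * (f ^ (1 + (Suc ?e + 2) * b) * v T) * H"
          using U(2) sc l1 f H0 v_nonneg[of "2 ^ ?j"] by (intro mult_right_mono mult_mono power_mono) auto
        also have "\<dots> = f ^ (4 * ?e + 3 + (1 + (Suc ?e + 2) * b)) * (v T * H)"
          by (simp only: power_add mult_ac)
        also have "\<dots> \<le> f ^ total_loss * (v T * H)"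
        proof (intro mult_right_mono power_increasing)
          show "4 * ?e + 3 + (1 + (Suc ?e + 2) * b) \<le> total_loss" using total_loss_ge(2) by (simp add: algebra_simps)
        qed (use f vT H0 in auto)
        finally show ?thesis by (simp add: mult_ac)
      qed
      from up low show "1 \<le> \<phi> t ^ total_loss * v T * heat_kernel E X P (2 * n) x x \<and>
        v T * heat_kernel E X P (2 * n) x x \<le> \<phi> t ^ total_loss" by (simp add: H_def f_def)
    qed
  qed
  from eventually_compose_filterlim[OF this filterlim_real_sequentially]
  show ?thesis by eventually_elim blast
qed

lemma exit_time_mono: "R \<le> R' \<Longrightarrow> exit_time G z d X R c \<le> exit_time G z d X R' c"
  unfolding exit_time_def gball_eq using vball_mono[of R R'] by (intro INF_superset_mono) auto

text \<open>Mean exit times increase with the radius, and \<open>R\<close> lies between two dyadic radii.\<close>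

lemma mean_exit_time_bounds:
  assumes x: "x \<in> G"
  shows "\<forall>\<^sub>F R in at_top. \<exists>M. mean_exit_time G z d X P x R = ennreal M \<and> M \<ge> 0 \<and>
     w R \<le> \<phi> R ^ total_loss * M \<and> M \<le> \<phi> R ^ total_loss * w R"
proof -
  let ?e = loss
  show ?thesis
    using eventually_dyadic_index[OF scale_estimates[OF x]] eventually_dyadic_index[OF lam_ge[of 1]]
      gauge gauge_ge[of "K\<^sup>2 * 2 ^ (b + 1)"] eventually_ge_at_top[of 4]
  proof eventually_elim
    case (elim R)
    define f where "f = \<phi> R"
    have R: "R \<ge> 1" "R > 0" using elim(5) by auto
    obtain i where i: "2 ^ i \<le> R" "R < 2 ^ Suc i" using dyadic_index[OF R(1)] .
    have "i \<ge> 2"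
    proof (rule ccontr)
      assume "\<not> i \<ge> 2"
      then have "(2::real) ^ Suc i \<le> 2 ^ 2" by (intro power_increasing) auto
      with i elim(5) show False by simp
    qed
    have "2 ^ i \<le> R * 1" using i by simp
    also have "\<dots> \<le> R\<^sup>2" unfolding power2_eq_square using R by (intro mult_left_mono) auto
    finally have lf: "lam i \<le> f" using elim(3) unfolding f_def by blast
    have l1: "lam i \<ge> 1" using elim(2) i by blast
    have f1: "f \<ge> 1" using lf l1 by simp
    have est: "\<exists>M. mean_exit_time G z d X P x (2 ^ j) = ennreal M
        \<and> w (2 ^ j) \<le> lam i ^ ?e * M \<and> M \<le> lam i ^ ?e * w (2 ^ j)"
      if "i \<le> j \<and> 2 * j \<le> 3 * i" for j
      using elim(1) i that unfolding Let_def by blast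
    obtain M where M: "mean_exit_time G z d X P x (2 ^ i) = ennreal M" "w (2 ^ i) \<le> lam i ^ ?e * M"
      using est[of i] by auto
    obtain M' where M': "mean_exit_time G z d X P x (2 ^ Suc i) = ennreal M'" "M' \<le> lam i ^ ?e * w (2 ^ Suc i)"
        "w (2 ^ Suc i) \<le> lam i ^ ?e * M'"
      using est[of "Suc i"] \<open>i \<ge> 2\<close> by auto
    have le0: "lam i ^ ?e > 0" using l1 by simp
    have Mp: "M > 0" "M' > 0"
    proof -
      have "0 < lam i ^ ?e * M" "0 < lam i ^ ?e * M'"
        using M(2) M'(3) w_pos[of "2 ^ i"] w_pos[of "2 ^ Suc i"] by (auto simp del: power_Suc intro: less_le_trans)
      then show "M > 0" "M' > 0" using le0 by (metis zero_less_mult_pos)+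
    qed
    define m where "m = mean_exit_time G z d X P x R"
    have m: "ennreal M \<le> m" "m \<le> ennreal M'"
      unfolding M(1)[symmetric] M'(1)[symmetric] m_def mean_exit_time_def
      using i by (intro nn_integral_mono exit_time_mono; simp)+
    then obtain M1 where M1: "m = ennreal M1" "M1 \<ge> 0"
      by (cases m) (auto simp: top_unique)
    have MM: "M \<le> M1" "M1 \<le> M'" using m Mp M1 by (auto simp: ennreal_le_iff)
    have ww: "w (2 ^ Suc i) \<le> K\<^sup>2 * 2 ^ (b + 1) * w (2 ^ i)" using w_double[of "2 ^ i"] by simp
    have fe: "lam i ^ ?e \<le> f ^ ?e" using lf l1 by (intro power_mono) auto
    have Kf: "K\<^sup>2 * 2 ^ (b + 1) \<le> f" using elim(4) by (simp add: f_def)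
    have pe: "f * f ^ ?e \<le> f ^ total_loss"
      unfolding power_Suc[symmetric] using f1 total_loss_ge(1) by (intro power_increasing) auto
    have w0: "w (2 ^ i) > 0" "w R > 0" using w_pos R by auto
    have "w R \<le> w (2 ^ Suc i)" using i R by (intro w_mono) auto
    also have "\<dots> \<le> K\<^sup>2 * 2 ^ (b + 1) * w (2 ^ i)" by (rule ww)
    also have "\<dots> \<le> f * (f ^ ?e * M1)"
    proof (rule mult_mono[OF Kf])
      have "lam i ^ ?e * M \<le> f ^ ?e * M1" using fe MM Mp f1 by (intro mult_mono) auto
      then show "w (2 ^ i) \<le> f ^ ?e * M1" using M(2) by linarith
    qed (use f1 w0 in auto)
    also have "\<dots> = (f * f ^ ?e) * M1" by simp
    also have "\<dots> \<le> f ^ total_loss * M1" using pe M1(2) by (rule mult_right_mono)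
    finally have low: "w R \<le> f ^ total_loss * M1" .
    have "M1 \<le> lam i ^ ?e * w (2 ^ Suc i)" using MM M' by linarith
    also have "\<dots> \<le> f ^ ?e * (f * w R)"
    proof (rule mult_mono[OF fe])
      have "w (2 ^ Suc i) \<le> f * w (2 ^ i)" using ww mult_right_mono[OF Kf, of "w (2 ^ i)"] w0 by linarith
      also have "\<dots> \<le> f * w R" using f1 i by (intro mult_left_mono w_mono) auto
      finally show "w (2 ^ Suc i) \<le> f * w R" .
    qed (use f1 w_pos[of "2 ^ Suc i"] in auto)
    also have "\<dots> = (f * f ^ ?e) * w R" by simp
    also have "\<dots> \<le> f ^ total_loss * w R" using pe w0 by (intro mult_right_mono) auto
    finally have "M1 \<le> f ^ total_loss * w R" .
    with low M1 show ?case unfolding m_def f_def by blast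
  qed
qed

end

lemma filterlim_half: "filterlim (\<lambda>i::nat. i div 2) sequentially sequentially"
  unfolding filterlim_at_top
proof
  fix Z :: nat
  show "\<forall>\<^sub>F i in sequentially. Z \<le> i div 2"
    using eventually_ge_at_top[of "2 * Z"] by eventually_elim simp
qed

section \<open>Almost sure estimates along the path\<close>

text \<open>If \<open>lam i \<ge> i\<^sup>2\<close>, then the exceptional probabilities, which are of order \<open>1 / lam i\<close>, are summable
  over the scales.\<close>

locale polynomial_environment = gauged_environment G E z d v r K \<alpha> b q N X P lam \<phi>
  for G :: "'v set" and E z d v r K \<alpha> b q and N :: "'b measure" and X P lam \<phi> +
  assumes lam_square: "\<forall>\<^sub>F i in sequentially. (real i)\<^sup>2 \<le> lam i"
begin

definition n_up :: "nat \<Rightarrow> nat" where "n_up i = nat \<lceil>lam i ^ (loss + 1) * w (2 ^ i)\<rceil>"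
definition n_down :: "nat \<Rightarrow> nat" where "n_down i = nat \<lfloor>w (2 ^ i) / lam i ^ loss\<rfloor>"

text \<open>The path leaves the ball of radius \<open>2 ^ i\<close> neither too late nor too early, and the set that it
  has visited by the later of the two times is large.\<close>

definition path_ok :: "nat \<Rightarrow> 'b \<Rightarrow> bool" where
  "path_ok i c \<longleftrightarrow> \<not> (\<forall>k\<le>n_up i. X k c \<in> vball (2 ^ i)) \<and> (\<forall>k\<le>n_down i. X k c \<in> vball (2 ^ i)) \<and>
     \<not> 2 * lam i ^ loss * range_volume E X (n_up i) c < v (2 ^ i)"

lemma path_ok_sets: "{c \<in> space N. path_ok i c} \<in> sets N"
  unfolding path_ok_def
  by (intro sets.sets_Collect_conj sets.sets_Collect_neg stay_sets range_volume_sets)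

lemma n_up_ge: "lam i ^ (loss + 1) * w (2 ^ i) \<le> real (n_up i)"
  unfolding n_up_def by linarith

lemma n_up_le:
  assumes "lam i \<ge> 1" shows "real (n_up i) \<le> 2 * (lam i ^ (loss + 1) * w (2 ^ i))"
proof -
  have "w 1 \<le> w (2 ^ i)" by (intro w_mono) auto
  then have "1 * 1 \<le> lam i ^ (loss + 1) * w (2 ^ i)"
    using assms by (intro mult_mono one_le_power) (auto simp: w_1)
  then show ?thesis unfolding n_up_def by linarith
qed

lemma n_down_le:
  assumes "lam i \<ge> 1" shows "real (n_down i) * lam i ^ loss \<le> w (2 ^ i)"
proof -
  have "w (2 ^ i) / lam i ^ loss \<ge> 0" using assms w_pos[of "2 ^ i"] by simp
  then have "real (n_down i) \<le> w (2 ^ i) / lam i ^ loss" unfolding n_down_def by linarith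
  then show ?thesis using assms by (simp add: field_simps)
qed

lemma n_down_ge:
  assumes "lam i \<ge> 1" shows "w (2 ^ i) / lam i ^ loss \<le> real (Suc (n_down i))"
  unfolding n_down_def by linarith

lemma ln_n_down: "\<forall>\<^sub>F i in sequentially. 1 + ln (real (n_down i)) \<le> lam i"
proof -
  have "\<forall>\<^sub>F i in sequentially. 1 + (ln (K\<^sup>2) + real i * real (b + 1) * ln 2) \<le> (real i)\<^sup>2"
    by real_asymp
  then show ?thesis
    using lam_square lam_ge[of 1]
  proof eventually_elim
    case (elim i)
    show ?case
    proof (cases "n_down i = 0")
      case False
      have "real (n_down i) * 1 \<le> real (n_down i) * lam i ^ loss"
        using elim by (intro mult_left_mono one_le_power) auto
      also have "\<dots> \<le> w (2 ^ i)" using elim by (intro n_down_le) auto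
      also have "\<dots> \<le> K\<^sup>2 * (2 ^ i) ^ (b + 1)" by (rule time_le_radius) simp
      finally have "ln (real (n_down i)) \<le> ln (K\<^sup>2 * (2 ^ i) ^ (b + 1))"
        using False K_ge_1 by (subst ln_le_cancel_iff) auto
      also have "\<dots> = ln (K\<^sup>2) + real i * real (b + 1) * ln 2"
        using K_ge_1 by (simp add: ln_mult ln_realpow power_mult[symmetric] algebra_simps del: power_Suc)
      finally show ?thesis using elim by linarith
    qed (use elim in simp)
  qed
qed

text \<open>Borel and Cantelli, the exceptional probability at scale \<open>i\<close> being at most \<open>6 / lam i\<close>.\<close>

lemma path_ok_AE:
  assumes x: "x \<in> G"
  shows "AE c in P x. \<forall>\<^sub>F i in sequentially. path_ok i c"
proof -
  interpret prob_space "P x" by (rule prob_space_P[OF x])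
  define A where "A i = {c \<in> space N. \<not> path_ok i c}" for i
  have A: "A i \<in> events" for i
    unfolding A_def sets_P[OF x] by (rule sets.sets_Collect_neg[OF path_ok_sets])
  have bound: "\<forall>\<^sub>F i in sequentially. prob (A i) \<le> 6 / (real i)\<^sup>2"
    using scale_estimates[OF x] ln_n_down lam_square lam_ge[of 1] eventually_ge_at_top[of 1]
  proof eventually_elim
    case (elim i)
    let ?S = "\<lambda>n. {c \<in> space N. \<forall>k\<le>n. X k c \<in> vball (2 ^ i)}"
    let ?V = "{c \<in> space N. 2 * lam i ^ loss * range_volume E X (n_up i) c < v (2 ^ i)}"
    have S: "?S n \<in> events" for n unfolding sets_P[OF x] by (rule stay_sets)
    have V: "?V \<in> events" unfolding sets_P[OF x] by (rule range_volume_sets)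
    have "space (P x) - ?S n \<in> events" for n by (rule sets.Diff[OF sets.top S])
    then have C: "space N - ?S n \<in> events" for n unfolding space_P[OF x] .
    have "i \<le> i \<and> 2 * i \<le> 3 * i" by simp
    note est = elim(1)[rule_format, OF this, unfolded Let_def]
    have 1: "prob (?S (n_up i)) \<le> 1 / lam i" "prob ?V \<le> 4 / lam i"
      using est n_up_ge[of i] by blast+
    have 2: "prob (?S (n_down i)) \<ge> 1 - 1 / lam i"
      using est n_down_le[OF elim(4)] elim(2) by blast
    have 3: "prob (space N - ?S (n_down i)) = 1 - prob (?S (n_down i))"
      using prob_compl[OF S] unfolding space_P[OF x] .
    have "A i \<subseteq> (?S (n_up i) \<union> ?V) \<union> (space N - ?S (n_down i))"
      unfolding A_def path_ok_def by blast
    then have "prob (A i) \<le> prob ((?S (n_up i) \<union> ?V) \<union> (space N - ?S (n_down i)))"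
      by (rule finite_measure_mono) (intro sets.Un S V C)
    also have "\<dots> \<le> prob (?S (n_up i) \<union> ?V) + prob (space N - ?S (n_down i))"
      by (intro measure_Un_le sets.Un S V C)
    also have "prob (?S (n_up i) \<union> ?V) \<le> prob (?S (n_up i)) + prob ?V"
      by (intro measure_Un_le S V)
    finally have "prob (A i) \<le> (prob (?S (n_up i)) + prob ?V) + prob (space N - ?S (n_down i))" by linarith
    also have "\<dots> \<le> (1 / lam i + 4 / lam i) + 1 / lam i" using 1 2 3 by linarith
    also have "\<dots> = 6 / lam i" by (simp add: add_divide_distrib[symmetric])
    also have "\<dots> \<le> 6 / (real i)\<^sup>2" using elim by (intro divide_left_mono) auto
    finally show ?case .
  qed
  have "summable (\<lambda>i. prob (A i))"
  proof (rule summable_comparison_test_ev)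
    show "\<forall>\<^sub>F i in sequentially. norm (prob (A i)) \<le> 6 * (1 / (real i)\<^sup>2)" using bound by simp
    show "summable (\<lambda>i. 6 * (1 / (real i)\<^sup>2))"
      using inverse_power_summable[of 2, where 'a=real] by (intro summable_mult) (simp add: inverse_eq_divide)
  qed
  then have "AE c in P x. \<forall>\<^sub>F i in sequentially. c \<in> space (P x) - A i"
    by (intro borel_cantelli_AE1 A) (auto simp: emeasure_eq_measure)
  then show ?thesis
  proof eventually_elim
    case (elim c)
    then show ?case by (rule eventually_mono) (unfold A_def space_P[OF x], blast)
  qed
qed

lemma exit_time_ge: "(\<forall>k\<le>n. X k c \<in> vball R) \<Longrightarrow> ennreal (real (Suc n)) \<le> exit_time G z d X R c"
  unfolding exit_time_def gball_eq
proof (rule INF_greatest)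
  fix m assume "\<forall>k\<le>n. X k c \<in> vball R" "m \<in> {m. X m c \<notin> vball R}"
  then have "Suc n \<le> m" by (metis mem_Collect_eq not_less_eq_eq)
  then show "ennreal (real (Suc n)) \<le> of_nat m"
    by (simp add: ennreal_of_nat_eq_real_of_nat ennreal_leI del: of_nat_Suc)
qed

lemma exit_time_le: "\<not> (\<forall>k\<le>n. X k c \<in> vball R) \<Longrightarrow> exit_time G z d X R c \<le> ennreal (real n)"
  using exit_time_le_iff[of "\<lambda>n. X n c" "vball R" n]
  unfolding exit_time_def gball_eq ennreal_of_nat_eq_real_of_nat by blast

text \<open>Exit times increase with the radius, so the bounds at two neighbouring dyadic radii give bounds in between.\<close>

lemma exit_time_bounds:
  "\<forall>\<^sub>F R in at_top. \<forall>c i. 2 ^ i \<le> R \<and> R < 2 ^ Suc i \<and> path_ok i c \<and> path_ok (Suc i) c \<longrightarrow>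
     ennreal (w R / \<phi> R ^ total_loss) \<le> exit_time G z d X R c \<and>
     exit_time G z d X R c \<le> ennreal (\<phi> R ^ total_loss * w R)"
  using eventually_dyadic_index[OF lam_ge[of 1]]
    eventually_dyadic_index[OF eventually_sequentially_Suc[THEN iffD2, OF lam_ge[of 1]]]
    gauge gauge_ge[of "2 * (K\<^sup>2 * 2 ^ (b + 1))"] eventually_ge_at_top[of 2]
proof eventually_elim
  case (elim R)
  show ?case
  proof (intro allI impI)
    fix c i assume i: "2 ^ i \<le> R \<and> R < 2 ^ Suc i \<and> path_ok i c \<and> path_ok (Suc i) c"
    define f where "f = \<phi> R"
    have R: "R \<ge> 1" "R > 0" using elim(5) by auto
    have l1: "lam i \<ge> 1" "lam (Suc i) \<ge> 1" using elim(1,2) i by blast+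
    have "2 ^ Suc i \<le> 2 * R" using i by simp
    also have "\<dots> \<le> R\<^sup>2" unfolding power2_eq_square using R elim(5) by (intro mult_right_mono) auto
    finally have "2 ^ Suc i \<le> R\<^sup>2" .
    moreover then have "2 ^ i \<le> R\<^sup>2" by (rule order_trans[rotated]) simp
    ultimately have lf: "lam (Suc i) \<le> f" "lam i \<le> f" using elim(3) unfolding f_def by blast+
    have f1: "f \<ge> 1" using lf l1 by simp
    have Kf: "2 * (K\<^sup>2 * 2 ^ (b + 1)) \<le> f" using elim(4) by (simp add: f_def)
    have w0: "w (2 ^ i) > 0" "w R > 0" "w (2 ^ Suc i) > 0" using w_pos R by auto
    have ww: "2 * w (2 ^ Suc i) \<le> f * w (2 ^ i)"
    proof -
      have "w (2 ^ Suc i) \<le> K\<^sup>2 * 2 ^ (b + 1) * w (2 ^ i)" using w_double[of "2 ^ i"] by simp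
      moreover have "2 * (K\<^sup>2 * 2 ^ (b + 1)) * w (2 ^ i) \<le> f * w (2 ^ i)"
        using Kf w0 by (intro mult_right_mono) auto
      ultimately show ?thesis by linarith
    qed
    have fe: "lam i ^ loss \<le> f ^ loss" "lam (Suc i) ^ (loss + 1) \<le> f ^ (loss + 1)"
      using lf l1 by (auto intro!: power_mono simp del: power_Suc)
    have pe: "f * f ^ loss \<le> f ^ total_loss" "f ^ (loss + 1) * f \<le> f ^ total_loss"
    proof -
      have "f ^ Suc loss \<le> f ^ total_loss" "f ^ Suc (loss + 1) \<le> f ^ total_loss"
        using f1 total_loss_ge(1) by (intro power_increasing; simp)+
      then show "f * f ^ loss \<le> f ^ total_loss" "f ^ (loss + 1) * f \<le> f ^ total_loss"
        by (simp_all only: power_Suc mult.commute)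
    qed
    have fp: "f ^ total_loss > 0" "f ^ loss > 0" "lam i ^ loss > 0" using f1 l1 by auto
    have "w R / f ^ total_loss \<le> w (2 ^ i) / lam i ^ loss"
    proof -
      have "w R * lam i ^ loss \<le> (f * w (2 ^ i)) * f ^ loss"
      proof (rule mult_mono[OF _ fe(1)])
        have "w R \<le> w (2 ^ Suc i)" using i R by (intro w_mono) auto
        then show "w R \<le> f * w (2 ^ i)" using ww w0 by linarith
      qed (use f1 w0 fp in auto)
      also have "\<dots> = (f * f ^ loss) * w (2 ^ i)" by simp
      also have "\<dots> \<le> f ^ total_loss * w (2 ^ i)" using pe w0 by (intro mult_right_mono) auto
      finally show ?thesis using fp by (simp add: field_simps)
    qed
    also have "\<dots> \<le> real (Suc (n_down i))" by (rule n_down_ge[OF l1(1)])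
    finally have "ennreal (w R / f ^ total_loss) \<le> ennreal (real (Suc (n_down i)))" by (rule ennreal_leI)
    also have "\<dots> \<le> exit_time G z d X (2 ^ i) c" using i by (intro exit_time_ge) (simp add: path_ok_def)
    also have "\<dots> \<le> exit_time G z d X R c" using i by (intro exit_time_mono) auto
    finally have low: "ennreal (w R / f ^ total_loss) \<le> exit_time G z d X R c" .
    have "exit_time G z d X R c \<le> exit_time G z d X (2 ^ Suc i) c" using i by (intro exit_time_mono) auto
    also have "\<dots> \<le> ennreal (real (n_up (Suc i)))" using i unfolding path_ok_def by (intro exit_time_le) blast
    also have "\<dots> \<le> ennreal (f ^ total_loss * w R)"
    proof (rule ennreal_leI)
      have "real (n_up (Suc i)) \<le> lam (Suc i) ^ (loss + 1) * (2 * w (2 ^ Suc i))"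
        using n_up_le[OF l1(2)] by simp
      also have "\<dots> \<le> f ^ (loss + 1) * (f * w R)"
      proof (rule mult_mono[OF fe(2)])
        have "f * w (2 ^ i) \<le> f * w R" using f1 i by (intro mult_left_mono w_mono) auto
        then show "2 * w (2 ^ Suc i) \<le> f * w R" using ww by linarith
      qed (use f1 w0 in auto)
      also have "\<dots> = (f ^ (loss + 1) * f) * w R" by simp
      also have "\<dots> \<le> f ^ total_loss * w R" using pe w0 by (intro mult_right_mono) auto
      finally show "real (n_up (Suc i)) \<le> f ^ total_loss * w R" .
    qed
    finally show "ennreal (w R / \<phi> R ^ total_loss) \<le> exit_time G z d X R c \<and>
       exit_time G z d X R c \<le> ennreal (\<phi> R ^ total_loss * w R)" using low by (simp add: f_def)
  qed
qed

lemma max_displacement_less_iff: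
  "R > 0 \<Longrightarrow> c \<in> space N \<Longrightarrow> max_displacement z d X n c < R \<longleftrightarrow> (\<forall>k\<le>n. X k c \<in> vball R)"
  unfolding max_displacement_def using X_in by (subst Max_less_iff) (auto simp: vball_def)

lemma range_volume_mono: "m \<le> n \<Longrightarrow> range_volume E X m c \<le> range_volume E X n c"
  unfolding range_volume_def by (intro sum_mono2) auto

text \<open>The displacement up to time \<open>n\<close> is less than \<open>R\<close> exactly if the exit time of the ball of radius \<open>R\<close> is
larger than \<open>n\<close>. The scale \<open>j1\<close> lies so far below the scale of \<open>T\<close> that its ball has been left at time \<open>n\<close>,
and \<open>j2\<close> so far above that its ball has not been left. The range up to time \<open>n\<close> then contains the range up to
the time \<open>n_up j1\<close> and is contained in the ball of scale \<open>j2\<close>.\<close>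

lemma displacement_and_range_bounds:
  "\<forall>\<^sub>F n in sequentially. \<forall>T\<ge>1. w T = real n \<longrightarrow> (\<exists>j1\<ge>m0. \<exists>j2\<ge>m0. \<forall>c\<in>space N. path_ok j1 c \<and> path_ok j2 c \<longrightarrow>
     T \<le> \<phi> (real n) ^ total_loss * max_displacement z d X n c \<and>
     max_displacement z d X n c \<le> \<phi> (real n) ^ total_loss * T \<and>
     v T \<le> \<phi> (real n) ^ total_loss * range_volume E X n c \<and>
     range_volume E X n c \<le> \<phi> (real n) ^ total_loss * v T)"
proof -
  let ?e = loss
  have "\<forall>\<^sub>F t in at_top. \<forall>n T. real n = t \<and> T \<ge> 1 \<and> w T = t \<longrightarrow> (\<exists>j1\<ge>m0. \<exists>j2\<ge>m0. \<forall>c\<in>space N. path_ok j1 c \<and> path_ok j2 c \<longrightarrow>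
     T \<le> \<phi> t ^ total_loss * max_displacement z d X n c \<and>
     max_displacement z d X n c \<le> \<phi> t ^ total_loss * T \<and>
     v T \<le> \<phi> t ^ total_loss * range_volume E X n c \<and>
     range_volume E X n c \<le> \<phi> t ^ total_loss * v T)"
    using eventually_radius_of_time[OF eventually_dyadic_index[OF good_ev]]
      eventually_radius_of_time[OF eventually_dyadic_index[OF eventually_ge_at_top[of "2 * m0"]]]
      eventually_radius_of_time[OF eventually_dyadic_index[OF
        eventually_compose_filterlim[OF eventually_all_ge_at_top[OF lam_ge[of 1]] filterlim_half]]]
      gauge_scales[of "?e + 3"] gauge_ge[of "4 + K"] eventually_ge_at_top[of 1]
  proof eventually_elim
    case (elim t)
    define f where "f = \<phi> t"
    show ?case
    proof (intro allI impI)
      fix n T assume nT: "real n = t \<and> T \<ge> 1 \<and> w T = t"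
      then have T: "T \<ge> 1" "w T = t" "T > 0" by auto
      have f: "f \<ge> K" "f \<ge> 4" "f \<ge> 1" using elim(5) K_ge_1 by (auto simp: f_def)
      obtain i where i: "2 ^ i \<le> T" "T < 2 ^ Suc i" using dyadic_index[OF T(1)] .
      have "f ^ Suc (?e + 2) \<ge> 1" using f by (intro one_le_power) auto
      then obtain M where M: "f ^ Suc (?e + 2) \<le> 2 ^ M" "2 ^ M \<le> 2 * f ^ Suc (?e + 2)"
        by (rule dyadic_between)
      have eq3: "Suc (?e + 2) = ?e + 3" by simp
      have sc: "4 * M + 4 \<le> i" "\<And>j. j \<le> i + 1 + M \<Longrightarrow> lam j \<le> f"
        using elim(4) T i M unfolding f_def eq3 by auto
      define j1 where "j1 = i - M"
      define j2 where "j2 = i + 1 + M"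
      have m0: "2 * m0 \<le> i" using elim(2) T i by blast
      have j: "j1 \<ge> m0" "j2 \<ge> m0" using m0 sc(1) by (auto simp: j1_def j2_def)
      have l1: "lam j1 \<ge> 1" "lam j2 \<ge> 1"
      proof -
        have "j1 \<ge> i div 2" "j2 \<ge> i div 2" using sc(1) by (auto simp: j1_def j2_def)
        then show "lam j1 \<ge> 1" "lam j2 \<ge> 1" using elim(3) T i by blast+
      qed
      have lf: "lam j1 \<le> f" "lam j2 \<le> f" using sc(2) by (auto simp: j1_def j2_def)
      have vT: "v T > 0" using v_pos T by auto
      note U = dyadic_up[OF T(1) i M f, folded j2_def]
      have Mi: "M \<le> i" using sc by auto
      note D = dyadic_down[OF T(1) i M Mi f, folded j1_def]
      have "\<forall>j. i \<le> 2 * j \<and> j \<le> 2 * i \<longrightarrow> good (lam i) (2 ^ j)" using elim(1) T i by blast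
      moreover have "i \<le> 2 * j2 \<and> j2 \<le> 2 * i" using sc(1) by (simp add: j2_def)
      ultimately have good2: "good (lam i) (2 ^ j2)" by blast
      have li: "lam i \<le> f" using sc(2) by auto
      \<comment> \<open>the ball of scale \<open>j1\<close> has been left at time \<open>n\<close>\<close>
      have up_time: "real (n_up j1) \<le> t"
      proof -
        have "real (n_up j1) \<le> 2 * (lam j1 ^ (?e + 1) * w (2 ^ j1))" by (rule n_up_le[OF l1(1)])
        also have "\<dots> \<le> f * (f ^ (?e + 1) * w (2 ^ j1))"
          using f lf l1 w_pos[of "2 ^ j1"] by (intro mult_mono power_mono) (auto simp del: power_Suc)
        also have "\<dots> = w (2 ^ j1) * f ^ (?e + 2)" by (simp add: mult_ac)
        also have "\<dots> \<le> t" using D(1) T by simp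
        finally show ?thesis .
      qed
      \<comment> \<open>the ball of scale \<open>j2\<close> has not been left at time \<open>n\<close>\<close>
      have down_time: "t < real (Suc (n_down j2))"
      proof -
        have "t * lam j2 ^ ?e < t * f ^ (?e + 2)"
        proof (rule mult_strict_left_mono)
          have "lam j2 ^ ?e \<le> f ^ ?e" using lf l1 by (intro power_mono) auto
          also have "\<dots> < f ^ (?e + 2)" using f by (intro power_strict_increasing) auto
          finally show "lam j2 ^ ?e < f ^ (?e + 2)" .
        qed (use elim(6) in simp)
        also have "\<dots> \<le> w (2 ^ j2)" using U(1) T by simp
        finally have "t < w (2 ^ j2) / lam j2 ^ ?e" using l1 by (simp add: field_simps)
        also have "\<dots> \<le> real (Suc (n_down j2))" by (rule n_down_ge[OF l1(2)])
        finally show ?thesis .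
      qed
      have fin: "f ^ (?e + 2 + 2) \<le> f ^ total_loss" "f ^ (1 + (?e + 4) * b + (?e + 1)) \<le> f ^ total_loss"
         "f ^ (1 + (1 + (?e + 4) * b)) \<le> f ^ total_loss"
        using f total_loss_ge by (intro power_increasing; simp)+
      have e4: "?e + 2 + 2 = ?e + 4" by simp
      have "T \<le> f ^ total_loss * max_displacement z d X n c \<and> max_displacement z d X n c \<le> f ^ total_loss * T \<and>
          v T \<le> f ^ total_loss * range_volume E X n c \<and> range_volume E X n c \<le> f ^ total_loss * v T"
        if c: "c \<in> space N" "path_ok j1 c" "path_ok j2 c" for c
      proof (intro conjI)
        have n1: "n_up j1 \<le> n" using up_time nT by simp
        have n2: "n \<le> n_down j2" using down_time nT by simp
        have stay: "\<forall>k\<le>n. X k c \<in> vball (2 ^ j2)" using c(3) n2 unfolding path_ok_def by auto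
        have Y2: "max_displacement z d X n c < 2 ^ j2" using stay c(1) by (subst max_displacement_less_iff) auto
        have leaves: "\<not> (\<forall>k\<le>n. X k c \<in> vball (2 ^ j1))" using c(2) n1 unfolding path_ok_def by (meson order_trans)
        have Y1: "2 ^ j1 \<le> max_displacement z d X n c"
        proof (rule ccontr)
          assume "\<not> ?thesis"
          then have "max_displacement z d X n c < 2 ^ j1" by simp
          then have "\<forall>k\<le>n. X k c \<in> vball (2 ^ j1)"
            by (subst (asm) max_displacement_less_iff[OF _ c(1)]) auto
          with leaves show False by blast
        qed
        have f4: "f ^ (?e + 2 + 2) * T \<le> f ^ total_loss * T" by (rule mult_right_mono[OF fin(1)]) (use T in simp)
        then show "max_displacement z d X n c \<le> f ^ total_loss * T" using Y2 U(3) by linarith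
        have "T \<le> f ^ (?e + 2 + 2) * 2 ^ j1" using D(3) by simp
        also have "\<dots> \<le> f ^ total_loss * max_displacement z d X n c"
          by (rule mult_mono[OF fin(1) Y1]) (use f in auto)
        finally show "T \<le> f ^ total_loss * max_displacement z d X n c" .
        have "range_volume E X n c \<le> vol (2 ^ j2)"
          unfolding range_volume_def vol_def using stay good2
          by (intro sum_mono2) (auto simp: good_def)
        also have "\<dots> \<le> lam i * v (2 ^ j2)" using good2 by (simp add: good_def)
        also have "\<dots> \<le> f * (f ^ (1 + (?e + 2 + 2) * b) * v T)"
          using li U(2) f v_nonneg[of "2 ^ j2"] by (intro mult_mono) auto
        also have "\<dots> = f ^ (1 + (1 + (?e + 4) * b)) * v T"
          by (simp only: e4 power_add power_one_right mult.assoc)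
        also have "\<dots> \<le> f ^ total_loss * v T" using fin(3) vT by (intro mult_right_mono) auto
        finally show "range_volume E X n c \<le> f ^ total_loss * v T" .
        have "v (2 ^ j1) \<le> 2 * lam j1 ^ ?e * range_volume E X (n_up j1) c"
          using c(2) unfolding path_ok_def by simp
        also have "\<dots> \<le> f * f ^ ?e * range_volume E X n c"
          using f lf l1 range_volume_nonneg n1
          by (intro mult_mono power_mono range_volume_mono) auto
        finally have 1: "v (2 ^ j1) \<le> f ^ (?e + 1) * range_volume E X n c" by simp
        have "v T \<le> f ^ (1 + (?e + 2 + 2) * b) * v (2 ^ j1)" by (rule D(2))
        also have "\<dots> \<le> f ^ (1 + (?e + 2 + 2) * b) * (f ^ (?e + 1) * range_volume E X n c)"
          using 1 f by (intro mult_left_mono) auto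
        also have "\<dots> = f ^ (1 + (?e + 4) * b + (?e + 1)) * range_volume E X n c"
          by (simp only: e4 power_add power_one_right mult.assoc)
        also have "\<dots> \<le> f ^ total_loss * range_volume E X n c"
          using fin(2) range_volume_nonneg by (rule mult_right_mono)
        finally show "v T \<le> f ^ total_loss * range_volume E X n c" .
      qed
      with j show "\<exists>j1\<ge>m0. \<exists>j2\<ge>m0. \<forall>c\<in>space N. path_ok j1 c \<and> path_ok j2 c \<longrightarrow>
         T \<le> \<phi> t ^ total_loss * max_displacement z d X n c \<and>
         max_displacement z d X n c \<le> \<phi> t ^ total_loss * T \<and>
         v T \<le> \<phi> t ^ total_loss * range_volume E X n c \<and>
         range_volume E X n c \<le> \<phi> t ^ total_loss * v T" unfolding f_def by blast
    qed
  qed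
  from eventually_compose_filterlim[OF this filterlim_real_sequentially]
  show ?thesis by eventually_elim blast
qed

end

section \<open>Growth functions with values in the extended half-line\<close>

context
  fixes f :: "ennreal \<Rightarrow> ennreal" and C a e :: real
  assumes gf: "growth_function f C a e"
begin

lemma gf_mono: "strict_mono f" and gf_cont: "continuous_on UNIV f"
  and gf_0: "f 0 = 0" and gf_1: "f 1 = 1" and gf_top: "f \<infinity> = \<infinity>"
  using gf by (auto simp: growth_function_def)

lemma gf_real: "f (ennreal R) = ennreal (enn2real (f (ennreal R)))"
proof -
  have "f (ennreal R) < f \<infinity>" using gf_mono by (rule strict_monoD) simp
  then have "f (ennreal R) < top" unfolding gf_top by simp
  then show ?thesis by simp
qed

lemma gf_strict: "0 \<le> R \<Longrightarrow> R < R' \<Longrightarrow> enn2real (f (ennreal R)) < enn2real (f (ennreal R'))"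
proof -
  assume R: "0 \<le> R" "R < R'"
  then have "f (ennreal R) < f (ennreal R')"
    by (intro strict_monoD[OF gf_mono] ennreal_lessI) auto
  then have "ennreal (enn2real (f (ennreal R))) < ennreal (enn2real (f (ennreal R')))"
    by (simp only: gf_real[symmetric])
  then show ?thesis by (simp only: ennreal_less_iff enn2real_nonneg)
qed

lemma gf_pos: "0 < R \<Longrightarrow> 0 < enn2real (f (ennreal R))"
  using gf_strict[of 0 R] by (simp add: gf_0)

lemma gf_bounds:
  assumes "0 < R'" "R' \<le> R"
  shows "inverse C * (R / R') powr a * enn2real (f (ennreal R')) \<le> enn2real (f (ennreal R))"
    and "enn2real (f (ennreal R)) \<le> C * (R / R') powr e * enn2real (f (ennreal R'))"
proof -
  let ?F = "\<lambda>R. enn2real (f (ennreal R))"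
  have pos: "?F R' > 0" "?F R > 0" using gf_pos assms by auto
  have "ennreal (?F R) / ennreal (?F R') = ennreal (?F R / ?F R')"
    using pos by (intro divide_ennreal) auto
  then have q: "f (ennreal R) / f (ennreal R') = ennreal (?F R / ?F R')"
    by (simp only: gf_real[symmetric])
  have "ennreal (inverse C * (R / R') powr a) \<le> ennreal (?F R / ?F R')"
    "ennreal (?F R / ?F R') \<le> ennreal (C * (R / R') powr e)"
    using gf assms unfolding growth_function_def q[symmetric] by blast+
  then have "inverse C * (R / R') powr a \<le> ?F R / ?F R'" "?F R / ?F R' \<le> C * (R / R') powr e"
  proof -
    assume 1: "ennreal (inverse C * (R / R') powr a) \<le> ennreal (?F R / ?F R')"
      and 2: "ennreal (?F R / ?F R') \<le> ennreal (C * (R / R') powr e)"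
    show "inverse C * (R / R') powr a \<le> ?F R / ?F R'"
      using 1 pos by (subst (asm) ennreal_le_iff) auto
    show "?F R / ?F R' \<le> C * (R / R') powr e"
      using 2 pos by (metis divide_pos_pos ennreal_le_iff2 not_le)
  qed
  then show "inverse C * (R / R') powr a * ?F R' \<le> ?F R" "?F R \<le> C * (R / R') powr e * ?F R'"
    using pos by (simp_all add: field_simps)
qed

lemma gf_continuous: "continuous_on A (\<lambda>R. enn2real (f (ennreal R)))"
proof -
  have "isCont (\<lambda>R. enn2real (f (ennreal R))) R" for R
  proof -
    have "(f \<longlongrightarrow> f (ennreal R)) (nhds (ennreal R))"
      using gf_cont by (simp add: continuous_on_eq_continuous_at isCont_def tendsto_at_iff_tendsto_nhds)
    moreover have "(ennreal \<longlongrightarrow> ennreal R) (at R)" by (intro tendsto_ennrealI tendsto_ident_at)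
    ultimately have "((\<lambda>R. f (ennreal R)) \<longlongrightarrow> f (ennreal R)) (at R)" by (rule filterlim_compose)
    then have "((\<lambda>R. f (ennreal R)) \<longlongrightarrow> ennreal (enn2real (f (ennreal R)))) (at R)"
      by (simp only: gf_real[symmetric])
    then show ?thesis unfolding isCont_def by (rule tendsto_enn2real) simp
  qed
  then show ?thesis by (simp add: continuous_at_imp_continuous_on)
qed

end

locale growth_pair =
  fixes v r :: "ennreal \<Rightarrow> ennreal" and C1 C2 d1 d2 \<alpha>1 \<alpha>2 :: real
  assumes C: "C1 \<ge> 1" "C2 \<ge> 1" and dd: "1 \<le> d1" "d1 \<le> d2" and aa: "0 < \<alpha>1" "\<alpha>1 \<le> \<alpha>2" "\<alpha>2 \<le> 1"
    and gv: "growth_function v C1 d1 d2" and gr: "growth_function r C2 \<alpha>1 \<alpha>2"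
begin

text \<open>Finite radii have finite values of \<open>v\<close> and \<open>r\<close>, so from here on both are functions of real numbers.\<close>

definition v_real :: "real \<Rightarrow> real" where "v_real R = enn2real (v (ennreal R))"
definition r_real :: "real \<Rightarrow> real" where "r_real R = enn2real (r (ennreal R))"
definition growth_const :: real where "growth_const = max C1 C2"
definition volume_exponent :: nat where "volume_exponent = nat \<lceil>d2\<rceil>"
definition gap_exponent :: nat where "gap_exponent = nat \<lceil>6 / \<alpha>1\<rceil>"

lemma v_eq: "v (ennreal R) = ennreal (v_real R)" and r_eq: "r (ennreal R) = ennreal (r_real R)"
  unfolding v_real_def r_real_def using gf_real[OF gv] gf_real[OF gr] by auto

end

sublocale growth_pair \<subseteq> growth v_real r_real growth_const \<alpha>1 volume_exponent gap_exponent
proof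
  have K: "C1 \<le> growth_const" "C2 \<le> growth_const" "growth_const \<ge> 1" using C by (auto simp: growth_const_def)
  show "growth_const \<ge> 1" by (rule K)
  show "\<alpha>1 > 0" "\<alpha>1 \<le> 1" using aa by auto
  show "6 \<le> \<alpha>1 * real gap_exponent"
  proof -
    have "6 / \<alpha>1 \<le> real gap_exponent" unfolding gap_exponent_def by linarith
    then show ?thesis using aa by (simp add: field_simps)
  qed
  show "0 < R \<Longrightarrow> 0 < v_real R" "0 < R \<Longrightarrow> 0 < r_real R" for R
    unfolding v_real_def r_real_def using gf_pos[OF gv] gf_pos[OF gr] by auto
  show "v_real 1 = 1" "r_real 1 = 1" "r_real 0 = 0"
    using gf_1[OF gv] gf_1[OF gr] gf_0[OF gr] by (simp_all add: v_real_def r_real_def)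
  show "0 \<le> R \<Longrightarrow> R \<le> R' \<Longrightarrow> v_real R \<le> v_real R'" "0 \<le> R \<Longrightarrow> R \<le> R' \<Longrightarrow> r_real R \<le> r_real R'" for R R'
    unfolding v_real_def r_real_def using gf_strict[OF gv, of R R'] gf_strict[OF gr, of R R']
    by (cases "R = R'"; auto)+
  fix R s :: real assume R: "0 < R" and s: "s \<ge> 1"
  have sR: "R \<le> s * R" "s * R / R = s" using R s by (auto simp: mult_le_cancel_right1)
  note V = gf_bounds[OF gv R sR(1), unfolded sR(2), folded v_real_def]
  note RR = gf_bounds[OF gr R sR(1), unfolded sR(2), folded r_real_def]
  have pos: "v_real R > 0" "r_real R > 0" "v_real (s * R) > 0" "r_real (s * R) > 0"
    unfolding v_real_def r_real_def using gf_pos[OF gv] gf_pos[OF gr] R s by auto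
  have "s powr 1 \<le> s powr d1" using s dd by (intro powr_mono) auto
  then have "s * v_real R \<le> s powr d1 * v_real R" using s pos by (intro mult_right_mono) auto
  also have "\<dots> \<le> C1 * v_real (s * R)" using V(1) C by (simp add: field_simps)
  also have "\<dots> \<le> growth_const * v_real (s * R)" using K pos by (intro mult_right_mono) auto
  finally show "s * v_real R \<le> growth_const * v_real (s * R)" .
  have "s powr d2 \<le> s powr (real volume_exponent)" using s unfolding volume_exponent_def by (intro powr_mono) linarith+
  then have "s powr d2 \<le> s ^ volume_exponent" using s by (simp add: powr_realpow)
  then have "C1 * s powr d2 * v_real R \<le> growth_const * s ^ volume_exponent * v_real R"
    using K C s pos by (intro mult_right_mono mult_mono) auto
  then show "v_real (s * R) \<le> growth_const * s ^ volume_exponent * v_real R" using V(2) by linarith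
  have "s powr \<alpha>1 * r_real R \<le> C2 * r_real (s * R)" using RR(1) C by (simp add: field_simps)
  also have "\<dots> \<le> growth_const * r_real (s * R)" using K pos by (intro mult_right_mono) auto
  finally show "s powr \<alpha>1 * r_real R \<le> growth_const * r_real (s * R)" .
  have "s powr \<alpha>2 \<le> s powr 1" using s aa by (intro powr_mono) auto
  then have "C2 * s powr \<alpha>2 * r_real R \<le> growth_const * s * r_real R"
    using K C s pos by (intro mult_right_mono mult_mono) auto
  then show "r_real (s * R) \<le> growth_const * s * r_real R" using RR(2) by linarith
qed

context growth_pair
begin

lemma w_strict: "0 \<le> R \<Longrightarrow> R < R' \<Longrightarrow> w R < w R'"
  unfolding w_def v_real_def r_real_def
  using gf_strict[OF gv, of R R'] gf_strict[OF gr, of R R'] by (intro mult_strict_mono') auto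

lemma product_eq: "v (ennreal R) * r (ennreal R) = ennreal (w R)"
  unfolding v_eq r_eq w_def by (simp add: ennreal_mult v_real_def r_real_def)

text \<open>Needed for \<open>inv\<close> in the definition of \<open>time_inverse\<close>. On finite radii the product is strictly increasing, and it is
infinite only at \<open>\<infinity>\<close>.\<close>

lemma inj_product: "inj (\<lambda>R. v R * r R)"
proof -
  have less: "v x * r x \<noteq> v y * r y" if xy: "x < y" for x y
  proof -
    from xy obtain X where X: "x = ennreal X" "X \<ge> 0" by (cases x) auto
    show ?thesis
    proof (cases y)
      case (real Y)
      then have "w X < w Y" using X xy by (intro w_strict) (auto simp: ennreal_less_iff)
      then show ?thesis
        using X real w_strict[of 0 Y] by (auto simp: product_eq ennreal_eq_0_iff w_def v_real_def r_real_def)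
    next
      case top
      then show ?thesis
        using X gf_top[OF gv] gf_top[OF gr] by (simp add: product_eq)
    qed
  qed
  show ?thesis by (rule linorder_injI) (use less in auto)
qed

text \<open>\<open>T\<close> is the radius at which \<open>t\<close> is the typical exit time. It exists by the intermediate value theorem, as \<open>w 1 = 1\<close>
and \<open>w\<close> grows at least linearly.\<close>

lemma time_inverse_eq:
  assumes t: "t \<ge> 1"
  obtains T where "T \<ge> 1" "w T = t" "time_inverse v r (ennreal t) = ennreal T"
proof -
  have w_eq: "w = (\<lambda>R. v_real R * r_real R)" by (simp add: fun_eq_iff w_def)
  have "\<exists>T. 1 \<le> T \<and> T \<le> growth_const * t \<and> w T = t"
  proof (rule IVT')
    show "w 1 \<le> t" using t by (simp add: w_1)
    have Kt: "1 \<le> growth_const * t" using mult_mono[of 1 growth_const 1 t] K_ge_1 t by simp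
    then show "1 \<le> growth_const * t" .
    show "t \<le> w (growth_const * t)" using radius_le_time[OF Kt] K_ge_1 by simp
    show "continuous_on {1..growth_const * t} w"
      unfolding w_eq v_real_def r_real_def
      by (intro continuous_on_mult gf_continuous[OF gv] gf_continuous[OF gr])
  qed
  then obtain T where T: "1 \<le> T" "w T = t" by blast
  have "time_inverse v r (ennreal t) = ennreal T"
    unfolding time_inverse_def by (rule inv_f_eq[OF inj_product]) (simp add: product_eq T)
  with T show ?thesis by (rule that)
qed

end

lemma (in scaled_graph) good_radii_imp_good:
  fixes V R' :: "ennreal \<Rightarrow> ennreal"
  assumes V: "\<And>R. V (ennreal R) = ennreal (v R)" and R': "\<And>R. R' (ennreal R) = ennreal (r R)"
    and l: "l > 1" and R: "R \<ge> 1" and g: "ennreal R \<in> good_radii G E z d V R' l"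
  shows "good l R"
proof -
  have R0: "R > 0" using R by simp
  have vR: "v R > 0" by (rule v_pos[OF R0])
  have vol: "ennreal (inverse l) * ennreal (v R) \<le> volume G E z d (ennreal R)"
    "volume G E z d (ennreal R) \<le> ennreal l * ennreal (v R)"
    and res: "ennreal (inverse l) * ennreal (r R) \<le> R_eff E {z} (G - vball R)"
    and pt: "\<And>y. y \<in> vball R \<Longrightarrow> R_eff_pt E z y \<le> ennreal l * ennreal (r (d z y))"
    using g unfolding good_radii_def mem_Collect_eq gball_eq V R' by blast+
  have "ennreal l * ennreal (v R) = ennreal (l * v R)" using l vR by (simp add: ennreal_mult)
  then have fin': "volume G E z d (ennreal R) < \<infinity>" using vol(2) by (simp add: le_less_trans)
  note fin = finite_of_volume[OF fin']
  have vol0: "vol R \<ge> 0" unfolding vol_def by (intro sum_nonneg) auto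
  have "ennreal (inverse l * v R) \<le> ennreal (vol R)" "ennreal (vol R) \<le> ennreal (l * v R)"
    using vol l vR unfolding fin(2) by (simp_all add: ennreal_mult)
  then have "inverse l * v R \<le> vol R" "vol R \<le> l * v R"
    using vol0 l vR by (simp_all add: ennreal_le_iff)
  then have "v R \<le> l * vol R" "vol R \<le> l * v R" using l by (simp_all add: field_simps)
  moreover have "\<exists>u. supported (vball R) u \<and> u z = 1 \<and> r R * dform E u \<le> 2 * l"
    using l res by (intro resistance_test_function[OF R0 fin(1)]) auto
  moreover have "(f z - f y)\<^sup>2 \<le> l * r (d z y) * dform E f"
    if "y \<in> vball R" "finite S \<and> S \<subseteq> G \<and> supported S f" for y S f
    using that l pt[OF that(1)] vball_subset by (intro resistance_oscillation[where S=S]) auto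
  ultimately show ?thesis using fin(1) unfolding good_def by blast
qed

section \<open>Random environments\<close>

lemma Borel_Cantelli_events:
  assumes "prob_space M" and A: "\<And>j. {\<omega> \<in> space M. Q j \<omega>} \<in> sets M"
    and bound: "\<And>j. measure M {\<omega> \<in> space M. Q j \<omega>} \<ge> 1 - e j" and e: "summable e"
  shows "{\<omega> \<in> space M. \<forall>\<^sub>F j in sequentially. Q j \<omega>} \<in> sets M"
    and "measure M {\<omega> \<in> space M. \<forall>\<^sub>F j in sequentially. Q j \<omega>} = 1"
proof -
  interpret prob_space M by fact
  show S: "{\<omega> \<in> space M. \<forall>\<^sub>F j in sequentially. Q j \<omega>} \<in> sets M"
    by (rule sets_Collect_eventually_sequentially) (rule A)
  define B where "B j = space M - {\<omega> \<in> space M. Q j \<omega>}" for j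
  have B: "B j \<in> sets M" for j unfolding B_def by (intro sets.Diff sets.top A)
  have "prob (B j) = 1 - prob {\<omega> \<in> space M. Q j \<omega>}" for j unfolding B_def by (rule prob_compl[OF A])
  then have le: "prob (B j) \<le> e j" for j using bound[of j] by simp
  have "summable (\<lambda>j. prob (B j))"
    by (rule summable_comparison_test'[OF e, of 0]) (simp add: le)
  then have "AE \<omega> in M. \<forall>\<^sub>F j in sequentially. \<omega> \<in> space M - B j"
    by (intro borel_cantelli_AE1 B) (auto simp: emeasure_eq_measure)
  then have "AE \<omega> in M. \<omega> \<in> {\<omega> \<in> space M. \<forall>\<^sub>F j in sequentially. Q j \<omega>}"
  proof (rule AE_mp, intro AE_I2 impI)
    fix \<omega> assume "\<omega> \<in> space M" "\<forall>\<^sub>F j in sequentially. \<omega> \<in> space M - B j"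
    then show "\<omega> \<in> {\<omega> \<in> space M. \<forall>\<^sub>F j in sequentially. Q j \<omega>}"
      unfolding B_def by (auto elim!: eventually_mono)
  qed
  then show "measure M {\<omega> \<in> space M. \<forall>\<^sub>F j in sequentially. Q j \<omega>} = 1"
    by (subst prob_eq_1[OF S])
qed

text \<open>\<open>L j\<close> is the error parameter at the scale \<open>2 ^ j\<close>. The index \<open>2 * i\<close> appears because one parameter has to serve all
scales from \<open>i / 2\<close> to \<open>2 * i\<close>.\<close>

definition admissible :: "(nat \<Rightarrow> real) \<Rightarrow> (real \<Rightarrow> real) \<Rightarrow> bool" where
  "admissible L \<phi> \<longleftrightarrow> (\<forall>j. L j > 1) \<and> mono L \<and> filterlim L at_top sequentially \<and>
     (\<forall>\<^sub>F t in at_top. \<forall>i. 2 ^ i \<le> t\<^sup>2 \<longrightarrow> L (2 * i) \<le> \<phi> t) \<and>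
     (\<forall>k. \<forall>\<^sub>F t in at_top. \<phi> t ^ k \<le> t)"

lemma (in growth_pair) gauged_environmentI:
  assumes mmg: "marked_metric_graph G E z d" and walk: "simple_random_walk G E N X P"
    and L: "admissible L \<phi>"
    and good: "\<forall>\<^sub>F j in sequentially. ennreal (2 ^ j) \<in> good_radii G E z d v r (L j)"
  shows "gauged_environment G E z d v_real r_real growth_const \<alpha>1 volume_exponent gap_exponent N X P (\<lambda>i. L (2 * i)) \<phi>"
proof -
  interpret marked_graph G E z d by unfold_locales (fact mmg)
  interpret scaled_graph G E z d v_real r_real growth_const \<alpha>1 volume_exponent gap_exponent by unfold_locales
  interpret graph_random_walk G E N X P
    by unfold_locales (fact walk, fact countable_G)
  have L1: "L j > 1" for j using L by (simp add: admissible_def)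
  have mono: "i \<le> j \<Longrightarrow> L i \<le> L j" for i j using L by (simp add: admissible_def mono_def)
  have gauge: "\<forall>\<^sub>F t in at_top. \<forall>i. 2 ^ i \<le> t\<^sup>2 \<longrightarrow> L (2 * i) \<le> \<phi> t"
    and slow: "\<forall>\<^sub>F t in at_top. \<phi> t ^ k \<le> t" for k
    using L by (auto simp: admissible_def)
  show ?thesis
  proof unfold_locales
    obtain j0 where j0: "\<And>j. j \<ge> j0 \<Longrightarrow> ennreal (2 ^ j) \<in> good_radii G E z d v r (L j)"
      using good by (auto simp: eventually_sequentially)
    show "\<forall>\<^sub>F i in sequentially. \<forall>j. i \<le> 2 * j \<and> j \<le> 2 * i \<longrightarrow> scaled_graph.good G E z d v_real r_real (L (2 * i)) (2 ^ j)"
      using eventually_ge_at_top[of "2 * j0"]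
    proof eventually_elim
      case (elim i)
      show ?case
      proof (intro allI impI)
        fix j assume j: "i \<le> 2 * j \<and> j \<le> 2 * i"
        have "good (L j) (2 ^ j)"
          using elim j j0 L1 by (intro good_radii_imp_good[OF v_eq r_eq]) auto
        then show "good (L (2 * i)) (2 ^ j)"
          by (rule good_mono) (use L1[of j] mono[of j "2 * i"] j in auto)
      qed
    qed
    show "filterlim (\<lambda>i. L (2 * i)) at_top sequentially"
    proof (rule filterlim_compose[of L])
      show "filterlim L at_top sequentially" using L by (simp add: admissible_def)
      show "filterlim (\<lambda>i::nat. 2 * i) sequentially sequentially"
        by (rule filterlim_at_top_mono[OF filterlim_ident]) auto
    qed
    show "\<forall>\<^sub>F i in sequentially. L (2 * i) ^ k \<le> 2 ^ i" for k
    proof -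
      have "filterlim (\<lambda>i::nat. 2 ^ i :: real) at_top sequentially" by real_asymp
      from eventually_compose_filterlim[OF eventually_conj[OF gauge slow[of k]] this]
      show ?thesis
      proof eventually_elim
        case (elim i)
        have "(2::real) ^ i \<le> (2 ^ i)\<^sup>2"
          unfolding power2_eq_square by (simp add: mult_le_cancel_left1)
        then have "L (2 * i) \<le> \<phi> (2 ^ i)" using elim by blast
        then have "L (2 * i) ^ k \<le> \<phi> (2 ^ i) ^ k" using L1[of "2 * i"] by (intro power_mono) auto
        with elim show ?case by linarith
      qed
    qed
  qed (fact gauge slow)+
qed

section \<open>The conclusions for one environment\<close>

lemma gauge_powers:
  fixes g :: real
  assumes "g > 0"
  shows "g powr (real (a * e)) = (g ^ a) ^ e" and "g powr (- real (a * e)) = inverse ((g ^ a) ^ e)"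
    and "(g ^ a) ^ e > 0"
  using assms by (simp_all only: powr_minus powr_realpow power_mult) simp

text \<open>A random time after which a property holds, when the property holds from the time \<open>F m\<close> on if
  the event \<open>B m\<close> occurs.\<close>

lemma measurable_threshold:
  fixes F :: "nat \<Rightarrow> ennreal"
  assumes "prob_space Q" "sets Q = sets N" and B: "\<And>m. B m \<in> sets N" and F: "\<And>m. F m < \<infinity>"
    and ae: "AE c in Q. \<exists>m. c \<in> B m"
  shows "\<exists>H \<in> borel_measurable N. measure Q {c \<in> space N. H c < \<infinity>} = 1 \<and>
     (\<forall>c\<in>space N. \<forall>t<\<infinity>. H c \<le> t \<longrightarrow> (\<exists>m. c \<in> B m \<and> F m \<le> t))"
proof -
  interpret prob_space Q by fact
  have space: "space Q = space N" by (rule sets_eq_imp_space_eq) fact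
  define H where "H c = (if \<exists>m. c \<in> B m then F (LEAST m. c \<in> B m) else \<infinity>)" for c
  have pred: "Measurable.pred N (\<lambda>c. c \<in> B m)" for m using B by measurable
  have L: "(\<lambda>c. LEAST m. c \<in> B m) \<in> N \<rightarrow>\<^sub>M count_space UNIV" by (rule measurable_Least[OF pred])
  have "(\<lambda>c. F (LEAST m. c \<in> B m)) \<in> borel_measurable N"
    by (rule measurable_compose[OF L]) simp
  then have "H \<in> borel_measurable N"
    unfolding H_def
  proof (rule measurable_If)
    show "{c \<in> space N. \<exists>m. c \<in> B m} \<in> sets N"
      by (rule sets.sets_Collect_countable_Ex) (use pred in \<open>simp add: pred_def\<close>)
  qed simp
  moreover have "measure Q {c \<in> space N. H c < \<infinity>} = 1"
  proof -
    have "{c \<in> space N. H c < \<infinity>} \<in> sets N"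
      using \<open>H \<in> borel_measurable N\<close> by measurable
    then have S: "{c \<in> space N. H c < \<infinity>} \<in> events" using assms(2) by simp
    have "AE c in Q. c \<in> {c \<in> space N. H c < \<infinity>}"
      using ae AE_space
    proof eventually_elim
      case (elim c)
      then show ?case using F by (simp add: H_def space)
    qed
    then show ?thesis by (subst prob_eq_1[OF S])
  qed
  moreover have "\<exists>m. c \<in> B m \<and> F m \<le> t" if "t < \<infinity>" "H c \<le> t" for c t
  proof (cases "\<exists>m. c \<in> B m")
    case True
    then have "c \<in> B (LEAST m. c \<in> B m)" by (rule LeastI_ex)
    then show ?thesis using that True by (auto simp: H_def)
  next
    case False
    then show ?thesis using that by (simp add: H_def top_unique)
  qed
  ultimately show ?thesis by blast
qed

context growth_pair
begin

text \<open>Passage from a statement about the radius \<open>T\<close> with \<open>w T = n\<close> to \<open>time_inverse\<close>.\<close>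

lemma eventually_time_inverse:
  assumes "\<forall>\<^sub>F n in sequentially. \<forall>T\<ge>1. w T = real n \<longrightarrow> Q n T"
  shows "\<forall>\<^sub>F n in sequentially. \<exists>T\<ge>1. w T = real n \<and> time_inverse v r (of_nat n) = ennreal T \<and> Q n T"
  using assms eventually_ge_at_top[of 1]
proof eventually_elim
  case (elim n)
  obtain T where "T \<ge> 1" "w T = real n" "time_inverse v r (ennreal (real n)) = ennreal T"
    using time_inverse_eq[of "real n"] elim by auto
  then show ?case using elim(1) by (auto simp: ennreal_of_nat_eq_real_of_nat)
qed

lemma heat_kernel_conclusion:
  assumes env: "gauged_environment G E z d v_real r_real growth_const \<alpha>1 volume_exponent gap_exponent N X P lam \<phi>"
    and \<phi>: "\<And>t. \<phi> t = g t ^ a" and g: "\<forall>\<^sub>F t in at_top. g t > 0" and x: "x \<in> G"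
  shows "\<exists>Nx :: nat. \<forall>n\<ge>Nx.
      ennreal (g (real n) powr (- real (a * total_loss))) / v (time_inverse v r (of_nat n))
        \<le> ennreal (heat_kernel E X P (2 * n) x x) \<and>
      ennreal (heat_kernel E X P (2 * n) x x)
        \<le> ennreal (g (real n) powr real (a * total_loss)) / v (time_inverse v r (of_nat n))"
proof -
  interpret gauged_environment G E z d v_real r_real growth_const \<alpha>1 volume_exponent gap_exponent N X P lam \<phi> by (rule env)
  have "\<forall>\<^sub>F n in sequentially.
      ennreal (g (real n) powr (- real (a * total_loss))) / v (time_inverse v r (of_nat n))
        \<le> ennreal (heat_kernel E X P (2 * n) x x) \<and>
      ennreal (heat_kernel E X P (2 * n) x x)
        \<le> ennreal (g (real n) powr real (a * total_loss)) / v (time_inverse v r (of_nat n))"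
    using eventually_time_inverse[OF heat_kernel_bounds[OF x]]
      eventually_compose_filterlim[OF g filterlim_real_sequentially]
  proof eventually_elim
    case (elim n)
    let ?H = "heat_kernel E X P (2 * n) x x"
    from elim(1) obtain T where T: "T \<ge> 1" "time_inverse v r (of_nat n) = ennreal T"
      "1 \<le> \<phi> (real n) ^ total_loss * v_real T * ?H" "v_real T * ?H \<le> \<phi> (real n) ^ total_loss" by blast
    note gp = gauge_powers[OF elim(2), of a total_loss, folded \<phi>]
    have vT: "v_real T > 0" using v_pos T by auto
    have div: "ennreal y / v (time_inverse v r (of_nat n)) = ennreal (y / v_real T)" if "y \<ge> 0" for y
      unfolding T(2) v_eq using that vT by (intro divide_ennreal) auto
    have "inverse (\<phi> (real n) ^ total_loss) / v_real T \<le> ?H" using T(3) gp(3) vT by (simp add: field_simps)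
    moreover have "?H \<le> \<phi> (real n) ^ total_loss / v_real T" using T(4) vT by (simp add: field_simps)
    ultimately show ?case
      using gp(3) unfolding gp(1,2) by (subst (1 2) div) (auto intro: ennreal_leI)
  qed
  then show ?thesis by (simp add: eventually_sequentially)
qed

lemma mean_exit_conclusion:
  assumes env: "gauged_environment G E z d v_real r_real growth_const \<alpha>1 volume_exponent gap_exponent N X P lam \<phi>"
    and \<phi>: "\<And>t. \<phi> t = g t ^ a" and g: "\<forall>\<^sub>F t in at_top. g t > 0" and x: "x \<in> G"
  shows "\<exists>Rx :: real. \<forall>R\<ge>Rx.
      ennreal (g R powr (- real (a * total_loss))) * v (ennreal R) * r (ennreal R)
        \<le> mean_exit_time G z d X P x R \<and>
      mean_exit_time G z d X P x R
        \<le> ennreal (g R powr real (a * total_loss)) * v (ennreal R) * r (ennreal R)"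
proof -
  interpret gauged_environment G E z d v_real r_real growth_const \<alpha>1 volume_exponent gap_exponent N X P lam \<phi> by (rule env)
  have "\<forall>\<^sub>F R in at_top.
      ennreal (g R powr (- real (a * total_loss))) * v (ennreal R) * r (ennreal R)
        \<le> mean_exit_time G z d X P x R \<and>
      mean_exit_time G z d X P x R
        \<le> ennreal (g R powr real (a * total_loss)) * v (ennreal R) * r (ennreal R)"
    using mean_exit_time_bounds[OF x] g eventually_gt_at_top[of 0]
  proof eventually_elim
    case (elim R)
    from elim(1) obtain M where M: "mean_exit_time G z d X P x R = ennreal M"
      "w R \<le> \<phi> R ^ total_loss * M" "M \<le> \<phi> R ^ total_loss * w R" by blast
    note gp = gauge_powers[OF elim(2), of a total_loss, folded \<phi>]
    have wR: "w R > 0" using w_pos elim by auto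
    have mul: "ennreal y * v (ennreal R) * r (ennreal R) = ennreal (y * w R)" if "y \<ge> 0" for y
      unfolding mult.assoc product_eq using that wR by (simp add: ennreal_mult)
    have "inverse (\<phi> R ^ total_loss) * w R \<le> M" using M(2) gp(3) by (simp add: field_simps)
    then show ?case
      using gp(3) M(3) unfolding gp(1,2) M(1) by (subst (1 2) mul) (auto intro: ennreal_leI)
  qed
  then show ?thesis by (simp add: eventually_at_top_linorder)
qed

lemma path_conclusion:
  assumes env: "polynomial_environment G E z d v_real r_real growth_const \<alpha>1 volume_exponent gap_exponent N X P lam \<phi>"
    and \<phi>: "\<And>t. \<phi> t = g t ^ a" and g: "\<forall>\<^sub>F t in at_top. g t > 0" and x: "x \<in> G"
  shows "\<exists>(Nx :: 'b \<Rightarrow> ennreal) (Rx :: 'b \<Rightarrow> ennreal).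
       Nx \<in> borel_measurable N \<and> Rx \<in> borel_measurable N \<and>
       measure (P x) {c \<in> space N. Nx c < \<infinity>} = 1 \<and>
       measure (P x) {c \<in> space N. Rx c < \<infinity>} = 1 \<and>
       (\<forall>c\<in>space N. \<forall>n :: nat. Nx c \<le> of_nat n \<longrightarrow>
          ennreal (g (real n) powr (- real (a * total_loss))) * time_inverse v r (of_nat n)
            \<le> ennreal (max_displacement z d X n c) \<and>
          ennreal (max_displacement z d X n c)
            \<le> ennreal (g (real n) powr real (a * total_loss)) * time_inverse v r (of_nat n)) \<and>
       (\<forall>c\<in>space N. \<forall>R :: real. Rx c \<le> ennreal R \<longrightarrow>
          ennreal (g R powr (- real (a * total_loss))) * v (ennreal R) * r (ennreal R)
            \<le> exit_time G z d X R c \<and>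
          exit_time G z d X R c
            \<le> ennreal (g R powr real (a * total_loss)) * v (ennreal R) * r (ennreal R))"
    (is "\<exists>Nx Rx. _ \<and> _ \<and> _ \<and> _ \<and> (\<forall>c\<in>space N. \<forall>n. _ \<longrightarrow> ?Y n c) \<and> (\<forall>c\<in>space N. \<forall>R. _ \<longrightarrow> ?E R c)")
proof -
  interpret polynomial_environment G E z d v_real r_real growth_const \<alpha>1 volume_exponent gap_exponent N X P lam \<phi> by (rule env)
  interpret prob_space "P x" by (rule prob_space_P[OF x])
  define B where "B m = {c \<in> space N. \<forall>i\<ge>m. path_ok i c}" for m
  have B: "B m \<in> sets N" for m
  proof -
    have "B m = {c \<in> space N. \<forall>i. i \<ge> m \<longrightarrow> path_ok i c}" by (simp add: B_def)
    also have "\<dots> \<in> sets N"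
    proof (rule sets.sets_Collect_countable_All)
      fix i show "{c \<in> space N. m \<le> i \<longrightarrow> path_ok i c} \<in> sets N"
        using path_ok_sets[of i] by (cases "m \<le> i") simp_all
    qed
    finally show ?thesis .
  qed
  have ae: "AE c in P x. \<exists>m. c \<in> B m"
    using path_ok_AE[OF x] AE_space
  proof eventually_elim
    case (elim c)
    then show ?case unfolding B_def eventually_sequentially space_P[OF x] by blast
  qed
  have "\<exists>n0. \<forall>n\<ge>n0. \<forall>c\<in>B m. ?Y n c" for m
  proof -
    have "\<forall>\<^sub>F n in sequentially. \<forall>c\<in>B m. ?Y n c"
      using eventually_time_inverse[OF displacement_and_range_bounds[of m]]
        eventually_compose_filterlim[OF g filterlim_real_sequentially]
    proof eventually_elim
      case (elim n)
      note gp = gauge_powers[OF elim(2), of a total_loss, folded \<phi>]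
      from elim(1) obtain T j1 j2 where T: "T \<ge> 1" "time_inverse v r (of_nat n) = ennreal T"
        and j: "j1 \<ge> m" "j2 \<ge> m"
        and bd: "\<forall>c\<in>space N. path_ok j1 c \<and> path_ok j2 c \<longrightarrow>
            T \<le> \<phi> (real n) ^ total_loss * max_displacement z d X n c \<and>
            max_displacement z d X n c \<le> \<phi> (real n) ^ total_loss * T \<and>
            v_real T \<le> \<phi> (real n) ^ total_loss * range_volume E X n c \<and>
            range_volume E X n c \<le> \<phi> (real n) ^ total_loss * v_real T" by blast
      have mul: "ennreal y * time_inverse v r (of_nat n) = ennreal (y * T)" if "y \<ge> 0" for y
        unfolding T(2) using that T by (simp add: ennreal_mult)
      show ?case
      proof
        fix c assume c: "c \<in> B m"
        then have "c \<in> space N" "path_ok j1 c" "path_ok j2 c" using j unfolding B_def by blast+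
        with bd have Y: "T \<le> \<phi> (real n) ^ total_loss * max_displacement z d X n c"
            "max_displacement z d X n c \<le> \<phi> (real n) ^ total_loss * T" by blast+
        have "inverse (\<phi> (real n) ^ total_loss) * T \<le> max_displacement z d X n c"
          using Y(1) gp(3) by (simp add: field_simps)
        then show "?Y n c"
          using gp(3) Y(2) unfolding gp(1,2) by (subst (1 2) mul) (auto intro: ennreal_leI)
      qed
    qed
    then show ?thesis by (simp add: eventually_sequentially)
  qed
  then obtain FN where FN: "\<And>m n c. n \<ge> FN m \<Longrightarrow> c \<in> B m \<Longrightarrow> ?Y n c" by metis
  have "\<exists>R0\<ge>1. \<forall>R\<ge>R0. \<forall>c\<in>B m. ?E R c" for m
  proof -
    have "\<forall>\<^sub>F R in at_top. \<forall>c\<in>B m. ?E R c"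
      using exit_time_bounds g eventually_ge_at_top[of "2 ^ m"]
    proof eventually_elim
      case (elim R)
      note gp = gauge_powers[OF elim(2), of a total_loss, folded \<phi>]
      have "(1::real) \<le> 2 ^ m" by (rule one_le_power) simp
      then have R: "R \<ge> 1" "R > 0" using elim(3) by linarith+
      obtain i where i: "2 ^ i \<le> R" "R < 2 ^ Suc i" using dyadic_index[OF R(1)] .
      have "(2::real) ^ m < 2 ^ Suc i" using i elim(3) by linarith
      then have "m < Suc i" by (simp only: power_strict_increasing_iff one_less_numeral_iff semiring_norm)
      then have mi: "m \<le> i" "m \<le> Suc i" by simp_all
      have wR: "w R > 0" using w_pos R by auto
      have mul: "ennreal y * v (ennreal R) * r (ennreal R) = ennreal (y * w R)" if "y \<ge> 0" for y
        unfolding mult.assoc product_eq using that wR by (simp add: ennreal_mult)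
      show ?case
      proof
        fix c assume c: "c \<in> B m"
        then have "path_ok i c" "path_ok (Suc i) c" using mi unfolding B_def by blast+
        with elim(1) i have "ennreal (w R / \<phi> R ^ total_loss) \<le> exit_time G z d X R c"
          "exit_time G z d X R c \<le> ennreal (\<phi> R ^ total_loss * w R)" by blast+
        moreover have "w R / \<phi> R ^ total_loss = inverse (\<phi> R ^ total_loss) * w R" by (simp add: field_simps)
        ultimately show "?E R c" using gp(3) unfolding gp(1,2) by (subst (1 2) mul) auto
      qed
    qed
    then obtain R0 where "\<forall>R\<ge>R0. \<forall>c\<in>B m. ?E R c" by (auto simp: eventually_at_top_linorder)
    then show ?thesis by (intro exI[of _ "max 1 R0"]) auto
  qed
  then obtain FR where FR: "\<And>m. FR m \<ge> 1" "\<And>m R c. R \<ge> FR m \<Longrightarrow> c \<in> B m \<Longrightarrow> ?E R c" by metis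
  obtain Nx where Nx: "Nx \<in> borel_measurable N" "measure (P x) {c \<in> space N. Nx c < \<infinity>} = 1"
      "\<And>c t. c \<in> space N \<Longrightarrow> t < \<infinity> \<Longrightarrow> Nx c \<le> t \<Longrightarrow> \<exists>m. c \<in> B m \<and> ennreal (real (FN m)) \<le> t"
    using measurable_threshold[where F="\<lambda>m. ennreal (real (FN m))", OF prob_space_axioms sets_P[OF x] B _ ae]
    by auto
  obtain Rx where Rx: "Rx \<in> borel_measurable N" "measure (P x) {c \<in> space N. Rx c < \<infinity>} = 1"
      "\<And>c t. c \<in> space N \<Longrightarrow> t < \<infinity> \<Longrightarrow> Rx c \<le> t \<Longrightarrow> \<exists>m. c \<in> B m \<and> ennreal (FR m) \<le> t"
    using measurable_threshold[where F="\<lambda>m. ennreal (FR m)", OF prob_space_axioms sets_P[OF x] B _ ae]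
    by auto
  have 1: "?Y n c" if c: "c \<in> space N" "Nx c \<le> of_nat n" for n c
  proof -
    have "(of_nat n :: ennreal) < \<infinity>" by (simp add: ennreal_of_nat_eq_real_of_nat)
    from Nx(3)[OF c(1) this c(2)] obtain m where m: "c \<in> B m" "ennreal (real (FN m)) \<le> of_nat n" by blast
    then have "FN m \<le> n" by (simp add: ennreal_of_nat_eq_real_of_nat)
    then show ?thesis using FN m(1) by blast
  qed
  have 2: "?E R c" if c: "c \<in> space N" "Rx c \<le> ennreal R" for R c
  proof -
    from Rx(3)[OF c(1) _ c(2)] obtain m where m: "c \<in> B m" "ennreal (FR m) \<le> ennreal R" by auto
    then have "FR m \<le> R" using FR(1)[of m] by (auto simp: ennreal_le_iff2)
    then show ?thesis using FR(2) m(1) by blast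
  qed
  from Nx(1,2) Rx(1,2) 1 2 show ?thesis by blast
qed

end

section \<open>Logarithmic limits\<close>

text \<open>Factors that are negligible on the logarithmic scale do not change a logarithmic limit.\<close>

lemma log_sandwich:
  fixes V H F s :: "'c \<Rightarrow> real"
  assumes ev: "\<forall>\<^sub>F n in \<FF>. V n > 0 \<and> F n > 0 \<and> V n \<le> F n * H n \<and> H n \<le> F n * V n"
    and s: "\<forall>\<^sub>F n in \<FF>. s n > 0"
    and F: "((\<lambda>n. ln (F n) / s n) \<longlongrightarrow> 0) \<FF>" and V: "((\<lambda>n. ln (V n) / s n) \<longlongrightarrow> c) \<FF>"
  shows "((\<lambda>n. ln (H n) / s n) \<longlongrightarrow> c) \<FF>"
proof (rule tendsto_sandwich)
  have key: "\<forall>\<^sub>F n in \<FF>. ln (V n) / s n - ln (F n) / s n \<le> ln (H n) / s n \<and>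
      ln (H n) / s n \<le> ln (V n) / s n + ln (F n) / s n"
    using ev s
  proof eventually_elim
    case (elim n)
    then have "0 < F n * H n" by linarith
    then have H: "H n > 0" using elim by (simp add: zero_less_mult_iff)
    have "ln (V n) \<le> ln (F n * H n)" "ln (H n) \<le> ln (F n * V n)"
      using elim H by simp_all
    then have "ln (V n) \<le> ln (F n) + ln (H n)" "ln (H n) \<le> ln (F n) + ln (V n)"
      using elim H by (simp_all add: ln_mult)
    then have "ln (V n) / s n \<le> (ln (F n) + ln (H n)) / s n" "ln (H n) / s n \<le> (ln (F n) + ln (V n)) / s n"
      using elim(2) by (simp_all only: divide_right_mono less_imp_le)
    then show ?case by (simp add: add_divide_distrib)
  qed
  show "\<forall>\<^sub>F n in \<FF>. ln (V n) / s n - ln (F n) / s n \<le> ln (H n) / s n"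
    using key by eventually_elim simp
  show "\<forall>\<^sub>F n in \<FF>. ln (H n) / s n \<le> ln (V n) / s n + ln (F n) / s n"
    using key by eventually_elim simp
  show "((\<lambda>n. ln (V n) / s n - ln (F n) / s n) \<longlongrightarrow> c) \<FF>" using tendsto_diff[OF V F] by simp
  show "((\<lambda>n. ln (V n) / s n + ln (F n) / s n) \<longlongrightarrow> c) \<FF>" using tendsto_add[OF V F] by simp
qed

lemma log_growth_limit:
  fixes f :: "real \<Rightarrow> real"
  assumes C: "C \<ge> 1" and f: "\<And>R. R > 0 \<Longrightarrow> f R > 0"
    and bd: "\<And>R. R \<ge> 2 \<Longrightarrow> inverse C * R powr D * ln R powr (- m) \<le> f R \<and> f R \<le> C * R powr D * ln R powr m"
  shows "((\<lambda>R. ln (f R) / ln R) \<longlongrightarrow> D) at_top"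
proof (rule tendsto_sandwich)
  have key: "\<forall>\<^sub>F R in at_top. (- ln C + D * ln R - m * ln (ln R)) / ln R \<le> ln (f R) / ln R \<and>
      ln (f R) / ln R \<le> (ln C + D * ln R + m * ln (ln R)) / ln R"
    using eventually_ge_at_top[of "2::real"]
  proof eventually_elim
    case (elim R)
    have lR: "ln R > 0" using elim by simp
    have "ln (inverse C * R powr D * ln R powr (- m)) \<le> ln (f R)" "ln (f R) \<le> ln (C * R powr D * ln R powr m)"
      using bd[OF elim] C elim f[of R] lR by simp_all
    then have "- ln C + D * ln R - m * ln (ln R) \<le> ln (f R)" "ln (f R) \<le> ln C + D * ln R + m * ln (ln R)"
      using C elim lR by (simp_all add: ln_mult ln_powr ln_inverse)
    then show ?case using lR by (simp add: divide_right_mono)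
  qed
  show "\<forall>\<^sub>F R in at_top. (- ln C + D * ln R - m * ln (ln R)) / ln R \<le> ln (f R) / ln R"
    using key by eventually_elim simp
  show "\<forall>\<^sub>F R in at_top. ln (f R) / ln R \<le> (ln C + D * ln R + m * ln (ln R)) / ln R"
    using key by eventually_elim simp
  show "((\<lambda>R. (- ln C + D * ln R - m * ln (ln R)) / ln R) \<longlongrightarrow> D) at_top" by real_asymp
  show "((\<lambda>R. (ln C + D * ln R + m * ln (ln R)) / ln R) \<longlongrightarrow> D) at_top" by real_asymp
qed

lemma log_gauge_limit: "((\<lambda>R::real. ln ((ln R ^ a) ^ e) / ln R) \<longlongrightarrow> 0) at_top"
proof -
  have "((\<lambda>R::real. real (a * e) * ln (ln R) / ln R) \<longlongrightarrow> 0) at_top" by real_asymp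
  moreover have "\<forall>\<^sub>F R::real in at_top. real (a * e) * ln (ln R) / ln R = ln ((ln R ^ a) ^ e) / ln R"
    using eventually_gt_at_top[of 1]
    by eventually_elim (simp add: power_mult[symmetric] ln_realpow)
  ultimately show ?thesis by (rule Lim_transform_eventually)
qed

context growth_pair
begin

context
  fixes D \<alpha> :: real
  assumes D: "D \<ge> 1" and \<alpha>: "\<alpha> > 0"
    and v_lim: "((\<lambda>R. ln (v_real R) / ln R) \<longlongrightarrow> D) at_top"
    and r_lim: "((\<lambda>R. ln (r_real R) / ln R) \<longlongrightarrow> \<alpha>) at_top"
begin

lemma w_lim: "((\<lambda>R. ln (w R) / ln R) \<longlongrightarrow> D + \<alpha>) at_top"
proof (rule Lim_transform_eventually)
  show "((\<lambda>R. ln (v_real R) / ln R + ln (r_real R) / ln R) \<longlongrightarrow> D + \<alpha>) at_top" by (rule tendsto_add[OF v_lim r_lim])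
  show "\<forall>\<^sub>F R in at_top. ln (v_real R) / ln R + ln (r_real R) / ln R = ln (w R) / ln R"
    using eventually_gt_at_top[of 0]
  proof eventually_elim
    case (elim R)
    then show ?case using v_pos[of R] r_pos[of R] by (simp add: w_def ln_mult add_divide_distrib)
  qed
qed

definition radius :: "nat \<Rightarrow> real" where "radius n = enn2real (time_inverse v r (ennreal (real n)))"

lemma radius: "n \<ge> 1 \<Longrightarrow> radius n \<ge> 1 \<and> w (radius n) = real n"
proof -
  assume "n \<ge> 1"
  then obtain T where "T \<ge> 1" "w T = real n" "time_inverse v r (ennreal (real n)) = ennreal T"
    using time_inverse_eq[of "real n"] by auto
  then show ?thesis by (simp add: radius_def)
qed

text \<open>As \<open>w (radius n) = n\<close>, the quotient is \<open>ln v / ln w\<close> along the sequence of radii, and each logarithm is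
asymptotic to a multiple of \<open>ln R\<close>.\<close>

lemma volume_radius_lim: "(\<lambda>n. ln (v_real (radius n)) / ln (real n)) \<longlonglongrightarrow> D / (D + \<alpha>)"
proof -
  have "((\<lambda>R. (ln (v_real R) / ln R) / (ln (w R) / ln R)) \<longlongrightarrow> D / (D + \<alpha>)) at_top"
    using D \<alpha> by (intro tendsto_divide v_lim w_lim) auto
  moreover have "\<forall>\<^sub>F R in at_top. (ln (v_real R) / ln R) / (ln (w R) / ln R) = ln (v_real R) / ln (w R)"
    using eventually_gt_at_top[of 1] by eventually_elim simp
  ultimately have lim: "((\<lambda>R. ln (v_real R) / ln (w R)) \<longlongrightarrow> D / (D + \<alpha>)) at_top"
    by (rule Lim_transform_eventually)
  have "filterlim radius at_top sequentially"
    unfolding filterlim_at_top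
  proof
    fix Z :: real
    have "\<forall>\<^sub>F t in at_top. \<forall>T\<ge>1. w T = t \<longrightarrow> Z \<le> T"
      by (rule eventually_radius_of_time[OF eventually_ge_at_top])
    from eventually_compose_filterlim[OF this filterlim_real_sequentially]
    show "\<forall>\<^sub>F n in sequentially. Z \<le> radius n"
      using eventually_ge_at_top[of 1] by eventually_elim (use radius in blast)
  qed
  from filterlim_compose[OF lim this]
  have "(\<lambda>n. ln (v_real (radius n)) / ln (w (radius n))) \<longlonglongrightarrow> D / (D + \<alpha>)" .
  moreover have "\<forall>\<^sub>F n in sequentially. ln (v_real (radius n)) / ln (w (radius n)) = ln (v_real (radius n)) / ln (real n)"
    using eventually_ge_at_top[of 1] by eventually_elim (simp add: radius)
  ultimately show ?thesis by (rule Lim_transform_eventually)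
qed

lemma volume_like_lim:
  fixes H :: "nat \<Rightarrow> real"
  assumes "\<forall>\<^sub>F n in sequentially. \<forall>T\<ge>1. w T = real n \<longrightarrow>
     v_real T \<le> (ln (real n) ^ a) ^ total_loss * H n \<and> H n \<le> (ln (real n) ^ a) ^ total_loss * v_real T"
  shows "(\<lambda>n. ln (H n) / ln (real n)) \<longlonglongrightarrow> D / (D + \<alpha>)"
proof (rule log_sandwich[OF _ _ _ volume_radius_lim])
  show "\<forall>\<^sub>F n in sequentially. v_real (radius n) > 0 \<and> (ln (real n) ^ a) ^ total_loss > 0 \<and>
      v_real (radius n) \<le> (ln (real n) ^ a) ^ total_loss * H n \<and> H n \<le> (ln (real n) ^ a) ^ total_loss * v_real (radius n)"
    using assms eventually_ge_at_top[of 2]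
  proof eventually_elim
    case (elim n)
    then have "radius n \<ge> 1" "w (radius n) = real n" using radius by auto
    then show ?case using elim v_pos[of "radius n"] by auto
  qed
  show "\<forall>\<^sub>F n in sequentially. ln (real n) > 0"
    using eventually_ge_at_top[of 2] by eventually_elim simp
  show "(\<lambda>n. ln ((ln (real n) ^ a) ^ total_loss) / ln (real n)) \<longlonglongrightarrow> 0"
    by (rule filterlim_compose[OF log_gauge_limit filterlim_real_sequentially])
qed

text \<open>The reciprocal of the heat kernel, the range and the mean exit time agree with \<open>v (radius n)\<close> or \<open>w R\<close>
up to powers of the logarithm, which do not affect logarithmic limits.\<close>

lemma limits_conclusion:
  assumes env: "polynomial_environment G E z d v_real r_real growth_const \<alpha>1 volume_exponent gap_exponent N X P lam (\<lambda>t. ln t ^ a)" and x: "x \<in> G"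
  shows "(\<lambda>n. - 2 * (ln (heat_kernel E X P (2 * n) x x) / ln (real n))) \<longlonglongrightarrow> 2 * D / (D + \<alpha>) \<and>
    recurrent_walk G X P \<and>
    (\<forall>\<^sub>F R in at_top. mean_exit_time G z d X P x R < \<infinity>) \<and>
    ((\<lambda>R. ln (enn2real (mean_exit_time G z d X P x R)) / ln R) \<longlongrightarrow> D + \<alpha>) at_top \<and>
    (AE c in P x. (\<lambda>n. ln (range_volume E X n c) / ln (real n)) \<longlonglongrightarrow> D / (D + \<alpha>))"
proof (intro conjI)
  interpret polynomial_environment G E z d v_real r_real growth_const \<alpha>1 volume_exponent gap_exponent N X P lam "\<lambda>t. ln t ^ a" by (rule env)
  show "recurrent_walk G X P" by (rule recurrent)
  show "\<forall>\<^sub>F R in at_top. mean_exit_time G z d X P x R < \<infinity>"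
    using mean_exit_time_bounds[OF x] by eventually_elim auto
  let ?H = "\<lambda>n. heat_kernel E X P (2 * n) x x"
  have "\<forall>\<^sub>F n in sequentially. \<forall>T\<ge>1. w T = real n \<longrightarrow>
     v_real T \<le> (ln (real n) ^ a) ^ total_loss * (1 / ?H n) \<and> 1 / ?H n \<le> (ln (real n) ^ a) ^ total_loss * v_real T"
    using heat_kernel_bounds[OF x] eventually_ge_at_top[of 2]
  proof eventually_elim
    case (elim n)
    show ?case
    proof (intro allI impI)
      fix T :: real assume T: "T \<ge> 1" "w T = real n"
      let ?F = "(ln (real n) ^ a) ^ total_loss"
      from elim(1) T have b: "1 \<le> ?F * v_real T * ?H n" "v_real T * ?H n \<le> ?F" by blast+
      have vT: "v_real T > 0" using v_pos T by auto
      have F: "?F > 0" using elim(2) by simp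
      have "0 < (?F * v_real T) * ?H n" using b(1) by linarith
      then have H: "?H n > 0" by (rule zero_less_mult_pos) (use F vT in simp)
      show "v_real T \<le> ?F * (1 / ?H n) \<and> 1 / ?H n \<le> ?F * v_real T" using b H by (simp add: field_simps)
    qed
  qed
  from volume_like_lim[OF this] have "(\<lambda>n. ln (1 / ?H n) / ln (real n)) \<longlonglongrightarrow> D / (D + \<alpha>)" .
  from tendsto_mult[OF tendsto_const[of 2] this]
  have "(\<lambda>n. 2 * (ln (1 / ?H n) / ln (real n))) \<longlonglongrightarrow> 2 * (D / (D + \<alpha>))" .
  then show "(\<lambda>n. - 2 * (ln (?H n) / ln (real n))) \<longlonglongrightarrow> 2 * D / (D + \<alpha>)"
    by (simp add: divide_inverse ln_inverse mult.assoc)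
  show "((\<lambda>R. ln (enn2real (mean_exit_time G z d X P x R)) / ln R) \<longlongrightarrow> D + \<alpha>) at_top"
  proof (rule log_sandwich[OF _ _ log_gauge_limit w_lim])
    show "\<forall>\<^sub>F R in at_top. w R > 0 \<and> (ln R ^ a) ^ total_loss > 0 \<and>
        w R \<le> (ln R ^ a) ^ total_loss * enn2real (mean_exit_time G z d X P x R) \<and>
        enn2real (mean_exit_time G z d X P x R) \<le> (ln R ^ a) ^ total_loss * w R"
      using mean_exit_time_bounds[OF x] eventually_gt_at_top[of 1]
    proof eventually_elim
      case (elim R)
      then show ?case using w_pos[of R] by auto
    qed
    show "\<forall>\<^sub>F R in at_top. ln R > (0::real)"
      using eventually_gt_at_top[of 1] by eventually_elim simp
  qed
  show "AE c in P x. (\<lambda>n. ln (range_volume E X n c) / ln (real n)) \<longlonglongrightarrow> D / (D + \<alpha>)"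
    using path_ok_AE[OF x] AE_space
  proof eventually_elim
    case (elim c)
    then obtain m where m: "\<And>i. i \<ge> m \<Longrightarrow> path_ok i c" unfolding eventually_sequentially by blast
    have c: "c \<in> space N" using elim(2) unfolding space_P[OF x] .
    show ?case
    proof (rule volume_like_lim)
      show "\<forall>\<^sub>F n in sequentially. \<forall>T\<ge>1. w T = real n \<longrightarrow>
         v_real T \<le> (ln (real n) ^ a) ^ total_loss * range_volume E X n c \<and>
         range_volume E X n c \<le> (ln (real n) ^ a) ^ total_loss * v_real T"
        using displacement_and_range_bounds[of m] by eventually_elim (use m c in blast)
    qed
  qed
qed

end

end

section \<open>Choice of the error parameters\<close>

lemma eventually_power_ln_le: "\<forall>\<^sub>F t::real in at_top. ln t ^ m \<le> t"
proof -
  have "((\<lambda>x::real. x ^ m / exp x) \<longlongrightarrow> 0) at_top" by (rule tendsto_power_div_exp_0)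
  then have "\<forall>\<^sub>F x::real in at_top. x ^ m / exp x < 1" by (rule order_tendstoD) simp
  from eventually_compose_filterlim[OF this ln_at_top] eventually_gt_at_top[of 0]
  show ?thesis by eventually_elim simp
qed

lemma dyadic_le_ln:
  assumes t: "t > 1" and i: "(2::real) ^ i \<le> t\<^sup>2"
  shows "real i \<le> 3 * ln t"
proof -
  have "ln ((2::real) ^ i) \<le> ln (t\<^sup>2)" using i t by (subst ln_le_cancel_iff) auto
  then have 1: "real i * ln 2 \<le> 2 * ln t" using t by (simp add: ln_realpow)
  have "real i * (2/3) \<le> real i * ln 2" using ln2_ge_two_thirds by (intro mult_left_mono) auto
  with 1 show ?thesis by simp
qed

text \<open>An index \<open>i\<close> with \<open>2 ^ i \<le> t\<^sup>2\<close> is at most \<open>3 * ln t\<close>. The additional power of \<open>ln t\<close> in the gauge absorbs the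
constants \<open>l0\<close> and \<open>6 ^ a\<close>.\<close>

lemma admissible_power:
  assumes l0: "l0 > 1" and a: "a \<ge> 1"
  shows "admissible (\<lambda>j. l0 + real j ^ a) (\<lambda>t. ln t ^ (a + 1))"
  unfolding admissible_def
proof (intro conjI allI)
  show "l0 + real j ^ a > 1" for j
  proof -
    have "real j ^ a \<ge> 0" by simp
    then show ?thesis using l0 by linarith
  qed
  show "mono (\<lambda>j. l0 + real j ^ a)" by (intro monoI add_left_mono power_mono) auto
  show "filterlim (\<lambda>j. l0 + real j ^ a) at_top sequentially"
  proof (rule filterlim_at_top_mono[OF filterlim_real_sequentially])
    show "\<forall>\<^sub>F j in sequentially. real j \<le> l0 + real j ^ a"
      using eventually_ge_at_top[of 1]
    proof eventually_elim
      case (elim j)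
      then have "real j \<le> real j ^ a" using a by (intro self_le_power) auto
      with l0 show ?case by linarith
    qed
  qed
  show "\<forall>\<^sub>F t in at_top. \<forall>i. 2 ^ i \<le> t\<^sup>2 \<longrightarrow> l0 + real (2 * i) ^ a \<le> ln t ^ (a + 1)"
    using eventually_gt_at_top[of 1] eventually_compose_filterlim[OF eventually_ge_at_top[of "l0 + 6 ^ a"] ln_at_top]
  proof eventually_elim
    case (elim t)
    have l1: "ln t \<ge> 1" using elim(2) l0 zero_le_power[of "6::real" a] by linarith
    show ?case
    proof (intro allI impI)
      fix i assume i: "2 ^ i \<le> t\<^sup>2"
      have "real (2 * i) \<le> 6 * ln t" using dyadic_le_ln[OF elim(1) i] by simp
      then have "real (2 * i) ^ a \<le> (6 * ln t) ^ a" by (intro power_mono) auto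
      moreover have "l0 * 1 \<le> l0 * ln t ^ a" using l0 l1 by (intro mult_left_mono one_le_power) auto
      ultimately have "l0 + real (2 * i) ^ a \<le> (l0 + 6 ^ a) * ln t ^ a"
        by (simp add: power_mult_distrib algebra_simps)
      also have "\<dots> \<le> ln t * ln t ^ a" using elim(2) l1 by (intro mult_right_mono) auto
      finally show "l0 + real (2 * i) ^ a \<le> ln t ^ (a + 1)" by simp
    qed
  qed
  show "\<forall>\<^sub>F t::real in at_top. (ln t ^ (a + 1)) ^ k \<le> t" for k
    unfolding power_mult[symmetric] by (rule eventually_power_ln_le)
qed

text \<open>As for \<open>admissible_power\<close>, with \<open>ln (ln t)\<close> in the role of \<open>ln t\<close>.\<close>

lemma admissible_log_power:
  assumes l0: "l0 > 1" and k: "k > 0" and s: "s > 0"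
  shows "admissible (\<lambda>j. l0 + (k * ln (real j + 1)) powr s) (\<lambda>t. ln (ln t) ^ (nat \<lceil>s\<rceil> + 1))"
  unfolding admissible_def
proof (intro conjI allI)
  show "l0 + (k * ln (real j + 1)) powr s > 1" for j
    using l0 powr_ge_zero[of "k * ln (real j + 1)" s] by linarith
  show "mono (\<lambda>j. l0 + (k * ln (real j + 1)) powr s)"
    using k s by (intro monoI add_left_mono powr_mono2 mult_left_mono) auto
  show "filterlim (\<lambda>j. l0 + (k * ln (real j + 1)) powr s) at_top sequentially"
    using k s by real_asymp
  let ?m = "nat \<lceil>s\<rceil>"
  have lnln: "filterlim (\<lambda>t::real. ln (ln t)) at_top at_top" by real_asymp
  show "\<forall>\<^sub>F t in at_top. \<forall>i. 2 ^ i \<le> t\<^sup>2 \<longrightarrow>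
      l0 + (k * ln (real (2 * i) + 1)) powr s \<le> ln (ln t) ^ (?m + 1)"
    using eventually_gt_at_top[of 1] eventually_compose_filterlim[OF eventually_ge_at_top[of 7] ln_at_top]
      eventually_compose_filterlim[OF eventually_ge_at_top[of "l0 + (2 * k) powr s"] lnln]
  proof eventually_elim
    case (elim t)
    define y where "y = ln (ln t)"
    have y: "y \<ge> l0 + (2 * k) powr s" "y \<ge> 1"
      using elim(3) l0 powr_ge_zero[of "2 * k" s] unfolding y_def by linarith+
    show ?case
    proof (intro allI impI)
      fix i assume i: "2 ^ i \<le> t\<^sup>2"
      have "real (2 * i) + 1 \<le> 7 * ln t" using dyadic_le_ln[OF elim(1) i] elim(2) by simp
      also have "\<dots> \<le> (ln t)\<^sup>2" unfolding power2_eq_square using elim(2) by (intro mult_right_mono) auto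
      finally have "ln (real (2 * i) + 1) \<le> ln ((ln t)\<^sup>2)" using elim(2) by (subst ln_le_cancel_iff) auto
      also have "\<dots> = 2 * y" unfolding y_def using elim(2) by (simp add: ln_realpow)
      finally have "k * ln (real (2 * i) + 1) \<le> 2 * k * y" using k by simp
      then have "(k * ln (real (2 * i) + 1)) powr s \<le> (2 * k * y) powr s"
        using k s by (intro powr_mono2) auto
      also have "\<dots> = (2 * k) powr s * y powr s" using k y by (simp add: powr_mult)
      also have "\<dots> \<le> (2 * k) powr s * y ^ ?m"
      proof (rule mult_left_mono)
        have "y powr s \<le> y powr (real ?m)" using y by (intro powr_mono) linarith+
        then show "y powr s \<le> y ^ ?m" using y by (simp add: powr_realpow)
      qed simp
      finally have "(k * ln (real (2 * i) + 1)) powr s \<le> (2 * k) powr s * y ^ ?m" .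
      moreover have "l0 * 1 \<le> l0 * y ^ ?m" using l0 y by (intro mult_left_mono one_le_power) auto
      ultimately have "l0 + (k * ln (real (2 * i) + 1)) powr s \<le> (l0 + (2 * k) powr s) * y ^ ?m"
        by (simp add: algebra_simps)
      also have "\<dots> \<le> y * y ^ ?m" using y by (intro mult_right_mono) auto
      finally show "l0 + (k * ln (real (2 * i) + 1)) powr s \<le> ln (ln t) ^ (?m + 1)" by (simp add: y_def)
    qed
  qed
  show "\<forall>\<^sub>F t::real in at_top. (ln (ln t) ^ (?m + 1)) ^ n \<le> t" for n
  proof -
    have "\<forall>\<^sub>F t::real in at_top. ln (ln t) ^ ((?m + 1) * n) \<le> t"
      using eventually_compose_filterlim[OF eventually_power_ln_le[of "(?m + 1) * n"] ln_at_top]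
        eventually_gt_at_top[of 0]
    proof eventually_elim
      case (elim t)
      then show ?case using ln_le_minus_one[of t] by linarith
    qed
    then show ?thesis by (simp only: power_mult)
  qed
qed

lemma summable_power_tail:
  assumes c: "c > 0" and q0: "q0 > 0" and l0: "l0 > 1" and a: "2 / q0 \<le> real a"
  shows "summable (\<lambda>j. c * (l0 + real j ^ a) powr (- q0))"
proof (rule summable_comparison_test_ev)
  show "summable (\<lambda>j. c * (1 / (real j)\<^sup>2))"
    using inverse_power_summable[of 2, where 'a=real] by (intro summable_mult) (simp add: inverse_eq_divide)
  show "\<forall>\<^sub>F j in sequentially. norm (c * (l0 + real j ^ a) powr (- q0)) \<le> c * (1 / (real j)\<^sup>2)"
    using eventually_ge_at_top[of 1]
  proof eventually_elim
    case (elim j)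
    have j: "real j \<ge> 1" using elim by simp
    have "(l0 + real j ^ a) powr (- q0) \<le> (real j ^ a) powr (- q0)"
      using j l0 q0 by (intro powr_mono2') auto
    also have "\<dots> = real j powr (- (real a * q0))"
      using j by (simp add: powr_realpow[symmetric] powr_powr)
    also have "\<dots> \<le> real j powr (- 2)"
      using j a q0 by (intro powr_mono) (auto simp: field_simps)
    also have "\<dots> = 1 / (real j)\<^sup>2"
      using j by (simp add: powr_minus powr_numeral inverse_eq_divide)
    finally have "c * (l0 + real j ^ a) powr (- q0) \<le> c * (1 / (real j)\<^sup>2)"
      using c by (intro mult_left_mono) auto
    then show ?case using c by (simp add: abs_mult)
  qed
qed

text \<open>The first use of Borel and Cantelli, over the randomness of the environment, along the radii \<open>2 ^ j\<close>.\<close>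

lemma (in growth_pair) good_environments:
  assumes M: "prob_space M"
    and graph: "\<forall>\<omega>\<in>space M. marked_metric_graph (G \<omega>) (E \<omega>) (z \<omega>) (d \<omega>)"
    and walk: "\<forall>\<omega>\<in>space M. simple_random_walk (G \<omega>) (E \<omega>) N (X \<omega>) (P \<omega>)"
    and prob: "\<forall>R l. R \<ge> 1 \<and> l \<ge> l0 \<longrightarrow>
           {\<omega> \<in> space M. ennreal R \<in> good_radii (G \<omega>) (E \<omega>) (z \<omega>) (d \<omega>) v r l} \<in> sets M \<and>
           measure M {\<omega> \<in> space M. ennreal R \<in> good_radii (G \<omega>) (E \<omega>) (z \<omega>) (d \<omega>) v r l} \<ge> 1 - p l"
    and L: "admissible L \<phi>" "\<And>j. L j \<ge> l0" and e: "\<And>j. p (L j) \<le> e j" "summable e"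
  obtains \<Omega>0 where "\<Omega>0 \<in> sets M" "measure M \<Omega>0 = 1"
    "\<And>\<omega>. \<omega> \<in> \<Omega>0 \<Longrightarrow> gauged_environment (G \<omega>) (E \<omega>) (z \<omega>) (d \<omega>) v_real r_real growth_const \<alpha>1 volume_exponent gap_exponent N (X \<omega>) (P \<omega>) (\<lambda>i. L (2 * i)) \<phi>"
proof -
  define Q where "Q j \<omega> \<longleftrightarrow> ennreal (2 ^ j) \<in> good_radii (G \<omega>) (E \<omega>) (z \<omega>) (d \<omega>) v r (L j)" for j \<omega>
  have ge1: "(2::real) ^ j \<ge> 1" for j by (rule one_le_power) simp
  have A: "{\<omega> \<in> space M. Q j \<omega>} \<in> sets M" and b: "measure M {\<omega> \<in> space M. Q j \<omega>} \<ge> 1 - e j" for j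
  proof -
    have "1 \<le> (2::real) ^ j \<and> l0 \<le> L j" using ge1 L(2) by blast
    from prob[rule_format, OF this] e(1)[of j]
    show "{\<omega> \<in> space M. Q j \<omega>} \<in> sets M" "measure M {\<omega> \<in> space M. Q j \<omega>} \<ge> 1 - e j"
      unfolding Q_def by auto
  qed
  note BC = Borel_Cantelli_events[OF M A b e(2)]
  show ?thesis
  proof (rule that[OF BC])
    fix \<omega> assume "\<omega> \<in> {\<omega> \<in> space M. \<forall>\<^sub>F j in sequentially. Q j \<omega>}"
    then have "\<omega> \<in> space M" "\<forall>\<^sub>F j in sequentially. Q j \<omega>" by auto
    then show "gauged_environment (G \<omega>) (E \<omega>) (z \<omega>) (d \<omega>) v_real r_real growth_const \<alpha>1 volume_exponent gap_exponent N (X \<omega>) (P \<omega>) (\<lambda>i. L (2 * i)) \<phi>"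
      using graph walk L(1) unfolding Q_def by (intro gauged_environmentI) auto
  qed
qed

lemma polynomial_environmentI:
  assumes env: "gauged_environment G E z d v r K \<alpha> b q N X P (\<lambda>i. l0 + real (2 * i) ^ a) \<phi>"
    and a: "a \<ge> 2" and l0: "l0 > 1"
  shows "polynomial_environment G E z d v r K \<alpha> b q N X P (\<lambda>i. l0 + real (2 * i) ^ a) \<phi>"
proof -
  interpret gauged_environment G E z d v r K \<alpha> b q N X P "\<lambda>i. l0 + real (2 * i) ^ a" \<phi> by (rule env)
  show ?thesis
  proof unfold_locales
    show "\<forall>\<^sub>F i in sequentially. (real i)\<^sup>2 \<le> l0 + real (2 * i) ^ a"
      using eventually_ge_at_top[of 1]
    proof eventually_elim
      case (elim i)
      have "(real i)\<^sup>2 \<le> (real (2 * i))\<^sup>2" by (intro power_mono) auto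
      also have "\<dots> \<le> real (2 * i) ^ a" using elim a by (intro power_increasing) auto
      finally show ?case using l0 by simp
    qed
  qed
qed

theorem theorem1p5:
  fixes M :: "'a measure"
    and G :: "'a \<Rightarrow> 'v set"
    and E :: "'a \<Rightarrow> 'v set set"
    and z :: "'a \<Rightarrow> 'v"
    and d :: "'a \<Rightarrow> 'v \<Rightarrow> 'v \<Rightarrow> real"
    and N :: "'b measure"
    and X :: "'a \<Rightarrow> nat \<Rightarrow> 'b \<Rightarrow> 'v"
    and P :: "'a \<Rightarrow> 'v \<Rightarrow> 'b measure"
    and v r :: "ennreal \<Rightarrow> ennreal"
    and C1 C2 d1 d2 \<alpha>1 \<alpha>2 l0 :: real
    and p :: "real \<Rightarrow> real"
  assumes "prob_space M"
    and "\<forall>\<omega>\<in>space M. marked_metric_graph (G \<omega>) (E \<omega>) (z \<omega>) (d \<omega>)"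
    and "\<forall>\<omega>\<in>space M. simple_random_walk (G \<omega>) (E \<omega>) N (X \<omega>) (P \<omega>)"
    and "C1 \<ge> 1" and "C2 \<ge> 1" and "1 \<le> d1" and "d1 \<le> d2"
    and "0 < \<alpha>1" and "\<alpha>1 \<le> \<alpha>2" and "\<alpha>2 \<le> 1"
    and "growth_function v C1 d1 d2"
    and "growth_function r C2 \<alpha>1 \<alpha>2"
    and "l0 > 1"
    and "(p \<longlongrightarrow> 0) at_top"
    and "\<forall>R l. R \<ge> 1 \<and> l \<ge> l0 \<longrightarrow>
           {\<omega> \<in> space M. ennreal R \<in> good_radii (G \<omega>) (E \<omega>) (z \<omega>) (d \<omega>) v r l} \<in> sets M \<and>
           measure M {\<omega> \<in> space M. ennreal R \<in> good_radii (G \<omega>) (E \<omega>) (z \<omega>) (d \<omega>) v r l} \<ge> 1 - p l"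
  shows
    "((\<exists>q0 c. q0 > 0 \<and> c > 0 \<and> (\<forall>l\<ge>l0. p l \<le> c * l powr (- q0))) \<longrightarrow>
      (\<exists>\<beta>1 \<beta>2 \<beta>3 \<beta>4 :: real. \<exists>\<Omega>0 \<in> sets M. measure M \<Omega>0 = 1 \<and>
        (\<forall>\<omega>\<in>\<Omega>0. \<forall>x\<in>G \<omega>. \<exists>Nx :: nat. \<forall>n\<ge>Nx.
           ennreal (ln (real n) powr (- \<beta>1)) / v (time_inverse v r (of_nat n))
             \<le> ennreal (heat_kernel (E \<omega>) (X \<omega>) (P \<omega>) (2 * n) x x) \<and>
           ennreal (heat_kernel (E \<omega>) (X \<omega>) (P \<omega>) (2 * n) x x)
             \<le> ennreal (ln (real n) powr \<beta>1) / v (time_inverse v r (of_nat n))) \<and>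
        (\<forall>\<omega>\<in>\<Omega>0. \<forall>x\<in>G \<omega>. \<exists>Rx :: real. \<forall>R\<ge>Rx.
           ennreal (ln R powr (- \<beta>2)) * v (ennreal R) * r (ennreal R)
             \<le> mean_exit_time (G \<omega>) (z \<omega>) (d \<omega>) (X \<omega>) (P \<omega>) x R \<and>
           mean_exit_time (G \<omega>) (z \<omega>) (d \<omega>) (X \<omega>) (P \<omega>) x R
             \<le> ennreal (ln R powr \<beta>2) * v (ennreal R) * r (ennreal R)) \<and>
        (\<forall>\<omega>\<in>\<Omega>0. \<forall>x\<in>G \<omega>. \<exists>(Nx :: 'b \<Rightarrow> ennreal) (Rx :: 'b \<Rightarrow> ennreal).
           Nx \<in> borel_measurable N \<and> Rx \<in> borel_measurable N \<and>
           measure (P \<omega> x) {b \<in> space N. Nx b < \<infinity>} = 1 \<and>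
           measure (P \<omega> x) {b \<in> space N. Rx b < \<infinity>} = 1 \<and>
           (\<forall>b\<in>space N. \<forall>n :: nat. Nx b \<le> of_nat n \<longrightarrow>
              ennreal (ln (real n) powr (- \<beta>3)) * time_inverse v r (of_nat n)
                \<le> ennreal (max_displacement (z \<omega>) (d \<omega>) (X \<omega>) n b) \<and>
              ennreal (max_displacement (z \<omega>) (d \<omega>) (X \<omega>) n b)
                \<le> ennreal (ln (real n) powr \<beta>3) * time_inverse v r (of_nat n)) \<and>
           (\<forall>b\<in>space N. \<forall>R :: real. Rx b \<le> ennreal R \<longrightarrow>
              ennreal (ln R powr (- \<beta>4)) * v (ennreal R) * r (ennreal R)
                \<le> exit_time (G \<omega>) (z \<omega>) (d \<omega>) (X \<omega>) R b \<and>
              exit_time (G \<omega>) (z \<omega>) (d \<omega>) (X \<omega>) R b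
                \<le> ennreal (ln R powr \<beta>4) * v (ennreal R) * r (ennreal R)))))
     \<and>
     ((\<exists>q0 c. q0 > 0 \<and> c > 0 \<and> (\<forall>l\<ge>l0. p l \<le> exp (- c * l powr q0))) \<longrightarrow>
      (\<exists>\<beta>1 \<beta>2 :: real. \<exists>\<Omega>0 \<in> sets M. measure M \<Omega>0 = 1 \<and>
        (\<forall>\<omega>\<in>\<Omega>0. \<forall>x\<in>G \<omega>. \<exists>(Nx :: nat) (Rx :: real).
          (\<forall>n\<ge>Nx.
             ennreal (ln (ln (real n)) powr (- \<beta>1)) / v (time_inverse v r (of_nat n))
               \<le> ennreal (heat_kernel (E \<omega>) (X \<omega>) (P \<omega>) (2 * n) x x) \<and>
             ennreal (heat_kernel (E \<omega>) (X \<omega>) (P \<omega>) (2 * n) x x)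
               \<le> ennreal (ln (ln (real n)) powr \<beta>1) / v (time_inverse v r (of_nat n))) \<and>
          (\<forall>R\<ge>Rx.
             ennreal (ln (ln R) powr (- \<beta>2)) * v (ennreal R) * r (ennreal R)
               \<le> mean_exit_time (G \<omega>) (z \<omega>) (d \<omega>) (X \<omega>) (P \<omega>) x R \<and>
             mean_exit_time (G \<omega>) (z \<omega>) (d \<omega>) (X \<omega>) (P \<omega>) x R
               \<le> ennreal (ln (ln R) powr \<beta>2) * v (ennreal R) * r (ennreal R)))))
     \<and>
     (\<forall>C3 C4 D \<alpha> m1 m2 :: real.
       (\<exists>q0 c. q0 > 0 \<and> c > 0 \<and> (\<forall>l\<ge>l0. p l \<le> c * l powr (- q0))) \<and>
       C3 \<ge> 1 \<and> C4 \<ge> 1 \<and> D \<ge> 1 \<and> 0 < \<alpha> \<and> \<alpha> \<le> 1 \<and> m1 > 0 \<and> m2 > 0 \<and>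
       (\<forall>R :: real. R \<ge> 2 \<longrightarrow>
          ennreal (inverse C3 * R powr D * ln R powr (- m1)) \<le> v (ennreal R) \<and>
          v (ennreal R) \<le> ennreal (C3 * R powr D * ln R powr m1) \<and>
          ennreal (inverse C4 * R powr \<alpha> * ln R powr (- m2)) \<le> r (ennreal R) \<and>
          r (ennreal R) \<le> ennreal (C4 * R powr \<alpha> * ln R powr m2)) \<longrightarrow>
       (\<exists>\<Omega>0 \<in> sets M. measure M \<Omega>0 = 1 \<and>
         (\<forall>\<omega>\<in>\<Omega>0. \<forall>x\<in>G \<omega>.
           (\<lambda>n. - 2 * (ln (heat_kernel (E \<omega>) (X \<omega>) (P \<omega>) (2 * n) x x) / ln (real n)))
             \<longlonglongrightarrow> 2 * D / (D + \<alpha>) \<and>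
           recurrent_walk (G \<omega>) (X \<omega>) (P \<omega>) \<and>
           (\<forall>\<^sub>F R in at_top. mean_exit_time (G \<omega>) (z \<omega>) (d \<omega>) (X \<omega>) (P \<omega>) x R < \<infinity>) \<and>
           ((\<lambda>R. ln (enn2real (mean_exit_time (G \<omega>) (z \<omega>) (d \<omega>) (X \<omega>) (P \<omega>) x R)) / ln R)
             \<longlongrightarrow> D + \<alpha>) at_top \<and>
           (AE b in P \<omega> x.
             (\<lambda>n. ln (range_volume (E \<omega>) (X \<omega>) n b) / ln (real n))
               \<longlonglongrightarrow> D / (D + \<alpha>)))))"
proof -
  interpret growth_pair v r C1 C2 d1 d2 \<alpha>1 \<alpha>2
    by unfold_locales (fact assms)+
  note l0 = assms(13)
  note environments = good_environments[OF assms(1,2,3,15)]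
  have polynomial: "\<exists>a\<ge>1. \<exists>\<Omega>0 \<in> sets M. measure M \<Omega>0 = 1 \<and> (\<forall>\<omega>\<in>\<Omega>0. \<exists>lam.
      polynomial_environment (G \<omega>) (E \<omega>) (z \<omega>) (d \<omega>) v_real r_real growth_const \<alpha>1 volume_exponent gap_exponent N (X \<omega>) (P \<omega>) lam (\<lambda>t. ln t ^ a))"
    if ex: "\<exists>q0 c. q0 > 0 \<and> c > 0 \<and> (\<forall>l\<ge>l0. p l \<le> c * l powr (- q0))"
  proof -
    obtain q0 c where q0: "q0 > 0" and c: "c > 0" and p: "\<And>l. l \<ge> l0 \<Longrightarrow> p l \<le> c * l powr (- q0)"
      using ex by blast
    \<comment> \<open>\<open>a * q0 \<ge> 2\<close> makes \<open>p (L j)\<close> summable, and \<open>a \<ge> 2\<close> makes \<open>1 / L j\<close> summable\<close>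
    define a where "a = max 2 (nat \<lceil>2 / q0\<rceil>)"
    have a: "a \<ge> 2" "2 / q0 \<le> real a" unfolding a_def by (auto simp: max_def) linarith+
    define L where "L j = l0 + real j ^ a" for j
    have L: "admissible L (\<lambda>t. ln t ^ (a + 1))"
      unfolding L_def using l0 a by (intro admissible_power) auto
    have Ll: "L j \<ge> l0" for j by (simp add: L_def)
    obtain \<Omega>0 where \<Omega>: "\<Omega>0 \<in> sets M" "measure M \<Omega>0 = 1"
      "\<And>\<omega>. \<omega> \<in> \<Omega>0 \<Longrightarrow> gauged_environment (G \<omega>) (E \<omega>) (z \<omega>) (d \<omega>) v_real r_real growth_const \<alpha>1 volume_exponent gap_exponent N (X \<omega>) (P \<omega>)
         (\<lambda>i. L (2 * i)) (\<lambda>t. ln t ^ (a + 1))"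
    proof (rule environments[OF L Ll])
      show "p (L j) \<le> c * L j powr (- q0)" for j by (rule p[OF Ll])
      show "summable (\<lambda>j. c * L j powr (- q0))"
        unfolding L_def by (rule summable_power_tail[OF c q0 l0 a(2)])
    qed (rule that)
    have "polynomial_environment (G \<omega>) (E \<omega>) (z \<omega>) (d \<omega>) v_real r_real growth_const \<alpha>1 volume_exponent gap_exponent N (X \<omega>) (P \<omega>)
        (\<lambda>i. L (2 * i)) (\<lambda>t. ln t ^ (a + 1))" if "\<omega> \<in> \<Omega>0" for \<omega>
      using \<Omega>(3)[OF that] unfolding L_def by (rule polynomial_environmentI[OF _ a(1) l0])
    with \<Omega>(1,2) show ?thesis by (intro exI[of _ "a + 1"]) auto
  qed
  have ln_pos: "\<forall>\<^sub>F t::real in at_top. ln t > 0"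
    using eventually_gt_at_top[of 1] by eventually_elim simp
  have ln_ln_pos: "\<forall>\<^sub>F t::real in at_top. ln (ln t) > 0"
    by (rule eventually_compose_filterlim[OF ln_pos ln_at_top])
  show ?thesis
  proof (intro conjI impI allI, goal_cases)
    case 1
    obtain a \<Omega>0 where \<Omega>: "\<Omega>0 \<in> sets M" "measure M \<Omega>0 = 1" and "\<forall>\<omega>\<in>\<Omega>0. \<exists>lam.
      polynomial_environment (G \<omega>) (E \<omega>) (z \<omega>) (d \<omega>) v_real r_real growth_const \<alpha>1 volume_exponent gap_exponent N (X \<omega>) (P \<omega>) lam (\<lambda>t. ln t ^ a)"
      using polynomial[OF 1] by blast
    then obtain lam where env: "\<And>\<omega>. \<omega> \<in> \<Omega>0 \<Longrightarrow>
      polynomial_environment (G \<omega>) (E \<omega>) (z \<omega>) (d \<omega>) v_real r_real growth_const \<alpha>1 volume_exponent gap_exponent N (X \<omega>) (P \<omega>) (lam \<omega>) (\<lambda>t. ln t ^ a)"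
      by metis
    note env' = polynomial_environment.axioms(1)[OF env]
    show ?case
      by (rule exI[of _ "real (a * total_loss)"], rule exI[of _ "real (a * total_loss)"],
          rule exI[of _ "real (a * total_loss)"], rule exI[of _ "real (a * total_loss)"],
          intro bexI[OF _ \<Omega>(1)] conjI[OF \<Omega>(2)] conjI ballI)
        (rule heat_kernel_conclusion[OF env' refl ln_pos] mean_exit_conclusion[OF env' refl ln_pos]
          path_conclusion[OF env refl ln_pos]; assumption)+
  next
    case 2
    then obtain q0 c where q0: "q0 > 0" and c: "c > 0" and p: "\<And>l. l \<ge> l0 \<Longrightarrow> p l \<le> exp (- c * l powr q0)"
      by blast
    \<comment> \<open>with this choice \<open>p (L j) \<le> (j + 1) powr (- 2)\<close>\<close>
    define L where "L j = l0 + (2 / c * ln (real j + 1)) powr (1 / q0)" for j :: nat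
    define a where "a = nat \<lceil>1 / q0\<rceil> + 1"
    have L: "admissible L (\<lambda>t. ln (ln t) ^ a)"
      unfolding L_def a_def using l0 c q0 by (intro admissible_log_power) auto
    have Ll: "L j \<ge> l0" for j by (simp add: L_def)
    obtain \<Omega>0 where \<Omega>: "\<Omega>0 \<in> sets M" "measure M \<Omega>0 = 1"
      and env: "\<And>\<omega>. \<omega> \<in> \<Omega>0 \<Longrightarrow> gauged_environment (G \<omega>) (E \<omega>) (z \<omega>) (d \<omega>) v_real r_real growth_const \<alpha>1 volume_exponent gap_exponent N (X \<omega>) (P \<omega>)
         (\<lambda>i. L (2 * i)) (\<lambda>t. ln (ln t) ^ a)"
    proof (rule environments[OF L Ll])
      show "p (L j) \<le> 1 / (real (Suc j))\<^sup>2" for j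
      proof -
        have "2 / c * ln (real j + 1) = ((2 / c * ln (real j + 1)) powr (1 / q0)) powr q0"
          using q0 c by (simp add: powr_powr)
        also have "\<dots> \<le> L j powr q0" unfolding L_def using q0 l0 by (intro powr_mono2) auto
        finally have "2 * ln (real j + 1) \<le> c * L j powr q0" using c by (simp add: field_simps)
        then have "exp (- c * L j powr q0) \<le> exp (- (2 * ln (real j + 1)))" by simp
        also have "\<dots> = 1 / (real (Suc j))\<^sup>2"
          by (simp add: exp_minus exp_double power2_eq_square inverse_eq_divide add.commute flip: exp_of_nat_mult)
        finally show ?thesis using p[OF Ll, of j] by linarith
      qed
      have "summable (\<lambda>j. 1 / (real j)\<^sup>2)"
        using inverse_power_summable[of 2, where 'a=real] by (simp add: inverse_eq_divide)
      then show "summable (\<lambda>j. 1 / (real (Suc j))\<^sup>2)" by (subst summable_Suc_iff)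
    qed (rule that)
    show ?case
    proof (intro exI[of _ "real (a * total_loss)"] bexI[OF _ \<Omega>(1)] conjI ballI \<Omega>(2))
      fix \<omega> x assume "\<omega> \<in> \<Omega>0" "x \<in> G \<omega>"
      from heat_kernel_conclusion[OF env[OF this(1)] refl ln_ln_pos this(2)]
        mean_exit_conclusion[OF env[OF this(1)] refl ln_ln_pos this(2)]
      show "\<exists>(Nx :: nat) (Rx :: real).
          (\<forall>n\<ge>Nx.
             ennreal (ln (ln (real n)) powr (- real (a * total_loss))) / v (time_inverse v r (of_nat n))
               \<le> ennreal (heat_kernel (E \<omega>) (X \<omega>) (P \<omega>) (2 * n) x x) \<and>
             ennreal (heat_kernel (E \<omega>) (X \<omega>) (P \<omega>) (2 * n) x x)
               \<le> ennreal (ln (ln (real n)) powr real (a * total_loss)) / v (time_inverse v r (of_nat n))) \<and>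
          (\<forall>R\<ge>Rx.
             ennreal (ln (ln R) powr (- real (a * total_loss))) * v (ennreal R) * r (ennreal R)
               \<le> mean_exit_time (G \<omega>) (z \<omega>) (d \<omega>) (X \<omega>) (P \<omega>) x R \<and>
             mean_exit_time (G \<omega>) (z \<omega>) (d \<omega>) (X \<omega>) (P \<omega>) x R
               \<le> ennreal (ln (ln R) powr real (a * total_loss)) * v (ennreal R) * r (ennreal R))" by blast
    qed
  next
    case (3 C3 C4 D \<alpha> m1 m2)
    then have p: "\<exists>q0 c. q0 > 0 \<and> c > 0 \<and> (\<forall>l\<ge>l0. p l \<le> c * l powr (- q0))"
      and C: "C3 \<ge> 1" "C4 \<ge> 1" and D: "D \<ge> 1" and \<alpha>: "0 < \<alpha>"
      and bd: "\<And>R :: real. R \<ge> 2 \<Longrightarrow>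
          ennreal (inverse C3 * R powr D * ln R powr (- m1)) \<le> ennreal (v_real R) \<and>
          ennreal (v_real R) \<le> ennreal (C3 * R powr D * ln R powr m1) \<and>
          ennreal (inverse C4 * R powr \<alpha> * ln R powr (- m2)) \<le> ennreal (r_real R) \<and>
          ennreal (r_real R) \<le> ennreal (C4 * R powr \<alpha> * ln R powr m2)"
      unfolding v_eq r_eq by blast+
    have v_lim: "((\<lambda>R. ln (v_real R) / ln R) \<longlongrightarrow> D) at_top"
    proof (rule log_growth_limit[OF C(1) v_pos])
      fix R :: real assume "R \<ge> 2"
      then show "inverse C3 * R powr D * ln R powr (- m1) \<le> v_real R \<and> v_real R \<le> C3 * R powr D * ln R powr m1"
        using bd[of R] C v_pos[of R] by (simp add: ennreal_le_iff)
    qed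
    have r_lim: "((\<lambda>R. ln (r_real R) / ln R) \<longlongrightarrow> \<alpha>) at_top"
    proof (rule log_growth_limit[OF C(2) r_pos])
      fix R :: real assume "R \<ge> 2"
      then show "inverse C4 * R powr \<alpha> * ln R powr (- m2) \<le> r_real R \<and> r_real R \<le> C4 * R powr \<alpha> * ln R powr m2"
        using bd[of R] C r_pos[of R] by (simp add: ennreal_le_iff)
    qed
    obtain a \<Omega>0 where \<Omega>: "\<Omega>0 \<in> sets M" "measure M \<Omega>0 = 1" and env: "\<forall>\<omega>\<in>\<Omega>0. \<exists>lam.
      polynomial_environment (G \<omega>) (E \<omega>) (z \<omega>) (d \<omega>) v_real r_real growth_const \<alpha>1 volume_exponent gap_exponent N (X \<omega>) (P \<omega>) lam (\<lambda>t. ln t ^ a)"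
      using polynomial[OF p] by blast
    show ?case
    proof (intro bexI[OF _ \<Omega>(1)] conjI[OF \<Omega>(2)] ballI)
      fix \<omega> x assume "\<omega> \<in> \<Omega>0" and x: "x \<in> G \<omega>"
      then obtain lam where "polynomial_environment (G \<omega>) (E \<omega>) (z \<omega>) (d \<omega>) v_real r_real growth_const \<alpha>1 volume_exponent gap_exponent N (X \<omega>) (P \<omega>) lam (\<lambda>t. ln t ^ a)"
        using env by blast
      from limits_conclusion[OF D \<alpha> v_lim r_lim this x]
      show "(\<lambda>n. - 2 * (ln (heat_kernel (E \<omega>) (X \<omega>) (P \<omega>) (2 * n) x x) / ln (real n)))
             \<longlonglongrightarrow> 2 * D / (D + \<alpha>) \<and>
           recurrent_walk (G \<omega>) (X \<omega>) (P \<omega>) \<and>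
           (\<forall>\<^sub>F R in at_top. mean_exit_time (G \<omega>) (z \<omega>) (d \<omega>) (X \<omega>) (P \<omega>) x R < \<infinity>) \<and>
           ((\<lambda>R. ln (enn2real (mean_exit_time (G \<omega>) (z \<omega>) (d \<omega>) (X \<omega>) (P \<omega>) x R)) / ln R)
             \<longlongrightarrow> D + \<alpha>) at_top \<and>
           (AE b in P \<omega> x.
             (\<lambda>n. ln (range_volume (E \<omega>) (X \<omega>) n b) / ln (real n))
               \<longlonglongrightarrow> D / (D + \<alpha>))" .
    qed
  qed
qed

end
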